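(* Let $r\in[0,\infty]$. There is a Baire generic subset of $\mathcal{AK}^r$ such that every map $f$ in this subset has exactly two ergodic invariant probability measures, these two measures are supported on different boundary components of the annulus $\mathbb{A}$, and moreover $f$ is maximally oscillating.
   Context: $\mathbb{A}=[0,1]\times\mathbb{R}/\mathbb{Z}$ is the closed annulus, with Lebesgue measure as reference probability measure ("almost every" refers to it). $\mathrm{Diff}^r_+(\mathbb{A})$ is the space of orientation preserving $C^r$ diffeomorphisms of $\mathbb{A}$ with the $C^r$ topology (homeomorphisms if $r=0$). Rotations are the maps $R_\alpha(s,\theta)=(s,\theta+\alpha)$, $\alpha\in\mathbb{R}$. The space $\mathcal{AK}^r$ of $C^r$ Anosov-Katok maps is the $C^r$-closure (in $\mathrm{Diff}^r_+(\mathbb{A})$) of the set of all $C^r$ diffeomorphisms of $\mathbb{A}$ that are $C^r$-conjugate to a rotation, with the induced $C^r$ topology; it is a Baire space. A subset of a topological space is Baire generic if it contains a countable intersection of open dense subsets. The empirical measures of a map $f$ at a point $x$ are $e_n^f(x)=\frac1n\sum_{i=0}^{n-1}\delta_{f^i(x)}$, $n\ge 1$. A map $f$ is maximally oscillating if for almost every point $x$, every $f$-invariant Borel probability measure is the weak-$*$ limit of some subsequence of $\{e_n^f(x)\}_n$. *)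

theory Defs
  imports
    "HOL-Complex_Analysis.Complex_Analysis"
    "HOL-Probability.Probability"
    "HOL-Library.Extended_Nat"
begin

section \<open>The closed annulus\<close>

text \<open>
  The circle \<open>\<real>/\<int>\<close> is identified with the unit circle of the complex plane by
  \<open>\<theta> \<mapsto> exp (2 \<pi> i \<theta>)\<close>, so that the annulus is a compact subset of
  \<open>\<real> \<times> \<complex>\<close> and \<open>ann_proj\<close> is its universal covering.
\<close>

type_synonym pt = "real \<times> complex"

definition annulus :: "pt set" where
  "annulus = {0..1} \<times> sphere 0 1"

definition strip :: "(real \<times> real) set" where
  "strip = {0..1} \<times> UNIV"

definition ann_proj :: "real \<times> real \<Rightarrow> pt" where
  "ann_proj = (\<lambda>(s, t). (s, cis (2 * pi * t)))"

definition rotation :: "real \<Rightarrow> pt \<Rightarrow> pt" where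
  "rotation \<alpha> = (\<lambda>(s, z). (s, cis (2 * pi * \<alpha>) * z))"

definition boundary_component :: "real \<Rightarrow> pt set" where
  "boundary_component s = {s} \<times> sphere 0 1"


section \<open>\<open>C\<^sup>r\<close> maps\<close>

text \<open>
  The annulus is an embedded submanifold of \<open>\<real> \<times> \<complex>\<close> and \<open>ann_proj\<close> is a local
  diffeomorphism from the strip onto it. Hence a self-map \<open>f\<close> of the annulus is \<open>C\<^sup>k\<close> iff
  \<open>f \<circ> ann_proj\<close> is \<open>C\<^sup>k\<close> on the strip as a map into \<open>\<real> \<times> \<complex>\<close>, and the \<open>C\<^sup>k\<close> topology is
  that of uniform convergence of the partial derivatives of \<open>f \<circ> ann_proj\<close> up to order \<open>k\<close>.
  Derivatives are taken within the strip, i.e. they are one-sided across its boundary.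
\<close>

definition dir_deriv ::
  "real \<times> real \<Rightarrow> (real \<times> real \<Rightarrow> 'b::real_normed_vector) \<Rightarrow> real \<times> real \<Rightarrow> 'b" where
  "dir_deriv v g = (\<lambda>p. frechet_derivative g (at p within strip) v)"

definition partials ::
  "(real \<times> real) list \<Rightarrow> (real \<times> real \<Rightarrow> 'b::real_normed_vector) \<Rightarrow> real \<times> real \<Rightarrow> 'b" where
  "partials vs g = foldr dir_deriv vs g"

definition Ck_strip :: "nat \<Rightarrow> (real \<times> real \<Rightarrow> 'b::real_normed_vector) \<Rightarrow> bool" where
  "Ck_strip k g \<longleftrightarrow>
     (\<forall>vs. set vs \<subseteq> Basis \<and> length vs < k \<longrightarrow> partials vs g differentiable_on strip) \<and>
     (\<forall>vs. set vs \<subseteq> Basis \<and> length vs \<le> k \<longrightarrow> continuous_on strip (partials vs g))"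

definition Cr_map :: "enat \<Rightarrow> (pt \<Rightarrow> pt) \<Rightarrow> bool" where
  "Cr_map r f \<longleftrightarrow> (\<forall>k. enat k \<le> r \<longrightarrow> Ck_strip k (f \<circ> ann_proj))"

text \<open>Self-maps of the annulus are represented by functions that are extensional on it.\<close>

definition Diff_ann :: "enat \<Rightarrow> (pt \<Rightarrow> pt) set" where
  "Diff_ann r =
     {f \<in> extensional annulus.
        \<exists>g. homeomorphism annulus annulus f g \<and> Cr_map r f \<and> Cr_map r g}"


section \<open>Orientation\<close>

text \<open>
  The annulus is embedded into the plane as \<open>{w. 1 \<le> \<bar>w\<bar> \<le> 2}\<close> by \<open>(s, z) \<mapsto> (1 + s) z\<close>. A
  homeomorphism preserves orientation iff its local degree at each interior point is \<open>1\<close>, i.e.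
  small positively oriented circles around a point \<open>w\<close> are mapped to loops that wind once
  around the image of \<open>w\<close>. This makes sense without differentiability.
\<close>

definition to_plane :: "pt \<Rightarrow> complex" where
  "to_plane = (\<lambda>(s, z). of_real (1 + s) * z)"

definition from_plane :: "complex \<Rightarrow> pt" where
  "from_plane w = (norm w - 1, sgn w)"

definition orientation_preserving :: "(pt \<Rightarrow> pt) \<Rightarrow> bool" where
  "orientation_preserving f \<longleftrightarrow>
     (let F = to_plane \<circ> f \<circ> from_plane in
      \<forall>w \<epsilon>. 0 < \<epsilon> \<and> cball w \<epsilon> \<subseteq> {u. 1 < norm u \<and> norm u < 2} \<longrightarrow>
        winding_number (F \<circ> circlepath w \<epsilon>) (F w) = 1)"

definition Diff_plus :: "enat \<Rightarrow> (pt \<Rightarrow> pt) set" where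
  "Diff_plus r = {f \<in> Diff_ann r. orientation_preserving f}"


section \<open>The \<open>C\<^sup>r\<close> topology and Anosov-Katok maps\<close>

text \<open>
  All partial derivatives are continuous and 1-periodic in the second variable, so the strict
  pointwise bound below amounts to the strict bound on the \<open>C\<^sup>k\<close> distance. For \<open>r = \<infinity>\<close> balls of
  every finite order \<open>k\<close> are used.
\<close>

definition Ck_ball :: "enat \<Rightarrow> nat \<Rightarrow> (pt \<Rightarrow> pt) \<Rightarrow> real \<Rightarrow> (pt \<Rightarrow> pt) set" where
  "Ck_ball r k f \<epsilon> =
     {g \<in> Diff_plus r. \<forall>vs. set vs \<subseteq> Basis \<and> length vs \<le> k \<longrightarrow>
        (\<forall>p\<in>strip. norm (partials vs (g \<circ> ann_proj) p - partials vs (f \<circ> ann_proj) p) < \<epsilon>)}"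

definition Diff_top :: "enat \<Rightarrow> (pt \<Rightarrow> pt) topology" where
  "Diff_top r =
     topology_generated_by {Ck_ball r k f \<epsilon> | k f \<epsilon>. enat k \<le> r \<and> f \<in> Diff_plus r \<and> 0 < \<epsilon>}"

lemma topspace_Diff_top: "topspace (Diff_top r) = Diff_plus r"
proof -
  let ?B = "{Ck_ball r k f \<epsilon> | k f \<epsilon>. enat k \<le> r \<and> f \<in> Diff_plus r \<and> 0 < \<epsilon>}"
  have "\<Union>?B = Diff_plus r"
  proof (intro equalityI subsetI)
    fix f assume "f \<in> \<Union>?B"
    then show "f \<in> Diff_plus r"
      unfolding Ck_ball_def by blast
  next
    fix f assume f: "f \<in> Diff_plus r"
    have "f \<in> Ck_ball r 0 f 1"
      using f unfolding Ck_ball_def by simp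
    moreover have "Ck_ball r 0 f 1 \<in> ?B"
    proof -
      have "enat 0 \<le> r"
        by (simp flip: zero_enat_def)
      then show ?thesis
        using f zero_less_one by blast
    qed
    ultimately show "f \<in> \<Union>?B"
      by (rule UnionI[rotated])
  qed
  then show ?thesis
    unfolding Diff_top_def by (simp only: topology_generated_by_topspace)
qed

definition rotation_conjugates :: "enat \<Rightarrow> (pt \<Rightarrow> pt) set" where
  "rotation_conjugates r =
     {f \<in> Diff_plus r. \<exists>h\<in>Diff_ann r. \<exists>\<alpha>. \<forall>p\<in>annulus. f (h p) = h (rotation \<alpha> p)}"

definition AK_space :: "enat \<Rightarrow> (pt \<Rightarrow> pt) topology" where
  "AK_space r = subtopology (Diff_top r) (Diff_top r closure_of rotation_conjugates r)"

definition baire_generic :: "'a topology \<Rightarrow> 'a set \<Rightarrow> bool" where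
  "baire_generic X G \<longleftrightarrow>
     G \<subseteq> topspace X \<and>
     (\<exists>\<U>. countable \<U> \<and> (\<forall>U\<in>\<U>. openin X U \<and> X closure_of U = topspace X) \<and>
          topspace X \<inter> \<Inter>\<U> \<subseteq> G)"


section \<open>Invariant measures and oscillation\<close>

definition annulus_borel :: "pt measure" where
  "annulus_borel = restrict_space borel annulus"

definition annulus_lebesgue :: "pt measure" where
  "annulus_lebesgue =
     distr (restrict_space lborel ({0..1} \<times> {0..<1})) annulus_borel ann_proj"

definition invariant_measures :: "(pt \<Rightarrow> pt) \<Rightarrow> pt measure set" where
  "invariant_measures f =
     {\<mu>. prob_space \<mu> \<and> sets \<mu> = sets annulus_borel \<and> distr \<mu> \<mu> f = \<mu>}"

definition ergodic_measures :: "(pt \<Rightarrow> pt) \<Rightarrow> pt measure set" where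
  "ergodic_measures f =
     {\<mu> \<in> invariant_measures f.
        \<forall>B\<in>sets \<mu>. f -` B \<inter> space \<mu> = B \<longrightarrow> measure \<mu> B = 0 \<or> measure \<mu> B = 1}"

text \<open>
  The image of the uniform probability on \<open>{0..<n}\<close> under \<open>i \<mapsto> f\<^sup>i(x)\<close> gives each
  orbit point its multiplicity.
\<close>

definition empirical_measure :: "(pt \<Rightarrow> pt) \<Rightarrow> pt \<Rightarrow> nat \<Rightarrow> pt measure" where
  "empirical_measure f x n =
     distr (uniform_count_measure {..<n}) annulus_borel (\<lambda>i. (f ^^ i) x)"

definition weak_star_limit :: "(nat \<Rightarrow> pt measure) \<Rightarrow> pt measure \<Rightarrow> bool" where
  "weak_star_limit M \<mu> \<longleftrightarrow>
     (\<forall>\<phi>::pt \<Rightarrow> real. continuous_on annulus \<phi> \<longrightarrow>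
        (\<lambda>n. integral\<^sup>L (M n) \<phi>) \<longlonglongrightarrow> integral\<^sup>L \<mu> \<phi>)"

definition maximally_oscillating :: "(pt \<Rightarrow> pt) \<Rightarrow> bool" where
  "maximally_oscillating f \<longleftrightarrow>
     (AE x in annulus_lebesgue. \<forall>\<mu>\<in>invariant_measures f.
        \<exists>\<sigma>. strict_mono \<sigma> \<and> 1 \<le> \<sigma> 0 \<and>
            weak_star_limit (\<lambda>j. empirical_measure f x (\<sigma> j)) \<mu>)"

end

theory Submission
  imports Defs "HOL-Number_Theory.Cong"
begin

text \<open>
  A map \<open>f\<close> is said here to oscillate at time \<open>n\<close> with weight \<open>c\<close>, up to an error \<open>\<epsilon>\<close> and for
  finitely many test functions, if three things hold for its Birkhoff averages of length \<open>n\<close>: on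
  each boundary circle they are constant up to \<open>\<epsilon>\<close>; every orbit spends almost all of its time close
  to the boundary; and outside a set of Lebesgue measure \<open>\<epsilon>\<close> the average at a point is, up to \<open>\<epsilon>\<close>,
  the mixture of the two boundary averages with weights \<open>1 - c\<close> and \<open>c\<close> (\<open>oscillates_at\<close>). Only \<open>n\<close>
  iterates enter, so the condition is open already in the \<open>C\<^sup>0\<close> topology. Letting \<open>c\<close> run through
  the rationals of \<open>[0,1]\<close>, the test functions through finite sets of monomials, \<open>\<epsilon>\<close> to \<open>0\<close> and \<open>n\<close>
  to infinity gives countably many open conditions. They define a Baire generic set
  (\<open>baire_generic_generic_maps\<close>) once each of them is dense.

  Density is the Anosov-Katok argument (\<open>oscillating_perturbation\<close>). The conjugates
  \<open>h \<circ> R\<^sub>\<alpha> \<circ> h\<^sup>-\<^sup>1\<close> depend continuously on \<open>\<alpha>\<close> (\<open>continuous_map_rot_conj\<close>), so \<open>\<alpha> = p/q\<close> may be assumed,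
  with \<open>q\<close> as large as desired. If \<open>\<psi>\<close> commutes with \<open>R\<^sub>p\<^sub>/\<^sub>q\<close>, then replacing \<open>h\<close> by \<open>h \<circ> \<psi>\<close> does not
  change the map, however wild \<open>\<psi>\<close> is; and replacing \<open>p/q\<close> by a very close fraction \<open>P/Q\<close> then
  changes it only a little. For \<open>P/Q\<close> in lowest terms an orbit of length \<open>Q\<close> is the image under
  \<open>h \<circ> \<psi>\<close> of \<open>Q\<close> equally spaced points of a circle, so that the Birkhoff average of length \<open>Q\<close> is
  decided by where \<open>\<psi>\<close> puts these points, and this is a matter of counting. The diffeomorphism
  \<open>\<psi>\<close> pushes the part of a circle lying over a proportion \<open>1 - d\<close> of each of the \<open>q\<close> cells to the
  boundary circle \<open>s = 1\<close> and the rest to \<open>s = 0\<close>, the transition being so fast that all circles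
  spend little time in the interior (\<open>birkhoff_interior\<close>). A reparametrisation of the angle by a
  hyperbolic Moebius map stretches the points where nothing is pushed over nearly the whole circle.
  Consequently most points of the annulus lie on images of circles that are not too close to the
  boundary, and those circles are distributed in the desired proportion (\<open>birkhoff_typical\<close>). When
  \<open>r = 0\<close> the map \<open>h\<close> may send null sets to sets of positive measure, so the exceptional set of \<open>\<psi>\<close> has
  to be small for the image of Lebesgue measure under \<open>h\<^sup>-\<^sup>1\<close>. About this measure nothing is known
  except that it does not charge the boundary, and \<open>\<psi>\<close> is rotated until its exceptional set is small
  (\<open>choose_phase\<close>).

  For a map in the generic set, integration of the Birkhoff averages against an invariant measure
  shows that this measure is carried by the boundary and that it is determined by the mass of one
  boundary circle (\<open>AE_boundary\<close>, \<open>invariant_unique\<close>). Each boundary circle carries an invariant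
  measure by the Krylov-Bogoliubov argument (\<open>invariant_on_boundary\<close>). These two measures are the
  ergodic ones, every invariant measure is a mixture of them, and for almost every point every
  mixture is a limit of empirical measures by the third condition.
\<close>

section \<open>Families of \<open>C\<^sup>k\<close> maps on the strip\<close>

text \<open>
  A family \<open>F\<close> of \<open>C\<^sup>k\<close> maps all of whose partial derivatives depend continuously on the parameter
  and on the point jointly. A constant family is a single \<open>C\<^sup>k\<close> map; families are used to see that a
  conjugate of \<open>R\<^sub>\<alpha>\<close> moves continuously with \<open>\<alpha>\<close>. Here the derivatives are taken innermost
  first, which suits inductive proofs about products and composites.
\<close>
primrec Ckfam ::
  "nat \<Rightarrow> ('p::topological_space \<Rightarrow> real \<times> real \<Rightarrow> 'b::real_normed_vector) \<Rightarrow> bool" where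
  "Ckfam 0 F \<longleftrightarrow> continuous_on (UNIV \<times> strip) (\<lambda>(a, p). F a p)"
| "Ckfam (Suc k) F \<longleftrightarrow> continuous_on (UNIV \<times> strip) (\<lambda>(a, p). F a p) \<and>
     (\<forall>a. F a differentiable_on strip) \<and> (\<forall>v\<in>Basis. Ckfam k (\<lambda>a. dir_deriv v (F a)))"

text \<open>
  In every coordinate direction one can move inside the strip, on at least one side, also at its
  boundary. This is what makes derivatives within the strip unique.
\<close>
lemma strip_not_isolated:
  assumes "p \<in> strip" "i \<in> Basis" "(e::real) > 0"
  shows "\<exists>d. 0 < \<bar>d\<bar> \<and> \<bar>d\<bar> < e \<and> p + d *\<^sub>R i \<in> strip"
proof -
  obtain s t where p: "p = (s, t)" "0 \<le> s" "s \<le> 1"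
    using assms(1) by (auto simp: strip_def)
  have i: "i = (1, 0) \<or> i = (0, 1)"
    using assms(2) by (auto simp: Basis_prod_def)
  define d where "d = (if s \<le> 1/2 then min (e/2) (1/2) else - min (e/2) (1/2))"
  show ?thesis
    using i assms(3) p by (intro exI[of _ d]) (auto simp: d_def strip_def min_def)
qed

lemma frechet_derivative_strip:
  assumes "(g has_derivative g') (at p within strip)" "p \<in> strip"
  shows "frechet_derivative g (at p within strip) = g'"
proof -
  have "g differentiable (at p within strip)"
    using assms(1) by (auto simp: differentiable_def)
  then have "(g has_derivative frechet_derivative g (at p within strip)) (at p within strip)"
    by (simp add: frechet_derivative_works)
  then show ?thesis
    using assms strip_not_isolated by (intro frechet_derivative_unique_within) blast+
qed

lemma dir_deriv_eq:
  assumes "(g has_derivative g') (at p within strip)" "p \<in> strip"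
  shows "dir_deriv v g p = g' v"
  using frechet_derivative_strip[OF assms] by (simp add: dir_deriv_def)

lemma has_derivative_strip_cong:
  assumes "\<And>p. p \<in> strip \<Longrightarrow> f p = g p" "p \<in> strip"
  shows "(f has_derivative D) (at p within strip) \<longleftrightarrow> (g has_derivative D) (at p within strip)"
  using has_derivative_transform[of p strip f g D] has_derivative_transform[of p strip g f D] assms
  by metis

lemma dir_deriv_cong:
  assumes "\<And>p. p \<in> strip \<Longrightarrow> f p = g p" "p \<in> strip"
  shows "dir_deriv v f p = dir_deriv v g p"
  using has_derivative_strip_cong[OF assms] by (simp add: dir_deriv_def frechet_derivative_def)

lemma Ckfam_cong:
  assumes "\<And>a p. p \<in> strip \<Longrightarrow> F a p = G a p"
  shows "Ckfam k F \<longleftrightarrow> Ckfam k G"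
  using assms
proof (induction k arbitrary: F G)
  case 0
  then show ?case by (auto intro!: continuous_on_cong)
next
  case (Suc k)
  have "Ckfam k (\<lambda>a. dir_deriv v (F a)) \<longleftrightarrow> Ckfam k (\<lambda>a. dir_deriv v (G a))" for v
    by (intro Suc.IH dir_deriv_cong) (use Suc.prems in auto)
  moreover have "F a differentiable_on strip \<longleftrightarrow> G a differentiable_on strip" for a
    using has_derivative_strip_cong[of "F a" "G a"] Suc.prems
    by (auto simp: differentiable_on_def differentiable_def)
  moreover have "continuous_on (UNIV \<times> strip) (\<lambda>(a, p). F a p)
      \<longleftrightarrow> continuous_on (UNIV \<times> strip) (\<lambda>(a, p). G a p)"
    using Suc.prems by (auto intro!: continuous_on_cong)
  ultimately show ?case by simp
qed

lemma Ckfam_continuous: "Ckfam k F \<Longrightarrow> continuous_on (UNIV \<times> strip) (\<lambda>(a, p). F a p)"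
  by (cases k) auto

lemma Ckfam_SucI:
  assumes "continuous_on (UNIV \<times> strip) (\<lambda>(a, p). F a p)"
    and "\<And>a p. p \<in> strip \<Longrightarrow> (F a has_derivative F' a p) (at p within strip)"
    and "\<And>v. v \<in> Basis \<Longrightarrow> Ckfam k (\<lambda>a p. F' a p v)"
  shows "Ckfam (Suc k) F"
proof -
  have "F a differentiable_on strip" for a
    using assms(2) by (auto simp: differentiable_on_def differentiable_def)
  moreover have "Ckfam k (\<lambda>a. dir_deriv v (F a))" if "v \<in> Basis" for v
    using Ckfam_cong[of "\<lambda>a. dir_deriv v (F a)" "\<lambda>a p. F' a p v"] assms(2,3) that
    by (simp add: dir_deriv_eq)
  ultimately show ?thesis using assms(1) by simp
qed

lemma Ckfam_has_derivative:
  assumes "Ckfam (Suc k) F" "p \<in> strip"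
  shows "(F a has_derivative (\<lambda>v. dir_deriv v (F a) p)) (at p within strip)"
  using assms unfolding dir_deriv_def
  by (simp add: differentiable_on_def frechet_derivative_works)

lemma Ckfam_Suc_D: "Ckfam (Suc k) F \<Longrightarrow> Ckfam k F"
proof (induction k arbitrary: F)
  case 0
  then show ?case by simp
next
  case (Suc k)
  have "Ckfam k (\<lambda>a. dir_deriv v (F a))" if "v \<in> Basis" for v
    using Suc.prems that by (intro Suc.IH) simp
  then show ?case using Suc.prems by simp
qed

text \<open>
  The recursive notion agrees with the one through iterated partial derivatives. A nonempty list
  of directions is split at its end, where the innermost derivative sits.
\<close>
lemma Ckfam_iff_partials:
  "Ckfam k F \<longleftrightarrow>
    (\<forall>vs. set vs \<subseteq> Basis \<and> length vs < k \<longrightarrow> (\<forall>a. partials vs (F a) differentiable_on strip)) \<and>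
    (\<forall>vs. set vs \<subseteq> Basis \<and> length vs \<le> k \<longrightarrow>
      continuous_on (UNIV \<times> strip) (\<lambda>(a, p). partials vs (F a) p))"
proof (induction k arbitrary: F)
  case 0
  then show ?case by (simp add: partials_def)
next
  case (Suc k)
  have *: "(\<forall>vs. set vs \<subseteq> Basis \<and> Q (length vs) \<longrightarrow> P vs) \<longleftrightarrow>
      (Q 0 \<longrightarrow> P []) \<and>
      (\<forall>v::real\<times>real\<in>Basis. \<forall>vs. set vs \<subseteq> Basis \<and> Q (Suc (length vs)) \<longrightarrow> P (vs @ [v]))" (is "?L \<longleftrightarrow> ?R") for P Q
  proof
    assume ?R
    show ?L
    proof (intro allI impI)
      fix vs :: "(real \<times> real) list"
      assume "set vs \<subseteq> Basis \<and> Q (length vs)"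
      then show "P vs" using \<open>?R\<close> by (cases vs rule: rev_cases) auto
    qed
  qed auto
  have 1: "(\<forall>vs. set vs \<subseteq> Basis \<and> length vs < Suc k \<longrightarrow> (\<forall>a. partials vs (F a) differentiable_on strip))
    \<longleftrightarrow> (\<forall>a. F a differentiable_on strip) \<and>
      (\<forall>v\<in>Basis. \<forall>vs. set vs \<subseteq> Basis \<and> length vs < k \<longrightarrow>
        (\<forall>a. partials vs (dir_deriv v (F a)) differentiable_on strip))"
    by (subst *) (simp add: partials_def)
  have 2: "(\<forall>vs. set vs \<subseteq> Basis \<and> length vs \<le> Suc k \<longrightarrow>
      continuous_on (UNIV \<times> strip) (\<lambda>(a, p). partials vs (F a) p))
    \<longleftrightarrow> continuous_on (UNIV \<times> strip) (\<lambda>(a, p). F a p) \<and>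
      (\<forall>v\<in>Basis. \<forall>vs. set vs \<subseteq> Basis \<and> length vs \<le> k \<longrightarrow>
        continuous_on (UNIV \<times> strip) (\<lambda>(a, p). partials vs (dir_deriv v (F a)) p))"
    by (subst *) (simp add: partials_def)
  show ?case
    unfolding Ckfam.simps Suc.IH 1 2 ball_conj_distrib by (simp only: conj_ac)
qed

lemma continuous_on_const_family:
  "continuous_on (UNIV \<times> S) (\<lambda>(a::'p::topological_space, p). g p) \<longleftrightarrow> continuous_on S g"
proof
  assume "continuous_on (UNIV \<times> S) (\<lambda>(a::'p, p). g p)"
  then have "continuous_on S ((\<lambda>(a::'p, p). g p) \<circ> (\<lambda>p. (undefined, p)))"
    by (intro continuous_on_compose) (auto intro!: continuous_intros elim!: continuous_on_subset)
  then show "continuous_on S g" by (simp add: o_def)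
next
  assume "continuous_on S g"
  then have "continuous_on (UNIV \<times> S) (\<lambda>x::'p \<times> _. g (snd x))"
    by (rule continuous_on_compose2[OF _ continuous_on_snd[OF continuous_on_id]]) auto
  then show "continuous_on (UNIV \<times> S) (\<lambda>(a::'p, p). g p)"
    by (simp add: case_prod_unfold)
qed

lemma Ck_strip_iff: "Ck_strip k g \<longleftrightarrow> Ckfam k (\<lambda>_::'p::topological_space. g)"
  unfolding Ckfam_iff_partials Ck_strip_def continuous_on_const_family by auto

lemma Ckfam_instance:
  assumes "Ckfam k F" shows "Ck_strip k (F a)"
proof -
  have "continuous_on strip (\<lambda>p. partials vs (F a) p)"
    if "set vs \<subseteq> Basis \<and> length vs \<le> k" for vs
  proof -
    have "continuous_on (UNIV \<times> strip) (\<lambda>(a, p). partials vs (F a) p)"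
      using assms that by (simp add: Ckfam_iff_partials)
    then have "continuous_on strip ((\<lambda>(a, p). partials vs (F a) p) \<circ> Pair a)"
      by (intro continuous_on_compose) (auto intro!: continuous_intros elim!: continuous_on_subset)
    then show ?thesis by (simp add: o_def)
  qed
  then show ?thesis
    using assms unfolding Ckfam_iff_partials Ck_strip_def by auto
qed

lemma Ckfam_param:
  assumes "continuous_on UNIV c"
  shows "Ckfam k (\<lambda>a p. c a)"
proof -
  have cont: "continuous_on (UNIV \<times> strip) (\<lambda>(a, p::real\<times>real). c a)"
    by (auto simp: case_prod_unfold intro!: continuous_on_compose2[OF assms] continuous_intros)
  have zero: "Ckfam j (\<lambda>(a::'a) p. 0 :: 'b)" for j
  proof (induction j)
    case (Suc j)
    show ?case
      by (rule Ckfam_SucI[where F' = "\<lambda>_ _ _. 0"]) (simp_all add: case_prod_unfold Suc)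
  qed (simp add: case_prod_unfold)
  show ?thesis
  proof (cases k)
    case 0
    then show ?thesis using cont by simp
  next
    case (Suc j)
    show ?thesis unfolding Suc
      by (rule Ckfam_SucI[OF cont, where F' = "\<lambda>_ _ _. 0"]) (simp_all add: zero)
  qed
qed

lemma Ckfam_const: "Ckfam k (\<lambda>a p. c)"
  by (intro Ckfam_param continuous_intros)

lemma Ckfam_linear:
  assumes "bounded_linear L" "Ckfam k F"
  shows "Ckfam k (\<lambda>a p. L (F a p))"
  using assms(2)
proof (induction k arbitrary: F)
  case 0
  then show ?case
    using linear_continuous_on[OF assms(1)]
    by (auto simp: case_prod_unfold intro: continuous_on_compose2)
next
  case (Suc k)
  have "continuous_on (UNIV \<times> strip) (\<lambda>(a, p). L (F a p))"
    using linear_continuous_on[OF assms(1)] Ckfam_continuous[OF Suc.prems]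
    by (auto simp: case_prod_unfold intro: continuous_on_compose2)
  then show ?case
  proof (rule Ckfam_SucI)
    fix a p assume "p \<in> strip"
    then show "((\<lambda>p. L (F a p)) has_derivative (\<lambda>v. L (dir_deriv v (F a) p))) (at p within strip)"
      using Ckfam_has_derivative[OF Suc.prems] bounded_linear.has_derivative[OF assms(1)] by blast
  next
    fix v :: "real \<times> real" assume "v \<in> Basis"
    then show "Ckfam k (\<lambda>a p. L (dir_deriv v (F a) p))"
      using Suc.prems by (intro Suc.IH) simp
  qed
qed

lemma Ckfam_add:
  assumes "Ckfam k F" "Ckfam k G"
  shows "Ckfam k (\<lambda>a p. F a p + G a p)"
  using assms
proof (induction k arbitrary: F G)
  case 0
  then show ?case by (auto simp: case_prod_unfold intro!: continuous_intros)
next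
  case (Suc k)
  have "continuous_on (UNIV \<times> strip) (\<lambda>(a, p). F a p + G a p)"
    using Ckfam_continuous[OF Suc.prems(1)] Ckfam_continuous[OF Suc.prems(2)]
    by (auto simp: case_prod_unfold intro!: continuous_intros)
  then show ?case
  proof (rule Ckfam_SucI)
    fix a p assume "p \<in> strip"
    then show "((\<lambda>p. F a p + G a p) has_derivative
        (\<lambda>v. dir_deriv v (F a) p + dir_deriv v (G a) p)) (at p within strip)"
      using Ckfam_has_derivative[OF Suc.prems(1)] Ckfam_has_derivative[OF Suc.prems(2)]
      by (intro has_derivative_add)
  next
    fix v :: "real \<times> real" assume "v \<in> Basis"
    then show "Ckfam k (\<lambda>a p. dir_deriv v (F a) p + dir_deriv v (G a) p)"
      using Suc.prems by (intro Suc.IH) simp_all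
  qed
qed

lemma Ckfam_sum:
  assumes "finite I" "\<And>i. i \<in> I \<Longrightarrow> Ckfam k (F i)"
  shows "Ckfam k (\<lambda>a p. \<Sum>i\<in>I. F i a p)"
  using assms by (induction I) (auto intro: Ckfam_add Ckfam_const)

lemma Ckfam_bilinear:
  assumes "bounded_bilinear B" "Ckfam k F" "Ckfam k G"
  shows "Ckfam k (\<lambda>a p. B (F a p) (G a p))"
  using assms(2,3)
proof (induction k arbitrary: F G)
  case 0
  then show ?case
    by (auto simp: case_prod_unfold intro!: bounded_bilinear.continuous_on[OF assms(1)])
next
  case (Suc k)
  have "continuous_on (UNIV \<times> strip) (\<lambda>(a, p). B (F a p) (G a p))"
    using Ckfam_continuous[OF Suc.prems(1)] Ckfam_continuous[OF Suc.prems(2)]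
    by (auto simp: case_prod_unfold intro!: bounded_bilinear.continuous_on[OF assms(1)])
  then show ?case
  proof (rule Ckfam_SucI)
    fix a p assume "p \<in> strip"
    then show "((\<lambda>p. B (F a p) (G a p)) has_derivative
        (\<lambda>v. B (F a p) (dir_deriv v (G a) p) + B (dir_deriv v (F a) p) (G a p))) (at p within strip)"
      using Ckfam_has_derivative[OF Suc.prems(1)] Ckfam_has_derivative[OF Suc.prems(2)]
      by (intro bounded_bilinear.FDERIV[OF assms(1)])
  next
    fix v :: "real \<times> real" assume "v \<in> Basis"
    then show "Ckfam k (\<lambda>a p. B (F a p) (dir_deriv v (G a) p) + B (dir_deriv v (F a) p) (G a p))"
      using Suc.prems Ckfam_Suc_D[OF Suc.prems(1)] Ckfam_Suc_D[OF Suc.prems(2)]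
      by (intro Ckfam_add Suc.IH) simp_all
  qed
qed

lemmas Ckfam_mult = Ckfam_bilinear[OF bounded_bilinear_mult]
lemmas Ckfam_scaleR = Ckfam_bilinear[OF bounded_bilinear_scaleR]

lemma Ckfam_Pair:
  assumes "Ckfam k F" "Ckfam k G"
  shows "Ckfam k (\<lambda>a p. (F a p, G a p))"
proof -
  have "bounded_linear (\<lambda>x::'b. (x, 0::'c))" "bounded_linear (\<lambda>x::'c. (0::'b, x))"
    by (auto intro!: bounded_linear_intros)
  from Ckfam_add[OF Ckfam_linear[OF this(1) assms(1)] Ckfam_linear[OF this(2) assms(2)]]
  show ?thesis by simp
qed

lemma Ckfam_linear_self:
  fixes L :: "real \<times> real \<Rightarrow> 'b::real_normed_vector"
  assumes L: "bounded_linear L"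
  shows "Ckfam k (\<lambda>(a::'p::topological_space) p. L p)"
proof -
  have cont: "continuous_on (UNIV \<times> strip) (\<lambda>(a::'p, p). L p)"
    unfolding continuous_on_const_family by (rule linear_continuous_on[OF L])
  show ?thesis
  proof (cases k)
    case (Suc j)
    show ?thesis unfolding Suc
      by (rule Ckfam_SucI[OF cont, of "\<lambda>a p. L"])
        (simp_all add: Ckfam_const bounded_linear_imp_has_derivative[OF L])
  qed (use cont in simp)
qed

lemmas Ckfam_fst = Ckfam_linear_self[OF bounded_linear_fst]
lemmas Ckfam_snd = Ckfam_linear_self[OF bounded_linear_snd]

text \<open>
  By the chain rule the derivative of a composite is a sum of products of derivatives of \<open>\<Phi>\<close> with
  composites of derivatives of \<open>G\<close>, to which the induction hypothesis applies.
\<close>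
lemma Ckfam_compose:
  fixes G :: "real \<times> real \<Rightarrow> 'b::real_normed_vector"
    and \<Phi> :: "'p::topological_space \<Rightarrow> real \<times> real \<Rightarrow> real \<times> real"
  assumes "Ckfam k (\<lambda>_::'p. G)" "Ckfam k \<Phi>" "\<And>a p. p \<in> strip \<Longrightarrow> \<Phi> a p \<in> strip"
  shows "Ckfam k (\<lambda>a p. G (\<Phi> a p))"
  using assms(1,2)
proof (induction k arbitrary: G)
  case 0
  then have "continuous_on strip G" by (simp add: continuous_on_const_family)
  then show ?case
    using 0(2) assms(3) by (auto simp: case_prod_unfold intro!: continuous_on_compose2[of strip G])
next
  case (Suc k)
  have "continuous_on strip G"
    using Ckfam_continuous[OF Suc.prems(1)] by (simp add: continuous_on_const_family)
  then have "continuous_on (UNIV \<times> strip) (\<lambda>(a, p). G (\<Phi> a p))"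
    using Ckfam_continuous[OF Suc.prems(2)] assms(3)
    by (auto simp: case_prod_unfold intro!: continuous_on_compose2[of strip G])
  then show ?case
  proof (rule Ckfam_SucI)
    fix a p assume p: "p \<in> strip"
    let ?D = "\<lambda>v. dir_deriv v G (\<Phi> a p)"
    have G: "(G has_derivative ?D) (at (\<Phi> a p) within strip)"
      using Ckfam_has_derivative[OF Suc.prems(1)] assms(3)[OF p] by simp
    then have G': "(G has_derivative ?D) (at (\<Phi> a p) within \<Phi> a ` strip)"
      using assms(3) by (elim has_derivative_subset) auto
    have lin: "linear ?D" using G by (rule has_derivative_linear)
    have "?D v = (\<Sum>b\<in>Basis. (v \<bullet> b) *\<^sub>R ?D b)" for v
    proof -
      have "?D v = ?D (\<Sum>b\<in>Basis. (v \<bullet> b) *\<^sub>R b)" by (simp only: euclidean_representation)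
      also have "\<dots> = (\<Sum>b\<in>Basis. (v \<bullet> b) *\<^sub>R ?D b)"
        by (simp add: linear_sum[OF lin] linear_scale[OF lin] del: sum_Basis_prod_eq)
      finally show ?thesis .
    qed
    then have "?D = (\<lambda>v. \<Sum>b\<in>Basis. (v \<bullet> b) *\<^sub>R ?D b)" by blast
    then have "(G has_derivative (\<lambda>v. \<Sum>b\<in>Basis. (v \<bullet> b) *\<^sub>R ?D b)) (at (\<Phi> a p) within \<Phi> a ` strip)"
      using G' by simp
    from has_derivative_in_compose[OF Ckfam_has_derivative[OF Suc.prems(2) p] this]
    show "((\<lambda>p. G (\<Phi> a p)) has_derivative
        (\<lambda>v. \<Sum>b\<in>Basis. (dir_deriv v (\<Phi> a) p \<bullet> b) *\<^sub>R dir_deriv b G (\<Phi> a p))) (at p within strip)" .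
  next
    fix v :: "real \<times> real" assume v: "v \<in> Basis"
    show "Ckfam k (\<lambda>a p. \<Sum>b\<in>Basis. (dir_deriv v (\<Phi> a) p \<bullet> b) *\<^sub>R dir_deriv b G (\<Phi> a p))"
    proof (intro Ckfam_sum Ckfam_scaleR)
      fix b :: "real \<times> real" assume b: "b \<in> Basis"
      show "Ckfam k (\<lambda>a p. dir_deriv v (\<Phi> a) p \<bullet> b)"
        using Suc.prems(2) v by (intro Ckfam_linear[OF bounded_linear_inner_left]) simp
      show "Ckfam k (\<lambda>a p. dir_deriv b G (\<Phi> a p))"
        using Suc.prems(1) b Ckfam_Suc_D[OF Suc.prems(2)] by (intro Suc.IH) simp_all
    qed simp
  qed
qed

text \<open>
  The inductive step for composition with a function of one variable: the elementary functions
  below have derivatives that are expressed through themselves and products.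
\<close>
lemma Ckfam_chain:
  fixes F :: "'p::topological_space \<Rightarrow> real \<times> real \<Rightarrow> real" and f :: "real \<Rightarrow> real"
  assumes F: "Ckfam (Suc k) F"
    and f: "\<And>a p. p \<in> strip \<Longrightarrow> (f has_real_derivative f' (F a p)) (at (F a p))"
    and f': "Ckfam k (\<lambda>a p. f' (F a p))"
  shows "Ckfam (Suc k) (\<lambda>a p. f (F a p))"
proof (rule Ckfam_SucI)
  let ?R = "(\<lambda>(a, p). F a p) ` (UNIV \<times> strip)"
  have "isCont f x" if "x \<in> ?R" for x
    using that f by (auto dest: DERIV_isCont)
  then have "continuous_on ?R f" by (simp add: continuous_at_imp_continuous_on)
  from continuous_on_compose[OF Ckfam_continuous[OF F] this]
  show "continuous_on (UNIV \<times> strip) (\<lambda>(a, p). f (F a p))"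
    by (simp add: o_def case_prod_unfold)
next
  fix a p assume p: "p \<in> strip"
  have "(f has_derivative (\<lambda>h. f' (F a p) * h)) (at (F a p))"
    using f[OF p] by (simp add: has_field_derivative_def)
  from has_derivative_compose[OF Ckfam_has_derivative[OF F p] this]
  show "((\<lambda>p. f (F a p)) has_derivative (\<lambda>v. f' (F a p) * dir_deriv v (F a) p)) (at p within strip)" .
next
  fix v :: "real \<times> real" assume "v \<in> Basis"
  then show "Ckfam k (\<lambda>a p. f' (F a p) * dir_deriv v (F a) p)"
    using F f' by (intro Ckfam_mult) simp_all
qed

lemma Ckfam_exp:
  fixes F :: "'p::topological_space \<Rightarrow> real \<times> real \<Rightarrow> real"
  assumes "Ckfam k F" shows "Ckfam k (\<lambda>a p. exp (F a p))"
  using assms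
proof (induction k)
  case 0
  then show ?case by (auto simp: case_prod_unfold intro!: continuous_intros)
next
  case (Suc k)
  then show ?case
    using Ckfam_Suc_D[OF Suc.prems]
    by (intro Ckfam_chain[OF Suc.prems, where f = exp and f' = exp]) simp_all
qed

lemma Ckfam_sin_cos:
  fixes F :: "'p::topological_space \<Rightarrow> real \<times> real \<Rightarrow> real"
  assumes "Ckfam k F"
  shows "Ckfam k (\<lambda>a p. sin (F a p)) \<and> Ckfam k (\<lambda>a p. cos (F a p))"
  using assms
proof (induction k)
  case 0
  then show ?case
    by (auto simp: case_prod_unfold continuous_on_compose2[of UNIV sin]
        continuous_on_compose2[of UNIV cos] continuous_at_imp_continuous_on)
next
  case (Suc k)
  then have IH: "Ckfam k (\<lambda>a p. sin (F a p))" "Ckfam k (\<lambda>a p. cos (F a p))"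
    using Ckfam_Suc_D[OF Suc.prems] by blast+
  have m: "Ckfam k (\<lambda>a p. - sin (F a p))"
    using Ckfam_linear[OF bounded_linear_minus[OF bounded_linear_ident] IH(1)] .
  show ?case
    using Ckfam_chain[OF Suc.prems, where f = sin and f' = cos, OF DERIV_sin IH(2)]
      Ckfam_chain[OF Suc.prems, where f = cos and f' = "\<lambda>x. - sin x", OF DERIV_cos m]
    by blast
qed

lemmas Ckfam_sin = Ckfam_sin_cos[THEN conjunct1]
lemmas Ckfam_cos = Ckfam_sin_cos[THEN conjunct2]

lemma Ckfam_inverse:
  fixes F :: "'p::topological_space \<Rightarrow> real \<times> real \<Rightarrow> real"
  assumes "Ckfam k F" "\<And>a p. p \<in> strip \<Longrightarrow> F a p \<noteq> 0"
  shows "Ckfam k (\<lambda>a p. inverse (F a p))"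
  using assms(1)
proof (induction k)
  case 0
  then show ?case using assms(2) by (auto simp: case_prod_unfold intro!: continuous_intros)
next
  case (Suc k)
  then have IH: "Ckfam k (\<lambda>a p. inverse (F a p))"
    using Ckfam_Suc_D[OF Suc.prems] by blast
  have m: "Ckfam k (\<lambda>a p. - (inverse (F a p) * inverse (F a p)))"
    using Ckfam_linear[OF bounded_linear_minus[OF bounded_linear_ident] Ckfam_mult[OF IH IH]] .
  show ?case
  proof (rule Ckfam_chain[OF Suc.prems, where f = inverse, OF _ m])
    fix a p assume "p \<in> strip"
    then show "(inverse has_real_derivative - (inverse (F a p) * inverse (F a p))) (at (F a p))"
      using DERIV_inverse[OF assms(2)[of p a]] by (simp add: power2_eq_square)
  qed
qed

lemma Ckfam_divide:
  fixes F G :: "'p::topological_space \<Rightarrow> real \<times> real \<Rightarrow> real"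
  assumes "Ckfam k F" "Ckfam k G" "\<And>a p. p \<in> strip \<Longrightarrow> G a p \<noteq> 0"
  shows "Ckfam k (\<lambda>a p. F a p / G a p)"
  using Ckfam_mult[OF assms(1) Ckfam_inverse[OF assms(2,3)]] by (simp add: divide_inverse)

lemma Ckfam_arctan:
  fixes F :: "'p::topological_space \<Rightarrow> real \<times> real \<Rightarrow> real"
  assumes "Ckfam k F" shows "Ckfam k (\<lambda>a p. arctan (F a p))"
proof (cases k)
  case 0
  then show ?thesis using assms by (auto simp: case_prod_unfold intro!: continuous_intros)
next
  case (Suc j)
  have j: "Ckfam j F" using assms unfolding Suc by (rule Ckfam_Suc_D)
  have "1 + x * x \<noteq> 0" for x :: real
    using sum_power2_ge_zero[of 1 x] by (simp add: power2_eq_square add_nonneg_eq_0_iff)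
  then have m: "Ckfam j (\<lambda>a p. inverse (1 + F a p * F a p))"
    by (intro Ckfam_inverse Ckfam_add Ckfam_mult Ckfam_const j) auto
  show ?thesis unfolding Suc
  proof (rule Ckfam_chain[OF assms[unfolded Suc], where f = arctan, OF _ m])
    fix a p
    show "(arctan has_real_derivative inverse (1 + F a p * F a p)) (at (F a p))"
      using DERIV_arctan[of "F a p"] by (simp add: power2_eq_square)
  qed
qed

lemma Ckfam_cis:
  fixes F :: "'p::topological_space \<Rightarrow> real \<times> real \<Rightarrow> real"
  assumes "Ckfam k F" shows "Ckfam k (\<lambda>a p. cis (F a p))"
proof -
  have "Ckfam k (\<lambda>a p. complex_of_real (cos (F a p)) + \<i> * complex_of_real (sin (F a p)))"
    by (intro Ckfam_add Ckfam_mult Ckfam_const Ckfam_linear[OF bounded_linear_of_real]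
        Ckfam_sin Ckfam_cos assms)
  moreover have "complex_of_real (cos x) + \<i> * complex_of_real (sin x) = cis x" for x
    by (simp add: complex_eq_iff)
  ultimately show ?thesis by simp
qed

section \<open>Maps of the annulus and their lifts\<close>

lemma annulus_iff: "(s, z) \<in> annulus \<longleftrightarrow> 0 \<le> s \<and> s \<le> 1 \<and> norm z = 1"
  by (auto simp: annulus_def)

lemma strip_iff: "(s, t) \<in> strip \<longleftrightarrow> 0 \<le> s \<and> s \<le> 1"
  by (auto simp: strip_def)

lemma convex_strip: "convex strip"
  unfolding strip_def by (intro convex_Times) auto

lemma ann_proj_in_annulus [simp]: "ann_proj p \<in> annulus \<longleftrightarrow> p \<in> strip"
  by (cases p) (auto simp: ann_proj_def annulus_iff strip_iff)

lemma ann_proj_surj: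
  assumes "x \<in> annulus"
  obtains s t where "x = ann_proj (s, t)" "0 \<le> t" "t < 1" "(s, t) \<in> strip"
proof -
  obtain s z where x: "x = (s, z)" "0 \<le> s" "s \<le> 1" "norm z = 1"
    using assms by (cases x) (auto simp: annulus_iff)
  define t where "t = Arg2pi z / (2 * pi)"
  have "z = cis (2 * pi * t)"
    using x(4) Arg2pi_eq[of z] by (simp add: t_def cis_conv_exp mult.commute)
  moreover have "0 \<le> t" "t < 1"
    using Arg2pi_ge_0[of z] Arg2pi_lt_2pi[of z] by (auto simp: t_def field_simps)
  ultimately show ?thesis
    using that[of s t] x by (simp add: ann_proj_def strip_iff)
qed

lemma ann_proj_image_strip: "ann_proj ` strip = annulus"
proof (intro equalityI subsetI)
  fix x assume "x \<in> annulus"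
  then show "x \<in> ann_proj ` strip" using ann_proj_surj by blast
qed auto

lemma continuous_on_ann_proj: "continuous_on S ann_proj"
  unfolding ann_proj_def case_prod_unfold by (intro continuous_intros)

lemma compact_annulus: "compact annulus"
  unfolding annulus_def by (intro compact_Times) auto

definition shift :: "real \<Rightarrow> real \<times> real \<Rightarrow> real \<times> real" where
  "shift \<alpha> = (\<lambda>(s, t). (s, t + \<alpha>))"

lemma shift_in_strip [simp]: "shift \<alpha> p \<in> strip \<longleftrightarrow> p \<in> strip"
  by (cases p) (auto simp: shift_def strip_iff)

lemma rotation_ann_proj: "rotation \<alpha> (ann_proj p) = ann_proj (shift \<alpha> p)"
  by (cases p) (auto simp: rotation_def ann_proj_def shift_def cis_mult algebra_simps)

lemma rotation_in_annulus [simp]: "rotation \<alpha> x \<in> annulus \<longleftrightarrow> x \<in> annulus"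
  by (cases x) (auto simp: rotation_def annulus_iff norm_mult)

lemma rotation_rotation: "rotation \<alpha> (rotation \<beta> x) = rotation (\<alpha> + \<beta>) x"
  by (cases x) (simp add: rotation_def cis_mult distrib_left mult.assoc[symmetric])

lemma rotation_0 [simp]: "rotation 0 x = x"
  by (cases x) (auto simp: rotation_def)

lemma ann_proj_shift_1: "ann_proj (shift 1 p) = ann_proj p"
  by (cases p) (auto simp: ann_proj_def shift_def distrib_left simp flip: cis_mult)

text \<open>
  A continuous logarithm of a \<open>C\<^sup>k\<close> map into the unit circle is \<open>C\<^sup>k\<close>: with \<open>W = cis (2 \<pi> L)\<close>, the
  derivative of \<open>L\<close> is the imaginary part of the derivative of \<open>W\<close> times the conjugate of \<open>W\<close>, up
  to the factor \<open>2 \<pi>\<close>.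
\<close>
lemma Ckfam_of_cis:
  fixes L :: "real \<times> real \<Rightarrow> real"
  assumes cont: "continuous_on strip L"
    and W: "Ckfam k (\<lambda>_::'p::topological_space. \<lambda>p. cis (2 * pi * L p))"
  shows "Ckfam k (\<lambda>_::'p. L)"
proof (cases k)
  case 0
  then show ?thesis using cont by (simp add: continuous_on_const_family)
next
  case (Suc j)
  let ?W = "\<lambda>p. cis (2 * pi * L p)"
  have W': "Ckfam (Suc j) (\<lambda>_::'p. ?W)" using W Suc by simp
  let ?D = "\<lambda>p v. Im (dir_deriv v ?W p * cnj (?W p)) / (2 * pi)"
  have "Ckfam (Suc j) (\<lambda>_::'p. L)"
  proof (rule Ckfam_SucI)
    show "continuous_on (UNIV \<times> strip) (\<lambda>(a::'p, p). L p)"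
      using cont by (simp add: continuous_on_const_family)
  next
    fix p assume p: "p \<in> strip"
    have cis_cnj: "cis a * cnj (cis b) = cis (a - b)" for a b
      by (simp add: cis_cnj cis_mult)
    obtain d where d: "d > 0" "\<And>x. x \<in> strip \<Longrightarrow> dist x p < d \<Longrightarrow> dist (L x) (L p) < 1/2"
      using cont p unfolding continuous_on_iff by (metis half_gt_zero zero_less_one)
    have "(Ln has_field_derivative 1) (at (?W p * cnj (?W p)))"
      using has_field_derivative_Ln[of 1] by (simp add: cis_cnj)
    \<comment> \<open>Near \<open>p\<close>, the number \<open>2 \<pi> \<i> (L x - L p)\<close> is the principal logarithm of the quotient of \<open>W x\<close> by
      \<open>W p\<close>, because this quotient is close to \<open>1\<close>.\<close>
    then have Ln: "(Ln has_derivative (\<lambda>h. h)) (at (?W p * cnj (?W p)))"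
      by (simp add: has_field_derivative_def lambda_one[symmetric])
    have "((\<lambda>x. ?W x * cnj (?W p)) has_derivative (\<lambda>v. dir_deriv v ?W p * cnj (?W p)))
        (at p within strip)"
      using Ckfam_has_derivative[OF W' p] by (intro has_derivative_mult_left)
    from has_derivative_compose[OF this Ln]
    have "((\<lambda>x. Ln (?W x * cnj (?W p))) has_derivative (\<lambda>v. dir_deriv v ?W p * cnj (?W p)))
        (at p within strip)" .
    from has_derivative_add[OF has_derivative_const[of "L p"]
        bounded_linear.has_derivative[OF bounded_linear_divide[of "2 * pi"]
          bounded_linear.has_derivative[OF bounded_linear_Im this]]]
    have "((\<lambda>x. L p + Im (Ln (?W x * cnj (?W p))) / (2 * pi)) has_derivative ?D p) (at p within strip)"
      by (simp only: add_0)
    note der = this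
    have eq: "L p + Im (Ln (?W x * cnj (?W p))) / (2 * pi) = L x"
      if "x \<in> strip" "dist x p < d" for x
    proof -
      have "\<bar>L x - L p\<bar> < 1/2" using d(2)[OF that] by (simp add: dist_real_def)
      then have "\<bar>2 * pi * (L x - L p)\<bar> < pi" by (simp add: abs_mult)
      then have "Ln (exp (\<i> * of_real (2 * pi * (L x - L p)))) = \<i> * of_real (2 * pi * (L x - L p))"
        by (intro Ln_exp) (auto simp: abs_less_iff)
      moreover have "?W x * cnj (?W p) = exp (\<i> * of_real (2 * pi * (L x - L p)))"
        unfolding cis_cnj by (simp add: cis_conv_exp right_diff_distrib)
      ultimately show ?thesis by simp
    qed
    show "(L has_derivative ?D p) (at p within strip)"
      by (rule has_derivative_transform_within[OF der d(1) p]) (rule eq)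
  next
    fix v :: "real \<times> real" assume v: "v \<in> Basis"
    have "Ckfam j (\<lambda>_::'p. \<lambda>p. dir_deriv v ?W p * cnj (?W p))"
      using W' v Ckfam_linear[OF bounded_linear_cnj Ckfam_Suc_D[OF W']] by (intro Ckfam_mult) simp_all
    moreover have "bounded_linear (\<lambda>z. Im z / (2 * pi))"
      by (rule bounded_linear_compose[OF bounded_linear_divide bounded_linear_Im])
    ultimately show "Ckfam j (\<lambda>_::'p. \<lambda>p. ?D p v)"
      by (rule Ckfam_linear[rotated])
  qed
  then show ?thesis unfolding Suc .
qed

text \<open>
  The strip is simply connected, so the angle of \<open>f \<circ> ann_proj\<close> can be chosen continuously. Lifts
  turn composition of maps of the annulus into composition of maps of the strip, which is needed
  because differentiability is defined through \<open>ann_proj\<close>.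
\<close>
lemma lift_exists:
  assumes "\<And>x. x \<in> annulus \<Longrightarrow> f x \<in> annulus" "continuous_on annulus f"
  obtains \<Phi> where "\<And>p. p \<in> strip \<Longrightarrow> \<Phi> p \<in> strip"
    and "\<And>p. p \<in> strip \<Longrightarrow> f (ann_proj p) = ann_proj (\<Phi> p)"
    and "\<And>k. Ck_strip k (f \<circ> ann_proj) \<Longrightarrow> Ckfam k (\<lambda>_::real. \<Phi>)"
proof -
  let ?g = "f \<circ> ann_proj"
  have cont: "continuous_on strip ?g"
    using assms(2) by (intro continuous_on_compose) (simp_all add: continuous_on_ann_proj ann_proj_image_strip)
  have norm1: "norm (snd (?g p)) = 1" "0 \<le> fst (?g p)" "fst (?g p) \<le> 1" if "p \<in> strip" for p
    using assms(1)[of "ann_proj p"] that by (cases "?g p"; auto simp: annulus_iff)+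
  obtain G where G: "continuous_on strip G" "\<And>p. p \<in> strip \<Longrightarrow> snd (?g p) = exp (G p)"
  proof (rule continuous_logarithm_on_contractible)
    show "continuous_on strip (\<lambda>p. snd (?g p))"
      using cont by (rule continuous_on_snd)
    show "contractible strip" by (intro convex_imp_contractible convex_strip)
    show "snd (?g p) \<noteq> 0" if "p \<in> strip" for p
      using norm1(1)[OF that] by auto
  qed blast
  define L where "L = (\<lambda>p. Im (G p) / (2 * pi))"
  have Lc: "continuous_on strip L"
    unfolding L_def by (intro continuous_on_divide continuous_on_Im G(1) continuous_on_const) simp
  have L: "snd (?g p) = cis (2 * pi * L p)" if "p \<in> strip" for p
  proof -
    have "exp (Re (G p)) = 1" using norm1(1)[OF that] G(2)[OF that] by simp
    then have "Re (G p) = 0" by simp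
    then show ?thesis using G(2)[OF that] by (simp add: L_def exp_eq_polar)
  qed
  define \<Phi> where "\<Phi> = (\<lambda>p. (fst (?g p), L p))"
  show ?thesis
  proof (rule that[of \<Phi>])
    show "\<Phi> p \<in> strip" if "p \<in> strip" for p
      using norm1[OF that] by (simp add: \<Phi>_def strip_iff)
    show "f (ann_proj p) = ann_proj (\<Phi> p)" if "p \<in> strip" for p
      using L[OF that] by (simp add: \<Phi>_def ann_proj_def prod_eq_iff)
    fix k assume "Ck_strip k ?g"
    then have k: "Ckfam k (\<lambda>_::real. ?g)" by (simp flip: Ck_strip_iff)
    have "Ckfam k (\<lambda>_::real. \<lambda>p. snd (?g p))"
      using Ckfam_linear[OF bounded_linear_snd k] .
    then have "Ckfam k (\<lambda>_::real. \<lambda>p. cis (2 * pi * L p))"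
      using L by (subst Ckfam_cong) auto
    then have "Ckfam k (\<lambda>_::real. L)" by (rule Ckfam_of_cis[OF Lc])
    then show "Ckfam k (\<lambda>_::real. \<Phi>)"
      unfolding \<Phi>_def using Ckfam_linear[OF bounded_linear_fst k] by (intro Ckfam_Pair)
  qed
qed

section \<open>Conjugates of rotations\<close>

definition rot_conj :: "(pt \<Rightarrow> pt) \<Rightarrow> (pt \<Rightarrow> pt) \<Rightarrow> real \<Rightarrow> pt \<Rightarrow> pt" where
  "rot_conj H K \<alpha> = restrict (\<lambda>x. H (rotation \<alpha> (K x))) annulus"

definition Cr_homeo :: "enat \<Rightarrow> (pt \<Rightarrow> pt) \<Rightarrow> (pt \<Rightarrow> pt) \<Rightarrow> bool" where
  "Cr_homeo r H K \<longleftrightarrow> homeomorphism annulus annulus H K \<and> Cr_map r H \<and> Cr_map r K"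

lemma Cr_homeo_sym: "Cr_homeo r H K \<Longrightarrow> Cr_homeo r K H"
  using homeomorphism_symD by (auto simp: Cr_homeo_def)

lemma Cr_homeoD:
  assumes "Cr_homeo r H K"
  shows "continuous_on annulus H" "continuous_on annulus K"
    "x \<in> annulus \<Longrightarrow> H x \<in> annulus" "x \<in> annulus \<Longrightarrow> K x \<in> annulus"
    "x \<in> annulus \<Longrightarrow> H (K x) = x" "x \<in> annulus \<Longrightarrow> K (H x) = x"
  using assms by (auto simp: Cr_homeo_def homeomorphism_def)

lemma Ckfam_rot_conj:
  assumes H: "\<And>x. x \<in> annulus \<Longrightarrow> H x \<in> annulus" "Cr_map r H"
    and K: "\<And>x. x \<in> annulus \<Longrightarrow> K x \<in> annulus" "continuous_on annulus K" "Cr_map r K"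
    and k: "enat k \<le> r"
  shows "Ckfam k (\<lambda>\<alpha> p. rot_conj H K \<alpha> (ann_proj p))"
proof -
  obtain \<Phi> where \<Phi>: "\<And>p. p \<in> strip \<Longrightarrow> \<Phi> p \<in> strip"
    "\<And>p. p \<in> strip \<Longrightarrow> K (ann_proj p) = ann_proj (\<Phi> p)"
    "\<And>k. Ck_strip k (K \<circ> ann_proj) \<Longrightarrow> Ckfam k (\<lambda>_::real. \<Phi>)"
    using lift_exists[OF K(1,2)] by blast
  have \<Phi>k: "Ckfam k (\<lambda>_::real. \<Phi>)" using \<Phi>(3) K(3) k by (auto simp: Cr_map_def)
  \<comment> \<open>On the universal cover a rotation is a translation, so the parameter enters linearly.\<close>
  have "Ckfam k (\<lambda>\<alpha> p. (fst (\<Phi> p), snd (\<Phi> p) + \<alpha>))"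
    by (intro Ckfam_Pair Ckfam_add Ckfam_param Ckfam_linear[OF bounded_linear_fst \<Phi>k]
        Ckfam_linear[OF bounded_linear_snd \<Phi>k] continuous_intros)
  then have s: "Ckfam k (\<lambda>\<alpha> p. shift \<alpha> (\<Phi> p))"
    by (simp add: shift_def case_prod_unfold)
  have "Ckfam k (\<lambda>_::real. H \<circ> ann_proj)"
    using H(2) k by (auto simp: Cr_map_def simp flip: Ck_strip_iff)
  from Ckfam_compose[OF this s] \<Phi>(1)
  have "Ckfam k (\<lambda>\<alpha> p. (H \<circ> ann_proj) (shift \<alpha> (\<Phi> p)))" by simp
  then show ?thesis
    by (rule Ckfam_cong[THEN iffD1, rotated]) (simp add: rot_conj_def \<Phi>(2) rotation_ann_proj)
qed

lemma Cr_map_rot_conj: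
  assumes "Cr_homeo r H K"
  shows "Cr_map r (rot_conj H K \<alpha>)"
  unfolding Cr_map_def
proof (intro allI impI)
  fix k assume "enat k \<le> r"
  then have "Ckfam k (\<lambda>\<alpha> p. rot_conj H K \<alpha> (ann_proj p))"
    using assms by (intro Ckfam_rot_conj) (auto simp: Cr_homeo_def homeomorphism_def)
  from Ckfam_instance[OF this, of \<alpha>] show "Ck_strip k (rot_conj H K \<alpha> \<circ> ann_proj)"
    by (simp add: o_def)
qed

lemma Cr_map_compose:
  assumes H: "\<And>x. x \<in> annulus \<Longrightarrow> H x \<in> annulus" "Cr_map r H"
    and K: "\<And>x. x \<in> annulus \<Longrightarrow> K x \<in> annulus" "continuous_on annulus K" "Cr_map r K"
  shows "Cr_map r (H \<circ> K)"
  unfolding Cr_map_def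
proof (intro allI impI)
  fix k assume "enat k \<le> r"
  then have "Ckfam k (\<lambda>\<alpha> p. rot_conj H K \<alpha> (ann_proj p))"
    using assms by (intro Ckfam_rot_conj) auto
  from Ckfam_instance[OF this, of 0] have "Ck_strip k (\<lambda>p. rot_conj H K 0 (ann_proj p))" .
  then have "Ckfam k (\<lambda>_::real. \<lambda>p. rot_conj H K 0 (ann_proj p))" by (simp add: Ck_strip_iff[symmetric])
  then have "Ckfam k (\<lambda>_::real. H \<circ> K \<circ> ann_proj)"
    by (rule Ckfam_cong[THEN iffD1, rotated]) (simp add: rot_conj_def)
  then show "Ck_strip k (H \<circ> K \<circ> ann_proj)" by (simp add: Ck_strip_iff[symmetric])
qed

lemma Cr_homeo_compose:
  assumes "Cr_homeo r H K" "Cr_homeo r H' K'"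
  shows "Cr_homeo r (H \<circ> H') (K' \<circ> K)"
  unfolding Cr_homeo_def
proof (intro conjI)
  show "homeomorphism annulus annulus (H \<circ> H') (K' \<circ> K)"
    using assms by (auto simp: Cr_homeo_def intro: homeomorphism_compose)
  show "Cr_map r (H \<circ> H')" "Cr_map r (K' \<circ> K)"
    using assms Cr_homeoD[OF assms(1)] Cr_homeoD[OF assms(2)]
    by (auto simp: Cr_homeo_def intro!: Cr_map_compose)
qed

lemma homeomorphism_rot_conj:
  assumes "Cr_homeo r H K"
  shows "homeomorphism annulus annulus (rot_conj H K \<alpha>) (rot_conj H K (- \<alpha>))"
proof -
  note D = Cr_homeoD[OF assms]
  have c: "continuous_on annulus (rot_conj H K \<beta>)" for \<beta>
  proof -
    have "continuous_on annulus (\<lambda>x. rotation \<beta> (K x))"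
      unfolding rotation_def case_prod_unfold by (intro continuous_intros D)
    then have "continuous_on annulus (\<lambda>x. H (rotation \<beta> (K x)))"
      using D by (intro continuous_on_compose2[OF D(1)]) auto
    then show ?thesis by (simp add: rot_conj_def)
  qed
  have i: "rot_conj H K \<beta> (rot_conj H K (- \<beta>) x) = x" "rot_conj H K \<beta> x \<in> annulus"
    if "x \<in> annulus" for \<beta> x
    using that D by (auto simp: rot_conj_def rotation_rotation)
  show ?thesis
    using c i(2) i(1) i(1)[of _ "- \<alpha>"] by (intro homeomorphismI image_subsetI) simp_all
qed

lemma from_plane_in_annulus [simp]: "from_plane w \<in> annulus \<longleftrightarrow> 1 \<le> norm w \<and> norm w \<le> 2"
  by (auto simp: from_plane_def annulus_iff norm_sgn)

lemma to_from_plane [simp]: "to_plane (from_plane w) = w"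
  by (cases "w = 0") (simp_all add: to_plane_def from_plane_def sgn_div_norm scaleR_conv_of_real field_simps)

lemma norm_one_plus_of_real: "0 \<le> a \<Longrightarrow> norm (1 + complex_of_real a) = 1 + a"
  by (metis (no_types, opaque_lifting) abs_of_nonneg add_nonneg_nonneg norm_of_real of_real_1 of_real_add zero_le_one)

lemma from_to_plane: "x \<in> annulus \<Longrightarrow> from_plane (to_plane x) = x"
proof (cases x)
  fix s z assume x: "x \<in> annulus" "x = (s, z)"
  then have s: "0 \<le> s" "norm z = 1" by (auto simp: annulus_iff)
  have p: "to_plane x = (1 + s) *\<^sub>R z" by (simp add: x(2) to_plane_def scaleR_conv_of_real)
  have "norm (to_plane x) = 1 + s" "sgn (to_plane x) = z"
    using s unfolding p by (simp_all add: sgn_scaleR sgn_div_norm[of z] sgn_1_pos)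
  then show ?thesis by (simp add: from_plane_def x(2))
qed

lemma norm_to_plane: "x \<in> annulus \<Longrightarrow> norm (to_plane x) = 1 + fst x"
  by (cases x) (auto simp: to_plane_def annulus_iff norm_mult norm_one_plus_of_real)

lemma continuous_on_from_plane: "0 \<notin> S \<Longrightarrow> continuous_on S from_plane"
  unfolding from_plane_def sgn_div_norm by (intro continuous_intros) auto

lemma continuous_on_to_plane: "continuous_on S to_plane"
  unfolding to_plane_def case_prod_unfold by (intro continuous_intros)

text \<open>
  A conjugate of \<open>R\<^sub>\<alpha>\<close> is joined to the identity by the conjugates of the rotations \<open>R\<^sub>\<tau>\<^sub>\<alpha>\<close>,
  \<open>0 \<le> \<tau> \<le> 1\<close>. All of them are injective, so the image of a small circle never meets the image of its
  centre and the winding number stays what it is for the identity. In particular the conjugacy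
  itself may reverse the orientation.
\<close>
lemma orientation_preserving_rot_conj:
  assumes "Cr_homeo r H K"
  shows "orientation_preserving (rot_conj H K \<alpha>)"
proof -
  note D = Cr_homeoD[OF assms]
  define F where "F = (\<lambda>\<beta>. to_plane \<circ> rot_conj H K \<beta> \<circ> from_plane)"
  let ?A = "{u::complex. 1 \<le> norm u \<and> norm u \<le> 2}"
  have Fc: "continuous_on (UNIV \<times> ?A) (\<lambda>(\<beta>, u). F \<beta> u)"
  proof -
    have fp: "continuous_on ?A from_plane" by (rule continuous_on_from_plane) auto
    have "continuous_on (UNIV \<times> ?A) (\<lambda>x. K (from_plane (snd x)))"
      by (intro continuous_on_compose2[OF D(2)] continuous_on_compose2[OF fp] continuous_intros) auto
    then have "continuous_on (UNIV \<times> ?A) (\<lambda>x. rotation (fst x) (K (from_plane (snd x))))"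
      unfolding rotation_def case_prod_unfold by (intro continuous_intros)
    then have "continuous_on (UNIV \<times> ?A) (\<lambda>x. H (rotation (fst x) (K (from_plane (snd x)))))"
      by (rule continuous_on_compose2[OF D(1)]) (auto simp del: split_paired_All intro!: D(4))
    then have "continuous_on (UNIV \<times> ?A) (\<lambda>x. to_plane (H (rotation (fst x) (K (from_plane (snd x))))))"
      by (intro continuous_on_compose2[OF continuous_on_to_plane[of UNIV]]) auto
    then show ?thesis
      by (rule continuous_on_eq) (auto simp: F_def rot_conj_def)
  qed
  have Finj: "u = w" if "F \<beta> u = F \<beta> w" "u \<in> ?A" "w \<in> ?A" for \<beta> u w
  proof -
    have "rot_conj H K (- \<beta>) (from_plane (F \<beta> v)) = from_plane v" if "v \<in> ?A" for v
    proof -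
      have v: "from_plane v \<in> annulus" using that by simp
      have "rot_conj H K \<beta> (from_plane v) \<in> annulus"
        "rot_conj H K (- \<beta>) (rot_conj H K \<beta> (from_plane v)) = from_plane v"
        using v homeomorphism_rot_conj[OF assms, of \<beta>] unfolding homeomorphism_def by blast+
      then show ?thesis by (simp add: F_def from_to_plane)
    qed
    then have "from_plane u = from_plane w" using that by metis
    then show ?thesis by (metis to_from_plane)
  qed
  have F0: "F 0 u = u" if "u \<in> ?A" for u
    using that D by (auto simp: F_def rot_conj_def)
  have "winding_number (F \<alpha> \<circ> circlepath w \<epsilon>) (F \<alpha> w) = 1"
    if \<epsilon>: "0 < \<epsilon>" "cball w \<epsilon> \<subseteq> {u. 1 < norm u \<and> norm u < 2}" for w \<epsilon>
  proof -
    have sub: "cball w \<epsilon> \<subseteq> ?A" using \<epsilon>(2) by force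
    have cp: "circlepath w \<epsilon> t \<in> cball w \<epsilon>" "circlepath w \<epsilon> t \<noteq> w" for t
      using \<epsilon>(1) by (auto simp: circlepath dist_norm norm_mult)
    have w: "w \<in> ?A" by (rule subsetD[OF sub]) (use \<epsilon>(1) in simp)
    have cpA: "circlepath w \<epsilon> t \<in> ?A" for t using cp sub by blast
    define p where "p = (\<lambda>\<beta> t. F \<beta> (circlepath w \<epsilon> t) - F \<beta> w)"
    have "homotopic_loops (- {0}) (p 0) (p \<alpha>)"
      unfolding homotopic_loops
    proof (intro exI conjI ballI)
      have c1: "continuous_on ({0..1} \<times> {0..1}) (\<lambda>x::real\<times>real. F (fst x * \<alpha>) (circlepath w \<epsilon> (snd x)))"
      proof -
        have "continuous_on ({0..1} \<times> {0..1}) (\<lambda>x::real\<times>real. (fst x * \<alpha>, circlepath w \<epsilon> (snd x)))"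
          unfolding circlepath by (intro continuous_intros)
        from continuous_on_compose2[OF Fc this] cpA show ?thesis by (simp add: image_subset_iff)
      qed
      have c2: "continuous_on ({0..1} \<times> {0..1}) (\<lambda>x::real\<times>real. F (fst x * \<alpha>) w)"
      proof -
        have "continuous_on ({0..1} \<times> {0..1}) (\<lambda>x::real\<times>real. (fst x * \<alpha>, w))"
          by (intro continuous_intros)
        from continuous_on_compose2[OF Fc this] w show ?thesis by (simp add: image_subset_iff)
      qed
      show "continuous_on ({0..1} \<times> {0..1}) (\<lambda>x. p (fst x * \<alpha>) (snd x))"
        unfolding p_def by (intro continuous_intros c1 c2)
      show "(\<lambda>x. p (fst x * \<alpha>) (snd x)) \<in> {0..1} \<times> {0..1} \<rightarrow> - {0}"
      proof (intro Pi_I)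
        fix x :: "real \<times> real"
        have "F (fst x * \<alpha>) (circlepath w \<epsilon> (snd x)) \<noteq> F (fst x * \<alpha>) w"
          using Finj[OF _ cpA w] cp(2) by blast
        then show "p (fst x * \<alpha>) (snd x) \<in> - {0}" by (simp add: p_def)
      qed
    qed (auto simp: p_def pathstart_def pathfinish_def circlepath)
    from winding_number_homotopic_loops[OF this]
    have "winding_number (p \<alpha>) 0 = winding_number (p 0) 0" by simp
    also have "p 0 = (\<lambda>t. circlepath w \<epsilon> t - w)"
      using cpA w by (auto simp: p_def F0)
    also have "winding_number \<dots> 0 = winding_number (circlepath w \<epsilon>) w"
      by (rule winding_number_offset[symmetric])
    also have "\<dots> = 1" using \<epsilon>(1) by (rule winding_number_circlepath_centre)
    finally show ?thesis
      unfolding p_def by (subst winding_number_offset) (simp add: o_def)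
  qed
  then show ?thesis by (auto simp: orientation_preserving_def F_def Let_def)
qed

lemma rot_conj_in_Diff_plus:
  assumes "Cr_homeo r H K"
  shows "rot_conj H K \<alpha> \<in> Diff_plus r"
proof -
  have "rot_conj H K \<alpha> \<in> extensional annulus" by (simp add: rot_conj_def)
  then have "rot_conj H K \<alpha> \<in> Diff_ann r"
    using Cr_map_rot_conj[OF assms] homeomorphism_rot_conj[OF assms] unfolding Diff_ann_def by blast
  then show ?thesis
    using orientation_preserving_rot_conj[OF assms] by (simp add: Diff_plus_def)
qed

lemma Ckfam_restrict:
  "Cr_map r (restrict H annulus) \<longleftrightarrow> Cr_map r H"
proof -
  have "Ckfam k (\<lambda>_::real. restrict H annulus \<circ> ann_proj) \<longleftrightarrow> Ckfam k (\<lambda>_::real. H \<circ> ann_proj)" for k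
    by (rule Ckfam_cong) (simp only: o_def restrict_apply' ann_proj_in_annulus)
  then show ?thesis unfolding Cr_map_def Ck_strip_iff[where 'p = real] by blast
qed

lemma Cr_homeo_restrict:
  assumes "Cr_homeo r H K"
  shows "restrict H annulus \<in> Diff_ann r"
proof -
  have "homeomorphism annulus annulus (restrict H annulus) K"
    using assms unfolding Cr_homeo_def by (auto elim!: homeomorphism_cong)
  moreover have "Cr_map r (restrict H annulus)" "Cr_map r K"
    using assms by (simp_all add: Cr_homeo_def Ckfam_restrict)
  ultimately show ?thesis unfolding Diff_ann_def by blast
qed

lemma rot_conj_in_rotation_conjugates:
  assumes "Cr_homeo r H K"
  shows "rot_conj H K \<alpha> \<in> rotation_conjugates r"
proof -
  have "\<forall>x\<in>annulus. rot_conj H K \<alpha> (restrict H annulus x) = restrict H annulus (rotation \<alpha> x)"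
    using Cr_homeoD[OF assms] by (simp add: rot_conj_def)
  then show ?thesis
    using rot_conj_in_Diff_plus[OF assms] Cr_homeo_restrict[OF assms]
    unfolding rotation_conjugates_def by blast
qed

lemma rotation_conjugatesE:
  assumes "f \<in> rotation_conjugates r"
  obtains h k \<alpha> where "Cr_homeo r h k" "f = rot_conj h k \<alpha>"
proof -
  obtain h \<alpha> where h: "h \<in> Diff_ann r" "\<And>p. p \<in> annulus \<Longrightarrow> f (h p) = h (rotation \<alpha> p)"
    and f: "f \<in> extensional annulus"
    using assms by (auto simp: rotation_conjugates_def Diff_plus_def Diff_ann_def)
  then obtain k where k: "Cr_homeo r h k" by (auto simp: Diff_ann_def Cr_homeo_def)
  have "f x = rot_conj h k \<alpha> x" if "x \<in> annulus" for x
    using h(2)[of "k x"] Cr_homeoD[OF k] that by (simp add: rot_conj_def)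
  then have "f = rot_conj h k \<alpha>"
    using f by (intro extensionalityI[of _ annulus]) (auto simp: rot_conj_def)
  then show ?thesis using that k by blast
qed

section \<open>The \<open>C\<^sup>r\<close> topology on Anosov-Katok maps\<close>

lemma has_derivative_shift_iff:
  assumes "p \<in> strip"
  shows "(g has_derivative D) (at (shift c p) within strip) \<longleftrightarrow>
    ((\<lambda>p. g (shift c p)) has_derivative D) (at p within strip)"
proof -
  have sh: "(shift c has_derivative (\<lambda>v. v)) (at p within strip)" for c p
  proof -
    have "shift c = (\<lambda>p. p + (0, c))" by (auto simp: shift_def)
    then show ?thesis by (auto intro!: derivative_eq_intros)
  qed
  have img: "shift c ` strip \<subseteq> strip" for c by auto
  have inv: "shift c (shift (- c) p) = p" "shift (- c) (shift c p) = p" for p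
    by (auto simp: shift_def split: prod.splits)
  show ?thesis
  proof
    assume "(g has_derivative D) (at (shift c p) within strip)"
    then have "(g has_derivative D) (at (shift c p) within shift c ` strip)"
      using has_derivative_subset img by blast
    from has_derivative_in_compose[OF sh this]
    show "((\<lambda>p. g (shift c p)) has_derivative D) (at p within strip)" by simp
  next
    assume "((\<lambda>p. g (shift c p)) has_derivative D) (at p within strip)"
    then have "((\<lambda>p. g (shift c p)) has_derivative D)
        (at (shift (- c) (shift c p)) within shift (- c) ` strip)"
      using has_derivative_subset img by (simp only: inv) blast
    from has_derivative_in_compose[OF sh this]
    show "(g has_derivative D) (at (shift c p) within strip)" by (simp add: inv)
  qed
qed

lemma partials_periodic:
  assumes "\<And>p. p \<in> strip \<Longrightarrow> g (shift c p) = g p" "p \<in> strip"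
  shows "partials vs g (shift c p) = partials vs g p"
  using assms(2)
proof (induction vs arbitrary: p)
  case Nil
  then show ?case using assms(1) by (simp add: partials_def)
next
  case (Cons v vs)
  let ?G = "partials vs g"
  have "dir_deriv v ?G (shift c p) = dir_deriv v (\<lambda>p. ?G (shift c p)) p"
    by (simp add: dir_deriv_def frechet_derivative_def has_derivative_shift_iff[OF Cons.prems])
  also have "\<dots> = dir_deriv v ?G p"
    by (rule dir_deriv_cong) (use Cons in auto)
  finally show ?case by (simp add: partials_def)
qed

text \<open>
  Partial derivatives of \<open>f \<circ> ann_proj\<close> are periodic, so bounds on the compact square \<open>[0,1]\<^sup>2\<close>
  hold on the whole strip.
\<close>
lemma partials_ann_proj_mod_1:
  assumes "(s, t) \<in> strip"
  shows "partials vs (f \<circ> ann_proj) (s, t) = partials vs (f \<circ> ann_proj) (s, frac t)"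
proof -
  have "ann_proj (shift (of_int m) p) = ann_proj p" for m p
  proof -
    have "cis (2 * pi * of_int m) = 1" by (rule cis_multiple_2pi) simp
    then show ?thesis
      by (cases p) (simp add: ann_proj_def shift_def distrib_left flip: cis_mult)
  qed
  then have "partials vs (f \<circ> ann_proj) (shift (of_int \<lfloor>t\<rfloor>) (s, frac t)) =
      partials vs (f \<circ> ann_proj) (s, frac t)"
    using assms by (intro partials_periodic) (auto simp: strip_iff)
  moreover have "shift (of_int \<lfloor>t\<rfloor>) (s, frac t) = (s, t)"
    by (simp add: shift_def frac_def)
  ultimately show ?thesis by simp
qed

lemma open_Ball_compact:
  fixes E :: "real \<times> 'b::euclidean_space \<Rightarrow> real"
  assumes "compact C" "continuous_on (UNIV \<times> C) E"
  shows "open {a. \<forall>p\<in>C. E (a, p) < \<epsilon>}"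
proof -
  have "closed {x \<in> C \<times> UNIV. E (snd x, fst x) \<in> {\<epsilon>..}}"
  proof (rule continuous_closed_preimage[unfolded vimage_def Int_def mem_Collect_eq])
    show "continuous_on (C \<times> UNIV) (\<lambda>x. E (snd x, fst x))"
      by (rule continuous_on_compose2[OF assms(2)]) (auto intro!: continuous_intros)
    show "closed (C \<times> (UNIV :: real set))"
      by (intro closed_Times compact_imp_closed[OF assms(1)] closed_UNIV)
  qed auto
  from closed_compact_projection[OF assms(1) this]
  have "closed {a. \<exists>p. p \<in> C \<and> \<epsilon> \<le> E (a, p)}" by simp
  moreover have "{a. \<forall>p\<in>C. E (a, p) < \<epsilon>} = - {a. \<exists>p. p \<in> C \<and> \<epsilon> \<le> E (a, p)}"
    by (auto simp: not_le)
  ultimately show ?thesis by (simp add: open_closed)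
qed

text \<open>
  The ball need not be centred at a conjugate. Its defining inequalities are strict, involve
  finitely many partial derivatives, and need to be checked only on a compact square; each of them
  therefore holds for an open set of parameters.
\<close>
lemma open_rot_conj_Ck_ball:
  assumes "Cr_homeo r H K" "enat k \<le> r" "f \<in> Diff_plus r"
  shows "open {\<alpha>. rot_conj H K \<alpha> \<in> Ck_ball r k f \<epsilon>}"
proof -
  let ?V = "{vs. set vs \<subseteq> (Basis :: (real \<times> real) set) \<and> length vs \<le> k}"
  let ?C = "{0..1::real} \<times> {0..1::real}"
  let ?E = "\<lambda>vs (\<alpha>, p). norm (partials vs (rot_conj H K \<alpha> \<circ> ann_proj) p - partials vs (f \<circ> ann_proj) p)"
  have fin: "finite ?V" by (rule finite_lists_length_le) simp
  have sub: "?C \<subseteq> strip" by (auto simp: strip_def)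
  have "?E vs (\<alpha>, p) < \<epsilon>" if "\<forall>p\<in>?C. ?E vs (\<alpha>, p) < \<epsilon>" "p \<in> strip" for vs \<alpha> p
  proof -
    obtain s t where p: "p = (s, t)" by (cases p)
    have "(s, frac t) \<in> ?C" using that(2) frac_ge_0[of t] frac_lt_1[of t] by (auto simp: p strip_iff)
    then show ?thesis
      using that unfolding p by (simp add: partials_ann_proj_mod_1[of s t])
  qed
  then have eq: "{\<alpha>. rot_conj H K \<alpha> \<in> Ck_ball r k f \<epsilon>} = (\<Inter>vs\<in>?V. {\<alpha>. \<forall>p\<in>?C. ?E vs (\<alpha>, p) < \<epsilon>})"
    using sub rot_conj_in_Diff_plus[OF assms(1)] unfolding Ck_ball_def by fastforce
  have "open {\<alpha>. \<forall>p\<in>?C. ?E vs (\<alpha>, p) < \<epsilon>}" if vs: "vs \<in> ?V" for vs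
  proof (rule open_Ball_compact)
    show "compact ?C" by (intro compact_Times) auto
    have "Ckfam k (\<lambda>\<alpha> p. rot_conj H K \<alpha> (ann_proj p))"
      using assms by (intro Ckfam_rot_conj) (auto simp: Cr_homeo_def homeomorphism_def)
    then have 1: "continuous_on (UNIV \<times> strip) (\<lambda>(\<alpha>, p). partials vs (rot_conj H K \<alpha> \<circ> ann_proj) p)"
      using vs unfolding Ckfam_iff_partials by (simp add: o_def)
    have "Ck_strip k (f \<circ> ann_proj)"
      using assms(2,3) unfolding Diff_plus_def Diff_ann_def Cr_map_def by blast
    then have 2: "continuous_on (UNIV \<times> strip) (\<lambda>(\<alpha>::real, p). partials vs (f \<circ> ann_proj) p)"
      using vs unfolding continuous_on_const_family Ck_strip_def by blast
    have "continuous_on (UNIV \<times> strip) (?E vs)"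
      using 1 2 unfolding case_prod_unfold by (intro continuous_intros)
    then show "continuous_on (UNIV \<times> ?C) (?E vs)"
      by (rule continuous_on_subset) (use sub in auto)
  qed
  then show ?thesis unfolding eq using fin by (intro open_INT) auto
qed

lemma continuous_map_rot_conj:
  assumes "Cr_homeo r H K"
  shows "continuous_map euclidean (Diff_top r) (rot_conj H K)"
  unfolding Diff_top_def
proof (rule continuous_on_generated_topo)
  fix U assume "U \<in> {Ck_ball r k f \<epsilon> |k f \<epsilon>. enat k \<le> r \<and> f \<in> Diff_plus r \<and> 0 < \<epsilon>}"
  then obtain k f \<epsilon> where U: "U = Ck_ball r k f \<epsilon>" "enat k \<le> r" "f \<in> Diff_plus r" by blast
  show "openin euclidean (rot_conj H K -` U \<inter> topspace euclidean)"
    using open_rot_conj_Ck_ball[OF assms U(2,3)] by (simp add: U(1) vimage_def)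
next
  have "rot_conj H K ` UNIV \<subseteq> topspace (Diff_top r)"
    using rot_conj_in_Diff_plus[OF assms] by (auto simp: topspace_Diff_top)
  then show "rot_conj H K ` topspace euclidean
      \<subseteq> \<Union> {Ck_ball r k f \<epsilon> |k f \<epsilon>. enat k \<le> r \<and> f \<in> Diff_plus r \<and> 0 < \<epsilon>}"
    by (simp add: Diff_top_def)
qed

lemma open_rot_conj_vimage:
  assumes "Cr_homeo r H K" "openin (Diff_top r) W"
  shows "open {\<alpha>. rot_conj H K \<alpha> \<in> W}"
  using openin_continuous_map_preimage[OF continuous_map_rot_conj[OF assms(1)] assms(2)] by simp

lemma self_in_Ck_ball: "f \<in> Diff_plus r \<Longrightarrow> 0 < \<epsilon> \<Longrightarrow> f \<in> Ck_ball r k f \<epsilon>"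
  by (simp add: Ck_ball_def)

lemma openin_Ck_ball:
  "enat k \<le> r \<Longrightarrow> f \<in> Diff_plus r \<Longrightarrow> 0 < \<epsilon> \<Longrightarrow> openin (Diff_top r) (Ck_ball r k f \<epsilon>)"
  unfolding Diff_top_def by (rule topology_generated_by_Basis) blast

lemma Ck_ball_0:
  "Ck_ball r 0 f \<epsilon> = {g \<in> Diff_plus r. \<forall>x\<in>annulus. dist (g x) (f x) < \<epsilon>}"
proof -
  have "(\<forall>p\<in>strip. norm (g (ann_proj p) - f (ann_proj p)) < \<epsilon>) \<longleftrightarrow>
      (\<forall>x\<in>annulus. dist (g x) (f x) < \<epsilon>)" for g
    by (simp add: ann_proj_image_strip[symmetric] dist_norm)
  then show ?thesis by (simp add: Ck_ball_def partials_def)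
qed

lemma zero_le_enat: "enat 0 \<le> r"
  by (simp flip: zero_enat_def)

text \<open>
  Conditions that are open for uniform convergence are open in all \<open>C\<^sup>r\<close> topologies.
\<close>
lemma openin_Diff_topI:
  assumes "U \<subseteq> Diff_plus r"
    and "\<And>f. f \<in> U \<Longrightarrow> \<exists>\<epsilon>>0. \<forall>g\<in>Diff_plus r. (\<forall>x\<in>annulus. dist (g x) (f x) < \<epsilon>) \<longrightarrow> g \<in> U"
  shows "openin (Diff_top r) U"
proof (subst openin_subopen, intro ballI)
  fix f assume f: "f \<in> U"
  obtain \<epsilon> where \<epsilon>: "\<epsilon> > 0" "\<forall>g\<in>Diff_plus r. (\<forall>x\<in>annulus. dist (g x) (f x) < \<epsilon>) \<longrightarrow> g \<in> U"
    using assms(2)[OF f] by blast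
  have "f \<in> Diff_plus r" using f assms(1) by blast
  then have "openin (Diff_top r) (Ck_ball r 0 f \<epsilon>)" "f \<in> Ck_ball r 0 f \<epsilon>"
    using \<epsilon>(1) openin_Ck_ball[OF zero_le_enat] self_in_Ck_ball by auto
  moreover have "Ck_ball r 0 f \<epsilon> \<subseteq> U" using \<epsilon>(2) by (auto simp: Ck_ball_0)
  ultimately show "\<exists>T. openin (Diff_top r) T \<and> f \<in> T \<and> T \<subseteq> U" by blast
qed

lemma rotation_conjugates_subset: "rotation_conjugates r \<subseteq> Diff_plus r"
  by (auto simp: rotation_conjugates_def)

lemma topspace_AK_space: "topspace (AK_space r) = Diff_top r closure_of rotation_conjugates r"
  by (simp add: AK_space_def closure_of_subset_topspace Int_absorb1)

lemma AK_space_in_Diff_plus: "f \<in> topspace (AK_space r) \<Longrightarrow> f \<in> Diff_plus r"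
  unfolding topspace_AK_space
  using subsetD[OF closure_of_subset_topspace] by (metis topspace_Diff_top)

lemma AK_space_approx:
  assumes "f \<in> topspace (AK_space r)" "0 < \<epsilon>"
  obtains g where "g \<in> rotation_conjugates r" "\<And>x. x \<in> annulus \<Longrightarrow> dist (g x) (f x) < \<epsilon>"
proof -
  have f: "f \<in> Diff_top r closure_of rotation_conjugates r"
    using assms(1) by (simp add: topspace_AK_space)
  have fD: "f \<in> Diff_plus r" using assms(1) by (rule AK_space_in_Diff_plus)
  have "openin (Diff_top r) (Ck_ball r 0 f \<epsilon>)" "f \<in> Ck_ball r 0 f \<epsilon>"
    using assms(2) openin_Ck_ball[OF zero_le_enat fD] self_in_Ck_ball[OF fD] by auto
  then obtain g where "g \<in> rotation_conjugates r" "g \<in> Ck_ball r 0 f \<epsilon>"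
    using f unfolding in_closure_of by blast
  then show ?thesis using that by (auto simp: Ck_ball_0)
qed

text \<open>
  As conjugates of rotations are dense among Anosov-Katok maps by definition, an open set is dense
  if it meets every neighbourhood of every conjugate.
\<close>
lemma baire_generic_Inter:
  assumes "countable I"
    and op: "\<And>i. i \<in> I \<Longrightarrow> openin (Diff_top r) (U i)"
    and dense: "\<And>i f W. i \<in> I \<Longrightarrow> f \<in> rotation_conjugates r \<Longrightarrow> openin (Diff_top r) W \<Longrightarrow> f \<in> W \<Longrightarrow>
      \<exists>g\<in>rotation_conjugates r. g \<in> W \<and> g \<in> U i"
  shows "baire_generic (AK_space r) (topspace (AK_space r) \<inter> (\<Inter>i\<in>I. U i))"
proof -
  let ?C = "Diff_top r closure_of rotation_conjugates r"
  let ?U = "\<lambda>i. ?C \<inter> U i"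
  have C: "topspace (AK_space r) = ?C" by (rule topspace_AK_space)
  have RC: "rotation_conjugates r \<subseteq> ?C"
    using rotation_conjugates_subset by (intro closure_of_subset) (simp add: topspace_Diff_top)
  have o: "openin (AK_space r) (?U i)" if "i \<in> I" for i
    unfolding AK_space_def openin_subtopology using op[OF that] by blast
  have d: "AK_space r closure_of ?U i = topspace (AK_space r)" if i: "i \<in> I" for i
  proof (intro equalityI closure_of_subset_topspace subsetI)
    fix f assume f: "f \<in> topspace (AK_space r)"
    show "f \<in> AK_space r closure_of ?U i"
      unfolding in_closure_of
    proof (intro conjI f allI impI)
      fix T assume T: "f \<in> T \<and> openin (AK_space r) T"
      then obtain W where W: "openin (Diff_top r) W" "T = W \<inter> ?C"
        unfolding AK_space_def openin_subtopology by blast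
      obtain g where "g \<in> rotation_conjugates r" "g \<in> W"
        using f T W unfolding C in_closure_of by blast
      then obtain g' where "g' \<in> rotation_conjugates r" "g' \<in> W" "g' \<in> U i"
        using dense[OF i _ W(1)] by blast
      then show "\<exists>y. y \<in> ?U i \<and> y \<in> T" using RC W(2) by blast
    qed
  qed
  show ?thesis
    unfolding baire_generic_def
    using assms(1) o d C by (intro conjI exI[of _ "?U ` I"]) auto
qed

section \<open>Boundary circles\<close>

lemma open_subset_closed_ring:
  assumes "open S" "S \<subseteq> {u::complex. 1 \<le> norm u \<and> norm u \<le> 2}" "u \<in> S"
  shows "1 < norm u \<and> norm u < 2"
proof -
  obtain e where e: "e > 0" "ball u e \<subseteq> S" using assms(1,3) open_contains_ball by blast
  have u: "1 \<le> norm u" "norm u \<le> 2" using assms(2,3) by auto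
  have *: "1 \<le> \<bar>1 + c\<bar> * norm u \<and> \<bar>1 + c\<bar> * norm u \<le> 2" if "\<bar>c\<bar> * norm u < e" for c
  proof -
    have "u + c *\<^sub>R u \<in> ball u e" using that by (simp add: dist_norm)
    then have "u + c *\<^sub>R u \<in> {u. 1 \<le> norm u \<and> norm u \<le> 2}" using e(2) assms(2) by blast
    moreover have "u + c *\<^sub>R u = (1 + c) *\<^sub>R u" by (simp add: scaleR_left_distrib)
    ultimately show ?thesis by simp
  qed
  define c where "c = min (1/2) (e/4)"
  have c: "0 < c" "c < 1" using e(1) by (auto simp: c_def)
  have "c * norm u \<le> (e/4) * 2" using u c(1) by (intro mult_mono) (auto simp: c_def)
  then have "\<bar>c\<bar> * norm u < e" "\<bar>- c\<bar> * norm u < e" using e(1) c by auto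
  from *[OF this(1)] *[OF this(2)] c
  have "1 \<le> (1 - c) * norm u" "(1 + c) * norm u \<le> 2" by auto
  moreover have "0 < c * norm u" by (rule mult_pos_pos) (use u(1) c in linarith)+
  then have "(1 - c) * norm u < norm u" "norm u < (1 + c) * norm u"
    unfolding left_diff_distrib distrib_right by linarith+
  ultimately show ?thesis by linarith
qed

text \<open>
  Invariance of domain: seen in the plane, the image of the open annulus is an open subset of the
  closed annulus.
\<close>
lemma Cr_homeo_interior:
  assumes "Cr_homeo r H K" "x \<in> annulus" "0 < fst x" "fst x < 1"
  shows "0 < fst (H x) \<and> fst (H x) < 1"
proof -
  note D = Cr_homeoD[OF assms(1)]
  let ?O = "{u::complex. 1 < norm u \<and> norm u < 2}"
  let ?F = "\<lambda>u. to_plane (H (from_plane u))"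
  have fp: "from_plane u \<in> annulus" if "u \<in> ?O" for u using that by simp
  have "continuous_on ?O (\<lambda>u. H (from_plane u))"
  proof (rule continuous_on_compose2[OF D(1)])
    show "continuous_on ?O from_plane" by (rule continuous_on_from_plane) simp
    show "from_plane ` ?O \<subseteq> annulus" using fp by blast
  qed
  then have cont: "continuous_on ?O ?F"
    by (rule continuous_on_compose2[OF continuous_on_to_plane[of UNIV]]) simp
  have op: "open ?O"
    by (intro open_Collect_conj open_Collect_less continuous_intros)
  have inj: "inj_on ?F ?O"
  proof (rule inj_on_inverseI)
    fix u assume "u \<in> ?O"
    then show "to_plane (K (from_plane (?F u))) = u"
      using D fp by (simp add: from_to_plane del: from_plane_in_annulus)
  qed
  have F: "?F u \<in> {u. 1 \<le> norm u \<and> norm u \<le> 2}" if "u \<in> ?O" for u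
  proof -
    have "H (from_plane u) \<in> annulus" using D(3) fp[OF that] by blast
    then show ?thesis
      by (cases "H (from_plane u)") (simp add: norm_to_plane annulus_iff)
  qed
  have "open (?F ` ?O)" using cont op inj by (rule invariance_of_domain)
  moreover have "?F (to_plane x) \<in> ?F ` ?O"
    using norm_to_plane[OF assms(2)] assms(3,4) by (intro imageI) simp
  ultimately have "1 < norm (?F (to_plane x)) \<and> norm (?F (to_plane x)) < 2"
    using F by (intro open_subset_closed_ring[of "?F ` ?O"]) blast+
  then show ?thesis
    using norm_to_plane[OF D(3)[OF assms(2)]] assms(2) by (simp add: from_to_plane)
qed

lemma Cr_homeo_boundary:
  assumes "Cr_homeo r H K" "x \<in> annulus" "fst x = 0 \<or> fst x = 1"
  shows "fst (H x) = 0 \<or> fst (H x) = 1"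
proof (rule ccontr)
  assume *: "\<not> ?thesis"
  have x: "H x \<in> annulus" using Cr_homeoD(3)[OF assms(1,2)] .
  have "0 < fst (H x)" "fst (H x) < 1"
    using x * by (cases "H x"; auto simp: annulus_iff)+
  from Cr_homeo_interior[OF Cr_homeo_sym[OF assms(1)] x this]
  show False using Cr_homeoD(6)[OF assms(1,2)] assms(3) by auto
qed

text \<open>
  Whether a homeomorphism exchanges the two boundary circles.
\<close>
definition flips :: "(pt \<Rightarrow> pt) \<Rightarrow> bool" where
  "flips H \<longleftrightarrow> fst (H (0, 1)) = 1"

text \<open>
  The height takes only the values \<open>0\<close> and \<open>1\<close> on the image of a boundary circle and is constant
  there by connectedness. Surjectivity excludes that both circles go to the same one.
\<close>
lemma Cr_homeo_boundary_value:
  assumes "Cr_homeo r H K" "x \<in> annulus" "fst x = 0 \<or> fst x = 1"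
  shows "fst (H x) = (if flips H then 1 - fst x else fst x)"
proof -
  note D = Cr_homeoD[OF assms(1)]
  have const: "fst (H x) = fst (H (s, 1))" if "x \<in> annulus" "fst x = s" "s = 0 \<or> s = 1" for x s
  proof -
    let ?B = "{s} \<times> sphere (0::complex) 1"
    have B: "y \<in> annulus" "fst y = s" if "y \<in> ?B" for y
      using that \<open>s = 0 \<or> s = 1\<close> by (auto simp: annulus_def)
    have "connected ?B" by (intro connected_Times connected_sphere) auto
    moreover have "continuous_on ?B (\<lambda>y. fst (H y))"
      using B by (intro continuous_on_fst continuous_on_subset[OF D(1)]) blast
    ultimately have "connected ((\<lambda>y. fst (H y)) ` ?B)" by (rule connected_continuous_image[rotated])
    moreover have "(\<lambda>y. fst (H y)) ` ?B \<subseteq> {0, 1}"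
    proof (intro image_subsetI)
      fix y assume "y \<in> ?B"
      then show "fst (H y) \<in> {0, 1}"
        using Cr_homeo_boundary[OF assms(1) B(1)] B(2) that(3) by auto
    qed
    then have "finite ((\<lambda>y. fst (H y)) ` ?B)" by (rule finite_subset) simp
    ultimately have "(\<exists>a. (\<lambda>y. fst (H y)) ` ?B \<subseteq> {a})"
      using connected_finite_iff_sing by (metis empty_subsetI order_refl)
    moreover have "x \<in> ?B" "(s, 1) \<in> ?B" using that by (auto simp: annulus_def)
    ultimately show ?thesis by blast
  qed
  have v: "fst (H (s, 1)) = 0 \<or> fst (H (s, 1)) = 1" if "s = 0 \<or> s = 1" for s
    using that by (intro Cr_homeo_boundary[OF assms(1)]) (auto simp: annulus_iff)
  have onto: "s = fst (H (0, 1)) \<or> s = fst (H (1, 1))" if "s = 0 \<or> s = 1" for s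
  proof -
    have "(s, 1) \<in> annulus" using that by (auto simp: annulus_iff)
    then have y: "K (s, 1) \<in> annulus" "fst (H (K (s, 1))) = s" using D by simp_all
    have "fst (K (s, 1)) = 0 \<or> fst (K (s, 1)) = 1"
      using Cr_homeo_boundary[OF Cr_homeo_sym[OF assms(1)] \<open>(s, 1) \<in> annulus\<close>] that by simp
    then show ?thesis using const[OF y(1)] y(2) by metis
  qed
  show ?thesis
    using const[OF assms(2) refl assms(3)] assms(3) v[of 0] v[of 1] onto[of 0] onto[of 1]
    by (auto simp: flips_def)
qed

lemma rot_conj_boundary:
  assumes "Cr_homeo r H K" "x \<in> annulus" "fst x = 0 \<or> fst x = 1"
  shows "fst (rot_conj H K \<alpha> x) = fst x"
proof -
  note D = Cr_homeoD[OF assms(1)]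
  have K: "K x \<in> annulus" "fst (K x) = 0 \<or> fst (K x) = 1"
    using D(4)[OF assms(2)] Cr_homeo_boundary[OF Cr_homeo_sym[OF assms(1)] assms(2,3)] by auto
  have r: "fst (rotation \<alpha> (K x)) = fst (K x)" by (simp add: rotation_def case_prod_unfold)
  have "fst (H (rotation \<alpha> (K x))) = fst (H (K x))"
    using Cr_homeo_boundary_value[OF assms(1) K] Cr_homeo_boundary_value[OF assms(1), of "rotation \<alpha> (K x)"] K r
    by simp
  then show ?thesis using D(5)[OF assms(2)] assms(2) by (simp add: rot_conj_def)
qed

text \<open>
  Conjugates of rotations preserve both boundary circles even if the conjugacy exchanges them, and
  this passes to uniform limits.
\<close>
lemma AK_space_boundary:
  assumes "f \<in> topspace (AK_space r)" "x \<in> annulus" "fst x = 0 \<or> fst x = 1"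
  shows "fst (f x) = fst x"
proof -
  have "\<bar>fst (f x) - fst x\<bar> < \<epsilon>" if pos: "\<epsilon> > 0" for \<epsilon>
  proof -
    obtain g where g: "g \<in> rotation_conjugates r" "\<And>x. x \<in> annulus \<Longrightarrow> dist (g x) (f x) < \<epsilon>"
      using AK_space_approx[OF assms(1) pos] by blast
    obtain h k \<alpha> where "Cr_homeo r h k" "g = rot_conj h k \<alpha>" using rotation_conjugatesE[OF g(1)] by blast
    then have "fst (g x) = fst x" using rot_conj_boundary assms(2,3) by blast
    then show ?thesis
      using g(2)[OF assms(2)] dist_fst_le[of "g x" "f x"] by (simp add: dist_real_def abs_minus_commute)
  qed
  from this[of "\<bar>fst (f x) - fst x\<bar>"] show ?thesis by fastforce
qed

lemma AK_space_homeomorphism: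
  assumes "f \<in> topspace (AK_space r)"
  shows "continuous_on annulus f" "\<And>x. x \<in> annulus \<Longrightarrow> f x \<in> annulus"
proof -
  have "f \<in> Diff_plus r" using assms by (rule AK_space_in_Diff_plus)
  then show "continuous_on annulus f" "\<And>x. x \<in> annulus \<Longrightarrow> f x \<in> annulus"
    by (auto simp: Diff_plus_def Diff_ann_def homeomorphism_def)
qed

section \<open>The twisting diffeomorphisms\<close>

text \<open>
  Translation by \<open>v\<close> in the coordinate \<open>ln (y / (1 - y))\<close>: a flow on \<open>[0,1]\<close>, given by a formula that
  is smooth up to the end points.
\<close>
definition lshift :: "real \<Rightarrow> real \<Rightarrow> real" where
  "lshift y v = y * exp v / (1 - y + y * exp v)"

lemma lshift_denom_pos:
  assumes "0 \<le> (y::real)" "y \<le> 1" shows "0 < 1 - y + y * exp v"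
proof (cases "y = 1")
  case False
  then have "0 < 1 - y" using assms by auto
  then show ?thesis using assms(1) by (intro add_pos_nonneg) auto
qed simp

lemma lshift_bounds:
  assumes "0 \<le> y" "y \<le> 1" shows "0 \<le> lshift y v" "lshift y v \<le> 1"
  using lshift_denom_pos[OF assms, of v] assms by (auto simp: lshift_def divide_le_eq)

lemma lshift_0_1 [simp]: "lshift 0 v = 0" "lshift 1 v = 1"
  by (auto simp: lshift_def)

lemma lshift_zero [simp]: "lshift y 0 = y"
  by (auto simp: lshift_def)

lemma lshift_add:
  assumes "0 \<le> y" "y \<le> 1" shows "lshift (lshift y u) v = lshift y (u + v)"
proof -
  let ?D = "1 - y + y * exp u"
  have D: "?D > 0" using lshift_denom_pos[OF assms] .
  have E: "1 - y + y * exp u * exp v > 0" using lshift_denom_pos[OF assms, of "u + v"] by (simp add: exp_add mult.assoc)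
  have 1: "1 - lshift y u = (1 - y) / ?D" using D by (simp add: lshift_def field_simps)
  have 2: "lshift y u * exp v = y * exp u * exp v / ?D" by (simp add: lshift_def)
  have "1 - lshift y u + lshift y u * exp v = (1 - y + y * exp u * exp v) / ?D"
    unfolding 1 2 by (simp add: add_divide_distrib)
  then have "lshift (lshift y u) v = (y * exp u * exp v / ?D) / ((1 - y + y * exp u * exp v) / ?D)"
    using 2 by (simp add: lshift_def[of "lshift y u"])
  also have "\<dots> = y * exp u * exp v / (1 - y + y * exp u * exp v)" using D by simp
  finally show ?thesis by (simp add: lshift_def exp_add mult.assoc)
qed

text \<open>
  For large \<open>\<bar>v\<bar>\<close> everything away from the end points is pushed close to one of them, uniformly.
\<close>
lemma lshift_extreme:
  assumes \<delta>: "0 < \<delta>" "\<delta> \<le> y" "y \<le> 1 - \<delta>" and V: "1 / \<delta>\<^sup>2 < exp V"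
  shows "V \<le> v \<Longrightarrow> 1 - \<delta> < lshift y v" "v \<le> - V \<Longrightarrow> lshift y v < \<delta>"
proof -
  have y: "0 < y" "y < 1" using \<delta> by auto
  have D: "0 < 1 - y + y * exp v" using y by (intro lshift_denom_pos) auto
  have V': "1 < \<delta> * (\<delta> * exp V)" using V \<delta>(1) by (simp add: field_simps power2_eq_square)
  show "1 - \<delta> < lshift y v" if "V \<le> v"
  proof -
    have "exp V \<le> exp v" using that by simp
    then have "\<delta> * (\<delta> * exp V) \<le> \<delta> * (y * exp v)" using \<delta> y by (intro mult_mono) auto
    then have "1 < \<delta> * (y * exp v)" using V' by linarith
    moreover have "(1 - \<delta>) * (1 - y + y * exp v) = y * exp v + (1 - \<delta>) * (1 - y) - \<delta> * (y * exp v)"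
      by (simp add: algebra_simps)
    moreover have "(1 - \<delta>) * (1 - y) \<le> 1 * 1" using \<delta> y by (intro mult_mono) auto
    ultimately have "(1 - \<delta>) * (1 - y + y * exp v) < y * exp v" by linarith
    then show ?thesis using D by (simp add: lshift_def less_divide_eq)
  qed
  show "lshift y v < \<delta>" if "v \<le> - V"
  proof -
    have "\<delta> * (\<delta> * exp V) * exp v \<le> \<delta> * \<delta>"
    proof -
      have "exp V * exp v \<le> 1" using that by (simp flip: exp_add)
      then have "(\<delta> * \<delta>) * (exp V * exp v) \<le> (\<delta> * \<delta>) * 1" using \<delta>(1) by (intro mult_left_mono) auto
      then show ?thesis by (simp add: mult.assoc)
    qed
    moreover have "1 * exp v < \<delta> * (\<delta> * exp V) * exp v" using V' by (intro mult_strict_right_mono) auto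
    ultimately have "exp v < \<delta> * \<delta>" by linarith
    moreover have "y * exp v \<le> 1 * exp v" using y by (intro mult_right_mono) auto
    moreover have "\<delta> * \<delta> \<le> \<delta> * (1 - y)" using \<delta> by (intro mult_left_mono) auto
    moreover have "\<delta> * (1 - y) \<le> \<delta> * (1 - y + y * exp v)" using \<delta>(1) y by (intro mult_left_mono) auto
    ultimately have "y * exp v < \<delta> * (1 - y + y * exp v)" by linarith
    then show ?thesis using D by (simp add: lshift_def divide_less_eq)
  qed
qed

text \<open>
  The function \<open>sin (\<pi> x) sin (\<pi> (x - d))\<close> of \<open>w = cis (2 \<pi> x)\<close>. On a period it is negative for
  \<open>0 < x < d\<close> and positive for \<open>d < x < 1\<close>, so it decides which part of the circle is pushed to
  which side; its zero at \<open>w = 1\<close> is the place where points stay.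
\<close>
definition twist :: "real \<Rightarrow> complex \<Rightarrow> real" where
  "twist d w = (cos (pi * d) - Re (w * cis (- pi * d))) / 2"

lemma twist_cis: "twist d (cis (2 * pi * x)) = sin (pi * x) * sin (pi * (x - d))"
proof -
  have "Re (cis (2 * pi * x) * cis (- pi * d)) = cos (2 * pi * x - pi * d)"
    by (simp add: cis_mult)
  also have "2 * pi * x - pi * d = pi * x + pi * (x - d)" by (simp add: algebra_simps)
  also have "cos (pi * d) = cos (pi * x - pi * (x - d))" by (simp add: algebra_simps)
  then have "(cos (pi * d) - cos (pi * x + pi * (x - d))) / 2 = sin (pi * x) * sin (pi * (x - d))"
    by (simp add: sin_times_sin)
  finally show ?thesis by (simp add: twist_def)
qed

lemma twist_le: "\<bar>twist d w\<bar> \<le> norm (w - 1) / 2"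
proof -
  have "twist d w = - Re ((w - 1) * cis (- pi * d)) / 2"
    by (simp add: twist_def algebra_simps)
  moreover have "\<bar>Re ((w - 1) * cis (- pi * d))\<bar> \<le> norm (w - 1)"
    using abs_Re_le_cmod[of "(w - 1) * cis (- pi * d)"] by (simp add: norm_mult)
  ultimately show ?thesis by simp
qed

text \<open>
  The angle, in turns, by which the disc automorphism \<open>w \<mapsto> (w + a) / (1 + a w)\<close> moves a point of
  the unit circle backwards. Taking it to be a function of \<open>w\<close> avoids any choice of branch.
\<close>
definition moebius_shift :: "real \<Rightarrow> complex \<Rightarrow> real" where
  "moebius_shift a w = arctan (a * Im w / (1 + a * Re w)) / pi"

lemma moebius_shift_bound: "\<bar>moebius_shift a w\<bar> \<le> 1 / 2"
  using arctan_bounded[of "a * Im w / (1 + a * Re w)"]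
  by (auto simp: moebius_shift_def abs_le_iff field_simps)

lemma Re_denom_pos:
  assumes "\<bar>a\<bar> < 1" "norm w = 1" shows "0 < 1 + a * Re w"
proof -
  have "\<bar>a * Re w\<bar> \<le> \<bar>a\<bar> * 1"
    unfolding abs_mult using abs_Re_le_cmod[of w] assms(2) by (intro mult_left_mono) auto
  then show ?thesis using assms(1) by linarith
qed

lemma cis_arctan: "cis (- 2 * arctan x) = (1 - \<i> * x) / (1 + \<i> * x)"
proof -
  let ?r = "sqrt (1 + x\<^sup>2)"
  have r: "?r > 0" "?r\<^sup>2 = 1 + x\<^sup>2" by (auto simp: add_pos_nonneg)
  have c: "cis (- arctan x) = (1 - \<i> * x) / ?r"
    using r(1) by (simp add: complex_eq_iff cos_arctan sin_arctan Re_divide_of_real Im_divide_of_real)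
  have nz: "1 + \<i> * complex_of_real x \<noteq> 0" by (simp add: complex_eq_iff)
  have rr: "complex_of_real ?r * complex_of_real ?r = complex_of_real (?r\<^sup>2)"
    by (simp only: of_real_mult[symmetric] power2_eq_square)
  have "cis (- 2 * arctan x) = cis (- arctan x) * cis (- arctan x)" by (simp add: cis_mult)
  also have "\<dots> = (1 - \<i> * x) * (1 - \<i> * x) / (complex_of_real (?r\<^sup>2))"
    unfolding c times_divide_times_eq rr ..
  also have "complex_of_real (?r\<^sup>2) = (1 - \<i> * x) * (1 + \<i> * x)"
    unfolding r(2) by (simp add: algebra_simps power2_eq_square)
  finally show ?thesis using nz by (simp add: complex_eq_iff)
qed

definition moebius :: "real \<Rightarrow> complex \<Rightarrow> complex" where
  "moebius a w = w * cis (- 2 * pi * moebius_shift a w)"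

lemma moebius_eq:
  assumes "\<bar>a\<bar> < 1" "norm w = 1"
  shows "moebius a w = (w + a) / (1 + a * w)"
proof -
  define x y where "x = 1 + a * Re w" and "y = a * Im w"
  have x: "x > 0" unfolding x_def by (rule Re_denom_pos[OF assms])
  have u: "complex_of_real x + \<i> * y = 1 + a * w" "complex_of_real x - \<i> * y = 1 + a * cnj w"
    by (simp_all add: complex_eq_iff x_def y_def)
  have "cis (- 2 * pi * moebius_shift a w) = cis (- 2 * arctan (y / x))"
    by (simp add: moebius_shift_def x_def y_def)
  also have "\<dots> = (1 - \<i> * (y / x)) / (1 + \<i> * (y / x))"
    unfolding cis_arctan by simp
  also have "\<dots> = ((1 - \<i> * (y / x)) * x) / ((1 + \<i> * (y / x)) * x)"
    using x by (subst mult_divide_mult_cancel_right) auto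
  also have "\<dots> = (x - \<i> * y) / (x + \<i> * y)"
    using x by (simp add: left_diff_distrib distrib_right)
  also have "\<dots> = (1 + a * cnj w) / (1 + a * w)" unfolding u ..
  finally have "moebius a w = (w + a * (w * cnj w)) / (1 + a * w)"
    by (simp add: moebius_def algebra_simps)
  moreover have "w * cnj w = 1" using complex_norm_square[of w] assms(2) by simp
  ultimately show ?thesis by simp
qed

text \<open>
  The automorphisms with parameters \<open>a\<close> and \<open>- a\<close> are inverse to each other; for the angles this
  is an identity between the arguments of the two arcus tangents.
\<close>
lemma moebius_shift_moebius:
  assumes "\<bar>a\<bar> < 1" "norm w = 1"
  shows "moebius_shift (- a) (moebius a w) = - moebius_shift a w"
proof -
  define x y where "x = Re w" and "y = Im w"
  have w: "w = Complex x y" by (simp add: x_def y_def complex_eq_iff)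
  have n: "x * x + y * y = 1"
    using assms(2) by (simp add: x_def y_def cmod_def power2_eq_square)
  have xa: "0 < 1 + a * x" using Re_denom_pos[OF assms] by (simp add: x_def)
  define D where "D = (1 + a * x) * (1 + a * x) + (a * y) * (a * y)"
  have D: "D > 0" unfolding D_def using xa by (intro add_pos_nonneg) auto
  have D2: "D = 1 + 2 * a * x + a * a"
  proof -
    have "D = 1 + 2 * a * x + a * a * (x * x + y * y)" by (simp add: D_def algebra_simps)
    then show ?thesis by (simp add: n)
  qed
  have m: "moebius a w = (w + a) / (1 + a * w)" by (rule moebius_eq[OF assms])
  have Im: "Im (moebius a w) = (1 - a * a) * y / D"
    unfolding m by (simp add: w Im_divide D_def power2_eq_square) (simp add: algebra_simps)
  have "Re (moebius a w) = ((x + a) * (1 + a * x) + y * (a * y)) / D"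
    unfolding m by (simp add: w Re_divide D_def power2_eq_square)
  also have "(x + a) * (1 + a * x) + y * (a * y) = x + a + a * a * x + a * (x * x + y * y)"
    by (simp add: algebra_simps)
  finally have Re: "Re (moebius a w) = (x + 2 * a + a * a * x) / D" by (simp add: n algebra_simps)
  have R1: "1 - a * Re (moebius a w) = (1 - a * a) * (1 + a * x) / D"
    unfolding Re using D by (simp add: field_simps) (simp add: D2 algebra_simps)
  have aa: "1 - a * a > 0"
  proof -
    have "\<bar>a\<bar> * \<bar>a\<bar> < 1 * 1" using assms(1) by (intro mult_strict_mono) auto
    then show ?thesis by simp
  qed
  have "Im (moebius a w) / (1 - a * Re (moebius a w)) = y / (1 + a * x)"
    unfolding Im R1 using D aa xa by simp
  then have r: "(- a) * Im (moebius a w) / (1 + (- a) * Re (moebius a w)) = - (a * y / (1 + a * x))"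
    by (metis (no_types, lifting) minus_mult_left times_divide_eq_right uminus_add_conv_diff add.commute)
  show ?thesis
    unfolding moebius_shift_def r x_def[symmetric] y_def[symmetric] arctan_minus by simp
qed

text \<open>
  As \<open>a\<close> tends to \<open>1\<close>, everything outside a neighbourhood of the repelling fixed point \<open>- 1\<close> is
  contracted to the attracting fixed point \<open>1\<close>.
\<close>
lemma moebius_contracts:
  assumes "norm w = 1" "0 < a" "a < 1" "1 - a \<le> e / 2" "e \<le> norm (w + 1)" "0 < e"
  shows "norm (moebius a w - 1) \<le> 4 * (1 - a) / e"
proof -
  have na: "norm (complex_of_real (1 - a)) = 1 - a" using assms by (subst norm_of_real) simp
  have "norm (w + 1) = norm ((1 + a * w) + complex_of_real (1 - a) * w)" by (simp add: algebra_simps)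
  also have "\<dots> \<le> norm (1 + a * w) + norm (complex_of_real (1 - a) * w)" by (rule norm_triangle_ineq)
  also have "norm (complex_of_real (1 - a) * w) = 1 - a"
    unfolding norm_mult na using assms(1) by simp
  finally have n: "e / 2 \<le> norm (1 + a * w)" using assms(4,5) by simp
  then have nz: "1 + a * w \<noteq> 0" using assms(6) by auto
  have "moebius a w - 1 = complex_of_real (1 - a) * (w - 1) / (1 + a * w)"
  proof -
    have "moebius a w = (w + a) / (1 + a * w)" using assms by (intro moebius_eq) auto
    then have "moebius a w - 1 = (w + a - (1 + a * w)) / (1 + a * w)" using nz by (simp add: diff_divide_distrib)
    also have "w + a - (1 + a * w) = complex_of_real (1 - a) * (w - 1)" by (simp add: algebra_simps)
    finally show ?thesis .
  qed
  then have "norm (moebius a w - 1) = (1 - a) * norm (w - 1) / norm (1 + a * w)"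
    by (simp only: norm_mult norm_divide na)
  also have "\<dots> \<le> (1 - a) * 2 / (e / 2)"
  proof (intro frac_le mult_left_mono)
    show "norm (w - 1) \<le> 2" using norm_triangle_ineq4[of w 1] assms(1) by simp
  qed (use assms n in auto)
  finally show ?thesis by simp
qed

text \<open>
  The height is moved along \<open>lshift\<close> by \<open>K\<close> times the twist of the \<open>q\<close>-fold angle, and the angle by
  the lift of a Moebius map to the \<open>q\<close>-fold cover of the circle followed by the rotation \<open>\<beta>\<close>. All
  terms depend on the angle through \<open>z ^ q\<close>, so the map commutes with the rotation by \<open>1/q\<close>, and no
  angle is moved by more than \<open>2/q\<close> turns if \<open>0 \<le> \<beta> \<le> 1/q\<close>.
\<close>
definition psi :: "nat \<Rightarrow> real \<Rightarrow> real \<Rightarrow> real \<Rightarrow> real \<Rightarrow> pt \<Rightarrow> pt" where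
  "psi q d K a \<beta> = (\<lambda>(s, z).
     (lshift s (K * twist d (z ^ q)), z * cis (2 * pi * (\<beta> - moebius_shift (- a) (z ^ q) / q))))"

definition psi_inv :: "nat \<Rightarrow> real \<Rightarrow> real \<Rightarrow> real \<Rightarrow> real \<Rightarrow> pt \<Rightarrow> pt" where
  "psi_inv q d K a \<beta> = (\<lambda>(s, z).
     let z1 = z * cis (- 2 * pi * \<beta>); z2 = z1 * cis (- 2 * pi * (moebius_shift a (z1 ^ q) / q))
     in (lshift s (- K * twist d (z2 ^ q)), z2))"

locale twisting =
  fixes q :: nat and d K a \<beta> :: real
  assumes q: "0 < q" and a: "\<bar>a\<bar> < 1"
begin

lemma pow_q: "(z * cis (- 2 * pi * (moebius_shift a (z ^ q) / q))) ^ q = moebius a (z ^ q)"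
  using q by (simp add: power_mult_distrib Complex.DeMoivre moebius_def)

lemma psi_psi_inv:
  assumes "x \<in> annulus"
  shows "psi q d K a \<beta> (psi_inv q d K a \<beta> x) = x" "psi_inv q d K a \<beta> x \<in> annulus"
proof -
  obtain s z where x: "x = (s, z)" "0 \<le> s" "s \<le> 1" "norm z = 1"
    using assms by (cases x) (auto simp: annulus_iff)
  define z1 where "z1 = z * cis (- 2 * pi * \<beta>)"
  define z2 where "z2 = z1 * cis (- 2 * pi * (moebius_shift a (z1 ^ q) / q))"
  have n: "norm z1 = 1" "norm z2 = 1" using x by (auto simp: z1_def z2_def norm_mult)
  have inv: "psi_inv q d K a \<beta> x = (lshift s (- K * twist d (z2 ^ q)), z2)"
    by (simp add: psi_inv_def x z1_def z2_def Let_def)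
  then show "psi_inv q d K a \<beta> x \<in> annulus" using x n lshift_bounds by (auto simp: annulus_iff)
  define \<mu> where "\<mu> = moebius_shift a (z1 ^ q)"
  have "z2 ^ q = moebius a (z1 ^ q)" unfolding z2_def by (rule pow_q)
  then have m: "moebius_shift (- a) (z2 ^ q) = - \<mu>"
    using moebius_shift_moebius[OF a] n by (simp add: norm_power \<mu>_def)
  have z2: "z2 = z * cis (- 2 * pi * \<beta>) * cis (- 2 * pi * (\<mu> / q))"
    unfolding z2_def \<mu>_def[symmetric] unfolding z1_def ..
  have "z2 * cis (2 * pi * (\<beta> - moebius_shift (- a) (z2 ^ q) / q)) = z"
    unfolding m unfolding z2 by (simp add: mult.assoc cis_mult algebra_simps)
  then show "psi q d K a \<beta> (psi_inv q d K a \<beta> x) = x"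
    unfolding inv using x by (simp add: psi_def lshift_add)
qed

lemma psi_inv_psi:
  assumes "x \<in> annulus"
  shows "psi_inv q d K a \<beta> (psi q d K a \<beta> x) = x" "psi q d K a \<beta> x \<in> annulus"
proof -
  obtain s z where x: "x = (s, z)" "0 \<le> s" "s \<le> 1" "norm z = 1"
    using assms by (cases x) (auto simp: annulus_iff)
  define z1 where "z1 = z * cis (- 2 * pi * (moebius_shift (- a) (z ^ q) / q))"
  have n: "norm z1 = 1" using x by (auto simp: z1_def norm_mult)
  have psi: "psi q d K a \<beta> x = (lshift s (K * twist d (z ^ q)), z1 * cis (2 * pi * \<beta>))"
    by (simp add: psi_def x z1_def mult.assoc cis_mult algebra_simps)
  then show "psi q d K a \<beta> x \<in> annulus" using x n lshift_bounds by (auto simp: annulus_iff norm_mult)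
  have "z1 ^ q = moebius (- a) (z ^ q)"
    unfolding z1_def using q by (simp add: power_mult_distrib Complex.DeMoivre moebius_def)
  then have m: "moebius_shift a (z1 ^ q) = - moebius_shift (- a) (z ^ q)"
    using moebius_shift_moebius[of "- a"] a x by (simp add: norm_power)
  have z1: "z1 * cis (2 * pi * \<beta>) * cis (- 2 * pi * \<beta>) = z1"
    by (simp add: mult.assoc cis_mult)
  have z: "z1 * cis (- 2 * pi * (moebius_shift a (z1 ^ q) / q)) = z"
    unfolding m unfolding z1_def by (simp add: mult.assoc cis_mult)
  show "psi_inv q d K a \<beta> (psi q d K a \<beta> x) = x"
    unfolding psi psi_inv_def Let_def prod.case z1 z using x by (simp add: lshift_add)
qed

lemma psi_rotation:
  "psi q d K a \<beta> (rotation (real p / q) x) = rotation (real p / q) (psi q d K a \<beta> x)"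
proof -
  have "cis (2 * pi * (real p / q)) ^ q = 1"
  proof -
    have "cis (2 * pi * (real p / q)) ^ q = cis (2 * pi * real p)" using q by (simp add: Complex.DeMoivre)
    also have "\<dots> = 1" by (rule cis_multiple_2pi) simp
    finally show ?thesis .
  qed
  then show ?thesis
    by (cases x) (simp add: psi_def rotation_def power_mult_distrib)
qed

lemma Ckfam_twist:
  assumes "Ckfam k (\<lambda>_::real. f)"
  shows "Ckfam k (\<lambda>_::real. \<lambda>p. K' * twist d (cis (2 * pi * f p) ^ q))"
proof -
  have "Ckfam k (\<lambda>_::real. \<lambda>p. q * (2 * pi * f p))"
    by (intro Ckfam_mult Ckfam_const assms)
  then have "Ckfam k (\<lambda>_::real. \<lambda>p. cis (q * (2 * pi * f p)))" by (rule Ckfam_cis)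
  then have w: "Ckfam k (\<lambda>_::real. \<lambda>p. cis (2 * pi * f p) ^ q)" by (simp add: Complex.DeMoivre)
  have "Ckfam k (\<lambda>_::real. \<lambda>p. K' * ((cos (pi * d) + (- 1) * Re (cis (2 * pi * f p) ^ q * cis (- pi * d))) * (1 / 2)))"
    by (intro Ckfam_mult Ckfam_const Ckfam_add Ckfam_linear[OF bounded_linear_Re] w)
  moreover have "twist d w = (cos (pi * d) + (- 1) * Re (w * cis (- pi * d))) * (1 / 2)" for w
    by (simp add: twist_def)
  ultimately show ?thesis by presburger
qed

lemma Ckfam_moebius_shift:
  assumes "Ckfam k (\<lambda>_::real. f)" "\<bar>b\<bar> < 1"
  shows "Ckfam k (\<lambda>_::real. \<lambda>p. moebius_shift b (cis (2 * pi * f p) ^ q))"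
proof -
  have "Ckfam k (\<lambda>_::real. \<lambda>p. q * (2 * pi * f p))"
    by (intro Ckfam_mult Ckfam_const assms)
  then have "Ckfam k (\<lambda>_::real. \<lambda>p. cis (q * (2 * pi * f p)))" by (rule Ckfam_cis)
  then have w: "Ckfam k (\<lambda>_::real. \<lambda>p. cis (2 * pi * f p) ^ q)" by (simp add: Complex.DeMoivre)
  have nz: "1 + b * Re (cis (2 * pi * f p) ^ q) \<noteq> 0" for p
    using Re_denom_pos[OF assms(2), of "cis (2 * pi * f p) ^ q"] by (simp add: norm_power)
  have "Ckfam k (\<lambda>_::real. \<lambda>p. arctan (b * Im (cis (2 * pi * f p) ^ q) /
      (1 + b * Re (cis (2 * pi * f p) ^ q))) * (1 / pi))"
    by (intro Ckfam_mult Ckfam_const Ckfam_add Ckfam_arctan Ckfam_divide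
        Ckfam_linear[OF bounded_linear_Re] Ckfam_linear[OF bounded_linear_Im] w nz)
  then show ?thesis by (simp add: moebius_shift_def)
qed

lemma Ckfam_lshift:
  assumes "Ckfam k (\<lambda>_::real. f)" "\<And>p. p \<in> strip \<Longrightarrow> 0 \<le> g p \<and> g p \<le> 1" "Ckfam k (\<lambda>_::real. g)"
  shows "Ckfam k (\<lambda>_::real. \<lambda>p. lshift (g p) (f p))"
proof -
  have "Ckfam k (\<lambda>_::real. \<lambda>p. g p * exp (f p) / ((1 + (- 1) * g p) + g p * exp (f p)))"
  proof (intro Ckfam_divide Ckfam_mult Ckfam_exp Ckfam_add Ckfam_const assms)
    fix p assume "p \<in> strip"
    then show "1 + - 1 * g p + g p * exp (f p) \<noteq> 0"
      using lshift_denom_pos[of "g p" "f p"] assms(2)[of p] by simp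
  qed
  then show ?thesis by (simp add: lshift_def)
qed

lemma Ckfam_ann_proj:
  assumes "Ckfam k (\<lambda>_::real. f)" "Ckfam k (\<lambda>_::real. g)"
  shows "Ckfam k (\<lambda>_::real. \<lambda>p. (f p, cis (2 * pi * g p)))"
  by (intro Ckfam_Pair Ckfam_cis Ckfam_mult Ckfam_const assms)

lemma Cr_map_psi: "Cr_map r (psi q d K a \<beta>)"
  unfolding Cr_map_def
proof (intro allI impI)
  fix k
  let ?G = "\<lambda>p. snd p + (\<beta> + (- 1 / q) * moebius_shift (- a) (cis (2 * pi * snd p) ^ q))"
  have "Ckfam k (\<lambda>_::real. \<lambda>p. (lshift (fst p) (K * twist d (cis (2 * pi * snd p) ^ q)), cis (2 * pi * ?G p)))"
    using a by (intro Ckfam_ann_proj Ckfam_lshift Ckfam_twist Ckfam_add Ckfam_mult Ckfam_const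
        Ckfam_moebius_shift Ckfam_fst Ckfam_snd) (auto simp: strip_def)
  moreover have "(lshift (fst p) (K * twist d (cis (2 * pi * snd p) ^ q)), cis (2 * pi * ?G p))
      = (psi q d K a \<beta> \<circ> ann_proj) p" for p
    by (simp add: psi_def ann_proj_def case_prod_unfold cis_mult algebra_simps)
  ultimately show "Ck_strip k (psi q d K a \<beta> \<circ> ann_proj)"
    unfolding Ck_strip_iff[where 'p = real] by (simp add: o_def)
qed

lemma Cr_map_psi_inv: "Cr_map r (psi_inv q d K a \<beta>)"
  unfolding Cr_map_def
proof (intro allI impI)
  fix k
  let ?G1 = "\<lambda>p::real\<times>real. snd p + (- \<beta>)"
  let ?G = "\<lambda>p. ?G1 p + (- 1 / q) * moebius_shift a (cis (2 * pi * ?G1 p) ^ q)"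
  have "Ckfam k (\<lambda>_::real. \<lambda>p. (lshift (fst p) (- K * twist d (cis (2 * pi * ?G p) ^ q)), cis (2 * pi * ?G p)))"
    using a by (intro Ckfam_ann_proj Ckfam_lshift Ckfam_twist Ckfam_add Ckfam_mult Ckfam_const
        Ckfam_moebius_shift Ckfam_fst Ckfam_snd) (auto simp: strip_def)
  moreover have "(lshift (fst p) (- K * twist d (cis (2 * pi * ?G p) ^ q)), cis (2 * pi * ?G p))
      = (psi_inv q d K a \<beta> \<circ> ann_proj) p" for p
  proof -
    have 1: "cis (2 * pi * snd p) * cis (- 2 * pi * \<beta>) = cis (2 * pi * ?G1 p)"
      by (simp add: cis_mult algebra_simps)
    have 2: "cis (2 * pi * ?G1 p) * cis (- 2 * pi * (moebius_shift a (cis (2 * pi * ?G1 p) ^ q) / q)) = cis (2 * pi * ?G p)"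
      unfolding cis_mult by (rule arg_cong[of _ _ cis]) (simp add: algebra_simps)
    show ?thesis
      unfolding psi_inv_def ann_proj_def o_def case_prod_unfold fst_conv snd_conv Let_def 1 2 ..
  qed
  ultimately show "Ck_strip k (psi_inv q d K a \<beta> \<circ> ann_proj)"
    unfolding Ck_strip_iff[where 'p = real] by (simp add: o_def)
qed

lemma continuous_psi: "continuous_on annulus (psi q d K a \<beta>)"
proof -
  have 1: "1 - fst x + fst x * exp v \<noteq> 0" if "x \<in> annulus" for x v
    using lshift_denom_pos[of "fst x" v] that by (cases x) (auto simp: annulus_iff)
  have 2: "1 + - a * Re (snd x ^ q) \<noteq> 0" if "x \<in> annulus" for x
    using Re_denom_pos[of "- a" "snd x ^ q"] a that by (cases x) (auto simp: annulus_iff norm_power)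
  show ?thesis
    unfolding psi_def lshift_def twist_def moebius_shift_def case_prod_unfold
    using q 1 2 by (intro continuous_intros) auto
qed

lemma Cr_homeo_psi: "Cr_homeo r (psi q d K a \<beta>) (psi_inv q d K a \<beta>)"
proof -
  have "homeomorphism annulus annulus (psi q d K a \<beta>) (psi_inv q d K a \<beta>)"
  proof (rule homeomorphism_compact[THEN exE])
    show "compact annulus" by (rule compact_annulus)
    show "continuous_on annulus (psi q d K a \<beta>)" by (rule continuous_psi)
    show "psi q d K a \<beta> ` annulus = annulus"
      using psi_psi_inv psi_inv_psi by (force simp: image_iff)
    show "inj_on (psi q d K a \<beta>) annulus"
      using psi_inv_psi(1) by (rule inj_on_inverseI)
    fix g assume g: "homeomorphism annulus annulus (psi q d K a \<beta>) g"
    have "g x = psi_inv q d K a \<beta> x" if "x \<in> annulus" for x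
      using g psi_psi_inv[OF that] unfolding homeomorphism_def by metis
    then show ?thesis using g by (elim homeomorphism_cong) auto
  qed
  then show ?thesis using Cr_map_psi Cr_map_psi_inv by (simp add: Cr_homeo_def)
qed

lemma fst_psi_inv_boundary:
  assumes "fst x = 0 \<or> fst x = 1" shows "fst (psi_inv q d K a \<beta> x) = fst x"
  using assms by (auto simp: psi_inv_def Let_def case_prod_unfold)

end

section \<open>Orbits of rational rotations\<close>

definition birkhoff :: "(pt \<Rightarrow> pt) \<Rightarrow> (pt \<Rightarrow> real) \<Rightarrow> nat \<Rightarrow> pt \<Rightarrow> real" where
  "birkhoff f \<phi> n x = (\<Sum>i<n. \<phi> ((f ^^ i) x)) / n"

lemma funpow_rot_conj:
  assumes "Cr_homeo r H K" "x \<in> annulus"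
  shows "(rot_conj H K \<alpha> ^^ i) x = H (rotation (i * \<alpha>) (K x))"
proof (induction i)
  case 0
  then show ?case using Cr_homeoD[OF assms(1)] assms(2) by simp
next
  case (Suc i)
  then show ?case using Cr_homeoD[OF assms(1)] assms(2)
    by (simp add: rot_conj_def rotation_rotation algebra_simps)
qed

lemma rotation_add_1: "rotation (\<alpha> + 1) x = rotation \<alpha> x"
  by (cases x) (simp add: rotation_def distrib_left flip: cis_mult)

lemma periodic_mod:
  fixes G :: "nat \<Rightarrow> 'a"
  assumes "\<And>k. G (k + Q) = G k" shows "G (n mod Q) = G n"
proof -
  have "G (m + j * Q) = G m" for m j
    by (induction j) (simp_all add: assms add.assoc[symmetric] add.commute[of Q])
  from this[of "n mod Q" "n div Q"] show ?thesis by simp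
qed

lemma sum_periodic_shift:
  fixes G :: "nat \<Rightarrow> real"
  assumes "\<And>k. G (k + Q) = G k"
  shows "(\<Sum>k<Q. G (k + m)) = (\<Sum>k<Q. G k)"
proof (induction m)
  case (Suc m)
  have "(\<Sum>k<Q. G (k + Suc m)) + G m = (\<Sum>k<Suc Q. G (k + m))"
    by (subst sum.lessThan_Suc_shift) simp
  also have "\<dots> = (\<Sum>k<Q. G (k + m)) + G m" using assms[of m] by (simp add: add.commute)
  finally show ?case using Suc by simp
qed simp

lemma sum_periodic_coprime:
  fixes G :: "nat \<Rightarrow> real"
  assumes "\<And>k. G (k + Q) = G k" "coprime P Q" "0 < Q"
  shows "(\<Sum>i<Q. G (i * P)) = (\<Sum>k<Q. G k)"
proof -
  have inj: "inj_on (\<lambda>i. i * P mod Q) {..<Q}"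
  proof (rule inj_onI)
    fix i j assume ij: "i \<in> {..<Q}" "j \<in> {..<Q}" "i * P mod Q = j * P mod Q"
    then have "[i * P = j * P] (mod Q)" by (simp add: cong_def)
    then have "[i = j] (mod Q)" using assms(2) cong_mult_rcancel_nat by blast
    then show "i = j" using ij by (simp add: cong_def)
  qed
  have "(\<lambda>i. i * P mod Q) ` {..<Q} = {..<Q}"
    using assms(3) inj by (intro card_subset_eq) (auto simp: card_image)
  then have "(\<Sum>k<Q. G k) = (\<Sum>i<Q. G (i * P mod Q))"
    using sum.reindex[OF inj, of G] by (simp add: o_def)
  also have "\<dots> = (\<Sum>i<Q. G (i * P))" using periodic_mod[of G Q] assms(1) by simp
  finally show ?thesis ..
qed

lemma sum_grid:
  fixes G :: "nat \<Rightarrow> real"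
  shows "(\<Sum>k<q * N. G k) = (\<Sum>j<q. \<Sum>l<N. G (j * N + l))"
proof -
  have "(\<Sum>k<q * N. G k) = (\<Sum>j<q. sum G {j * N..<j * N + N})"
    by (simp add: sum.nat_group)
  moreover have "sum G {j * N..<j * N + N} = (\<Sum>l<N. G (j * N + l))" for j
    using sum.shift_bounds_nat_ivl[of G 0 "j * N" N] by (simp add: atLeast0LessThan add.commute)
  ultimately show ?thesis by simp
qed

text \<open>
  If \<open>P/(q N)\<close> is in lowest terms, an orbit of length \<open>q N\<close> runs through all translates of a point
  by multiples of \<open>1/(q N)\<close>. Starting from the translate with the least angle, these points are
  sorted by the cell \<open>j\<close> of length \<open>1/q\<close> and the position \<open>l\<close> in the cell.
\<close>
lemma birkhoff_rot_conj_grid: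
  fixes q N :: nat
  assumes HK: "Cr_homeo r H K" and x: "x \<in> annulus"
    and cop: "coprime P (q * N)" and pos: "0 < q" "0 < N"
  obtains t where "0 \<le> t" "t < 1 / real (q * N)"
    and "\<And>\<phi>. birkhoff (rot_conj H K (real P / real (q * N))) \<phi> (q * N) x =
      (\<Sum>j<q. \<Sum>l<N. \<phi> (H (ann_proj (fst (K x), t + j / q + l / real (q * N))))) / real (q * N)"
proof -
  define Q where "Q = q * N"
  have Q: "Q > 0" using pos by (simp add: Q_def)
  have Kx: "K x \<in> annulus" using Cr_homeoD[OF HK] x by blast
  obtain s t1 where t1: "K x = ann_proj (s, t1)" "0 \<le> t1" "t1 < 1" using ann_proj_surj[OF Kx] by blast
  have s: "s = fst (K x)" using t1(1) by (simp add: ann_proj_def)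
  define m where "m = nat \<lfloor>t1 * Q\<rfloor>"
  define t where "t = t1 - m / Q"
  have m: "real m \<le> t1 * Q" "t1 * Q < real m + 1"
    unfolding m_def using t1(2) by (simp_all add: of_nat_nat)
  have t: "0 \<le> t" "t < 1 / Q"
  proof -
    have "m / Q \<le> t1" "t1 < (m + 1) / Q" using m Q by (simp_all add: pos_divide_le_eq pos_less_divide_eq)
    then show "0 \<le> t" "t < 1 / Q" by (simp_all add: t_def add_divide_distrib)
  qed
  have "birkhoff (rot_conj H K (real P / real Q)) \<phi> Q x =
      (\<Sum>j<q. \<Sum>l<N. \<phi> (H (ann_proj (s, t + j / q + l / Q)))) / Q" for \<phi>
  proof -
    define G where "G = (\<lambda>k::nat. \<phi> (H (ann_proj (s, t + k / Q))))"
    have per: "G (k + Q) = G k" for k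
    proof -
      have "(s, t + real (k + Q) / Q) = shift 1 (s, t + k / Q)"
        using Q by (simp add: shift_def add_divide_distrib)
      then show ?thesis by (simp add: G_def ann_proj_shift_1)
    qed
    have "(\<Sum>i<Q. \<phi> ((rot_conj H K (real P / real Q) ^^ i) x)) = (\<Sum>i<Q. G (i * P + m))"
    proof (rule sum.cong[OF refl])
      fix i
      have "(rot_conj H K (real P / real Q) ^^ i) x = H (ann_proj (s, t1 + i * (P / Q)))"
        unfolding funpow_rot_conj[OF HK x] t1(1) rotation_ann_proj by (simp add: shift_def)
      also have "t1 + i * (P / Q) = t + real (i * P + m) / Q"
        by (simp add: t_def add_divide_distrib)
      finally show "\<phi> ((rot_conj H K (real P / real Q) ^^ i) x) = G (i * P + m)" by (simp add: G_def)
    qed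
    also have "\<dots> = (\<Sum>k<Q. G (k + m))"
    proof (rule sum_periodic_coprime[where G = "\<lambda>k. G (k + m)"])
      show "G (k + Q + m) = G (k + m)" for k
        using per[of "k + m"] by (simp add: algebra_simps)
    qed (use cop Q in \<open>simp_all add: Q_def\<close>)
    also have "\<dots> = (\<Sum>k<Q. G k)" by (rule sum_periodic_shift) (rule per)
    also have "\<dots> = (\<Sum>j<q. \<Sum>l<N. G (j * N + l))" unfolding Q_def by (rule sum_grid)
    also have "\<dots> = (\<Sum>j<q. \<Sum>l<N. \<phi> (H (ann_proj (s, t + j / q + l / Q))))"
      using pos by (intro sum.cong refl) (simp add: G_def Q_def add_divide_distrib add.assoc)
    finally show ?thesis by (simp add: birkhoff_def)
  qed
  then show ?thesis using that[of t] t s by (simp add: Q_def)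
qed

lemma card_le_diameter:
  fixes A :: "nat set"
  assumes "finite A" "0 \<le> c" "\<And>l m. l \<in> A \<Longrightarrow> m \<in> A \<Longrightarrow> l < m \<Longrightarrow> real m - real l \<le> c"
  shows "real (card A) \<le> c + 1"
proof (cases "A = {}")
  case False
  have "A \<subseteq> {Min A..Max A}" using assms(1) by auto
  then have "card A \<le> card {Min A..Max A}" by (intro card_mono) auto
  then have 1: "real (card A) \<le> real (Suc (Max A) - Min A)" by simp
  have "Min A \<le> Max A" using assms(1) False by simp
  then have 2: "real (Suc (Max A) - Min A) = real (Max A) - real (Min A) + 1" by (simp add: of_nat_diff)
  have "real (Max A) - real (Min A) \<le> c"
  proof (cases "Min A < Max A")
    case True
    then show ?thesis using assms(1,3) False by simp
  next
    case False
    then have "Max A \<le> Min A" by simp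
    then show ?thesis using assms(2) by linarith
  qed
  then show ?thesis using 1 2 by linarith
qed (use assms(2) in simp)

text \<open>
  A grid of step \<open>1/N\<close> has at most one point more in an interval than its length predicts. The
  lower bounds needed later come from applying this to the complement.
\<close>
lemma card_grid_interval:
  fixes y a b :: real and N :: nat
  assumes "0 < N" "a \<le> b" "A \<subseteq> {..<N}" "\<And>l. l \<in> A \<Longrightarrow> a \<le> y + l / N \<and> y + l / N \<le> b"
  shows "real (card A) \<le> N * (b - a) + 1"
proof (rule card_le_diameter)
  show "finite A" using assms(3) finite_subset by blast
  show "0 \<le> N * (b - a)" using assms by simp
  fix l m assume "l \<in> A" "m \<in> A" "l < m"
  then have "real m / N - real l / N \<le> b - a" using assms(4)[of l] assms(4)[of m] by linarith
  then have "(real m - real l) / N \<le> b - a" by (simp add: diff_divide_distrib)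
  then show "real m - real l \<le> N * (b - a)" using assms(1) by (simp add: field_simps)
qed

lemma sin_pi_ge:
  assumes "0 \<le> e" "e \<le> z" "z \<le> 1 - e"
  shows "sin (pi * e) \<le> sin (pi * z)"
proof -
  have 1: "sin (pi * e) \<le> sin (pi * w)" if "e \<le> w" "w \<le> 1/2" for w
    using that assms(1) by (intro sin_monotone_2pi_le) (auto simp: field_simps intro: order_trans[of _ 0])
  show ?thesis
  proof (cases "z \<le> 1/2")
    case False
    have "sin (pi * z) = sin (pi * (1 - z))" by (simp add: right_diff_distrib sin_diff)
    then show ?thesis using 1[of "1 - z"] False assms by simp
  qed (use 1 assms in simp)
qed

lemma abs_sin_pi_ge:
  assumes e: "0 < e" and z: "(e \<le> z \<and> z \<le> 1 - e) \<or> (e \<le> - z \<and> - z \<le> 1 - e) \<or> (e \<le> z - 1 \<and> z - 1 \<le> 1 - e)"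
  shows "sin (pi * e) \<le> \<bar>sin (pi * z)\<bar>"
proof -
  have "\<bar>sin (pi * (z - 1))\<bar> = \<bar>sin (pi * z)\<bar>" by (simp add: right_diff_distrib sin_diff)
  moreover have "\<bar>sin (pi * (- z))\<bar> = \<bar>sin (pi * z)\<bar>" by simp
  ultimately show ?thesis
    using z e sin_pi_ge[of e z] sin_pi_ge[of e "- z"] sin_pi_ge[of e "z - 1"] by fastforce
qed

definition twist_at :: "real \<Rightarrow> real \<Rightarrow> real" where
  "twist_at d x = sin (pi * x) * sin (pi * (x - d))"

lemma twist_at_diff: "twist_at d x - twist_at d y = sin (pi * (x + y - d)) * sin (pi * (x - y))"
proof -
  have *: "twist_at d x = (cos (pi * d) - cos (2 * pi * x - pi * d)) / 2" for x
  proof -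
    have "pi * x - pi * (x - d) = pi * d" "pi * x + pi * (x - d) = 2 * pi * x - pi * d"
      by (simp_all add: algebra_simps)
    then show ?thesis unfolding twist_at_def sin_times_sin by (simp only:)
  qed
  have "twist_at d x - twist_at d y = (cos (2 * pi * y - pi * d) - cos (2 * pi * x - pi * d)) / 2"
    unfolding * by (simp add: field_simps)
  also have "\<dots> = sin ((2 * pi * y - pi * d + (2 * pi * x - pi * d)) / 2) *
      sin ((2 * pi * x - pi * d - (2 * pi * y - pi * d)) / 2)"
    by (simp add: cos_diff_cos)
  also have "(2 * pi * y - pi * d + (2 * pi * x - pi * d)) / 2 = pi * (x + y - d)"
    by (simp add: field_simps)
  also have "(2 * pi * x - pi * d - (2 * pi * y - pi * d)) / 2 = pi * (x - y)"
    by (simp add: field_simps)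
  finally show ?thesis .
qed

text \<open>
  The difference of two values is a product of two sines, and on each of the pieces between the
  critical points \<open>d/2\<close>, \<open>d/2 + 1/2\<close> of the twist (modulo \<open>1\<close>) both are at least \<open>sin (\<pi> e)\<close> in
  absolute value, if the two points are at least \<open>e\<close> apart. So the points of a period where the twist
  is almost equal to a given value lie in three short intervals.
\<close>
lemma twist_at_separates:
  assumes e: "0 < e" and xy: "x + e \<le> y"
    and piece: "(x \<ge> d/2 - 1/2 \<and> y \<le> d/2) \<or> (x \<ge> d/2 \<and> y \<le> d/2 + 1/2) \<or> (x \<ge> d/2 + 1/2 \<and> y \<le> d/2 + 1)"
  shows "(sin (pi * e))\<^sup>2 \<le> \<bar>twist_at d x - twist_at d y\<bar>"
proof -
  have 1: "sin (pi * e) \<le> \<bar>sin (pi * (x + y - d))\<bar>"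
    using e by (rule abs_sin_pi_ge) (use piece xy e in linarith)
  have 2: "sin (pi * e) \<le> \<bar>sin (pi * (x - y))\<bar>"
    using e by (rule abs_sin_pi_ge) (use piece xy e in linarith)
  have "0 \<le> sin (pi * e)"
    using e piece xy by (intro sin_ge_zero) auto
  then show ?thesis
    unfolding twist_at_diff abs_mult power2_eq_square using 1 2 by (intro mult_mono) auto
qed

lemma twist_at_good:
  assumes "0 < e" "e \<le> x" "0 \<le> d" "d \<le> 1"
  shows "x \<le> d - e \<Longrightarrow> twist_at d x \<le> - (sin (pi * e))\<^sup>2"
    and "d + e \<le> x \<Longrightarrow> x \<le> 1 - e \<Longrightarrow> (sin (pi * e))\<^sup>2 \<le> twist_at d x"
proof -
  have s0: "0 \<le> sin (pi * e)" if "e \<le> 1" using assms(1) that by (intro sin_ge_zero) auto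
  show "twist_at d x \<le> - (sin (pi * e))\<^sup>2" if "x \<le> d - e"
  proof -
    have 1: "sin (pi * e) \<le> sin (pi * x)" using that assms by (intro sin_pi_ge) auto
    have 2: "sin (pi * e) \<le> sin (pi * (d - x))" using that assms by (intro sin_pi_ge) auto
    have "(sin (pi * e))\<^sup>2 \<le> sin (pi * x) * sin (pi * (d - x))"
      unfolding power2_eq_square using 1 2 s0 that assms by (intro mult_mono) auto
    moreover have "sin (pi * (d - x)) = - sin (pi * (x - d))"
      by (metis minus_diff_eq mult_minus_right sin_minus)
    ultimately show ?thesis by (simp add: twist_at_def)
  qed
  show "(sin (pi * e))\<^sup>2 \<le> twist_at d x" if "d + e \<le> x" "x \<le> 1 - e"
  proof -
    have 1: "sin (pi * e) \<le> sin (pi * x)" using that assms by (intro sin_pi_ge) auto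
    have 2: "sin (pi * e) \<le> sin (pi * (x - d))" using that assms by (intro sin_pi_ge) auto
    show ?thesis unfolding power2_eq_square twist_at_def using 1 2 s0 that assms by (intro mult_mono) auto
  qed
qed

lemma grid_average:
  fixes v :: "nat \<Rightarrow> nat \<Rightarrow> real" and g :: "nat \<Rightarrow> real" and \<omega> :: real and q N :: nat
  assumes "0 < q" "0 < N" "\<And>j. j < q \<Longrightarrow> \<bar>(\<Sum>l<N. v j l) - N * g j\<bar> \<le> N * \<omega>"
  shows "\<bar>(\<Sum>j<q. \<Sum>l<N. v j l) / real (q * N) - (\<Sum>j<q. g j) / q\<bar> \<le> \<omega>"
proof -
  have "\<bar>\<Sum>j<q. (\<Sum>l<N. v j l) - N * g j\<bar> \<le> (\<Sum>j<q. \<bar>(\<Sum>l<N. v j l) - N * g j\<bar>)"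
    by (rule sum_abs)
  also have "\<dots> \<le> (\<Sum>j<q. N * \<omega>)" by (intro sum_mono assms) auto
  also have "\<dots> = real (q * N) * \<omega>" by simp
  finally have b: "\<bar>(\<Sum>j<q. \<Sum>l<N. v j l) - N * (\<Sum>j<q. g j)\<bar> \<le> real (q * N) * \<omega>"
    by (simp add: sum_subtractf sum_distrib_left)
  have "(\<Sum>j<q. \<Sum>l<N. v j l) / real (q * N) - (\<Sum>j<q. g j) / q
      = ((\<Sum>j<q. \<Sum>l<N. v j l) - N * (\<Sum>j<q. g j)) / real (q * N)"
    using assms(1,2) by (simp add: field_simps)
  then have "\<bar>(\<Sum>j<q. \<Sum>l<N. v j l) / real (q * N) - (\<Sum>j<q. g j) / q\<bar>
      = \<bar>(\<Sum>j<q. \<Sum>l<N. v j l) - N * (\<Sum>j<q. g j)\<bar> / real (q * N)"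
    by (simp only: abs_divide abs_of_nat)
  also have "\<dots> \<le> real (q * N) * \<omega> / real (q * N)" using b by (intro divide_right_mono) auto
  also have "\<dots> = \<omega>" using assms(1,2) by simp
  finally show ?thesis .
qed

lemma sum_off_bad:
  fixes v g :: "nat \<Rightarrow> real"
  assumes "B \<subseteq> {..<N}" "\<And>l. l < N \<Longrightarrow> l \<notin> B \<Longrightarrow> \<bar>v l - g l\<bar> \<le> \<omega>"
    "\<And>l. l < N \<Longrightarrow> \<bar>v l - g l\<bar> \<le> 2" "0 \<le> \<omega>" "real (card B) \<le> b"
  shows "\<bar>(\<Sum>l<N. v l) - (\<Sum>l<N. g l)\<bar> \<le> N * \<omega> + 2 * b"
proof -
  have fin: "finite B" using assms(1) finite_subset by blast
  have "\<bar>(\<Sum>l<N. v l) - (\<Sum>l<N. g l)\<bar> \<le> (\<Sum>l<N. \<bar>v l - g l\<bar>)"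
    unfolding sum_subtractf[symmetric] by (rule sum_abs)
  also have "\<dots> \<le> (\<Sum>l<N. \<omega> + (if l \<in> B then 2 else 0))"
    using assms(2,3,4) by (intro sum_mono) (auto simp: add_increasing)
  also have "\<dots> = N * \<omega> + 2 * card B"
    using assms(1) fin by (simp add: sum.distrib sum.If_cases Int_absorb1 Int_absorb2)
  also have "\<dots> \<le> N * \<omega> + 2 * b" using assms(5) by simp
  finally show ?thesis .
qed

text \<open>
  A sequence that is close to \<open>g0\<close> at the grid points below \<open>d\<close> and to \<open>g1\<close> above \<open>d\<close>, except within
  \<open>e\<close> of \<open>0\<close>, \<open>d\<close> and \<open>1\<close>, has nearly the mean value \<open>d g0 + (1 - d) g1\<close>. The term \<open>8/N\<close> collects the
  rounding errors of the counts.
\<close>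
lemma two_level_sum:
  fixes v :: "nat \<Rightarrow> real" and x0 d e \<omega> g0 g1 :: real and N :: nat
  assumes N: "0 < N" and x0: "0 \<le> x0" "x0 < 1 / N" and d: "0 \<le> d" "d \<le> 1" and e: "0 < e"
    and \<omega>: "0 \<le> \<omega>" and b: "\<And>l. l < N \<Longrightarrow> \<bar>v l\<bar> \<le> 1" "\<bar>g0\<bar> \<le> 1" "\<bar>g1\<bar> \<le> 1"
    and low: "\<And>l. l < N \<Longrightarrow> e \<le> x0 + l / N \<Longrightarrow> x0 + l / N \<le> d - e \<Longrightarrow> \<bar>v l - g0\<bar> \<le> \<omega>"
    and high: "\<And>l. l < N \<Longrightarrow> d + e \<le> x0 + l / N \<Longrightarrow> x0 + l / N \<le> 1 - e \<Longrightarrow> \<bar>v l - g1\<bar> \<le> \<omega>"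
  shows "\<bar>(\<Sum>l<N. v l) - N * (d * g0 + (1 - d) * g1)\<bar> \<le> N * (\<omega> + 8 * e + 8 / N)"
proof -
  let ?x = "\<lambda>l::nat. x0 + l / N"
  have x: "0 \<le> ?x l" "?x l \<le> 1" if "l < N" for l
  proof -
    show "0 \<le> ?x l" using x0 by simp
    have "real l + 1 \<le> N" using that by linarith
    then have "(real l + 1) / N \<le> 1" using N by simp
    then show "?x l \<le> 1" using x0(2) by (simp add: add_divide_distrib)
  qed
  define B1 B2 B3 where "B1 = {l\<in>{..<N}. ?x l \<le> e}" and "B2 = {l\<in>{..<N}. d - e \<le> ?x l \<and> ?x l \<le> d + e}"
    and "B3 = {l\<in>{..<N}. 1 - e \<le> ?x l}"
  have c1: "card B1 \<le> N * (e - 0) + 1"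
    using e N by (intro card_grid_interval[where y = x0]) (auto simp: B1_def x)
  have c2: "card B2 \<le> N * (d + e - (d - e)) + 1"
    using e N by (intro card_grid_interval[where y = x0]) (auto simp: B2_def)
  have c3: "card B3 \<le> N * (1 - (1 - e)) + 1"
    using e N by (intro card_grid_interval[where y = x0]) (auto simp: B3_def x)
  let ?B = "B1 \<union> B2 \<union> B3"
  have "card ?B \<le> card B1 + card B2 + card B3"
    using card_Un_le[of "B1 \<union> B2" B3] card_Un_le[of B1 B2] by linarith
  then have cB: "real (card ?B) \<le> 4 * (N * e) + 3" using c1 c2 c3 by (simp add: algebra_simps)
  let ?g = "\<lambda>l. if ?x l < d then g0 else g1"
  have "\<bar>(\<Sum>l<N. v l) - (\<Sum>l<N. ?g l)\<bar> \<le> N * \<omega> + 2 * (4 * (N * e) + 3)"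
  proof (rule sum_off_bad[where B = ?B])
    show "?B \<subseteq> {..<N}" by (auto simp: B1_def B2_def B3_def)
    show "\<bar>v l - ?g l\<bar> \<le> 2" if "l < N" for l using b(1)[OF that] b(2,3) by (auto split: if_splits)
    fix l assume l: "l < N" "l \<notin> ?B"
    then have "\<not> ?x l \<le> e" "\<not> (d - e \<le> ?x l \<and> ?x l \<le> d + e)" "\<not> 1 - e \<le> ?x l"
      by (auto simp: B1_def B2_def B3_def)
    then show "\<bar>v l - ?g l\<bar> \<le> \<omega>"
      using low[OF l(1)] high[OF l(1)] e by (cases "?x l < d") auto
  qed (use \<omega> cB in auto)
  moreover have "\<bar>(\<Sum>l<N. ?g l) - N * (d * g0 + (1 - d) * g1)\<bar> \<le> 2"
  proof -
    define A0 A1 where "A0 = {l\<in>{..<N}. ?x l < d}" and "A1 = {l\<in>{..<N}. \<not> ?x l < d}"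
    have a0: "card A0 \<le> N * (d - 0) + 1"
      using d N by (intro card_grid_interval[where y = x0]) (auto simp: A0_def x)
    have a1: "card A1 \<le> N * (1 - d) + 1"
      using d N by (intro card_grid_interval[where y = x0]) (auto simp: A1_def x)
    have "A0 \<union> A1 = {..<N}" "A0 \<inter> A1 = {}" "finite A0" "finite A1" by (auto simp: A0_def A1_def)
    then have s: "real (card A0) + real (card A1) = N"
      using card_Un_disjoint[of A0 A1] by (metis card_lessThan of_nat_add)
    have "(\<Sum>l<N. ?g l) = (\<Sum>l\<in>A0. g0) + (\<Sum>l\<in>A1. g1)"
    proof -
      have "{..<N} \<inter> {l. ?x l < d} = A0" "{..<N} \<inter> - {l. ?x l < d} = A1"
        by (auto simp: A0_def A1_def)
      then show ?thesis by (subst sum.If_cases) simp_all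
    qed
    then have "(\<Sum>l<N. ?g l) - N * (d * g0 + (1 - d) * g1) = (card A0 - N * d) * (g0 - g1)"
    proof -
      have A1: "real (card A1) = N - real (card A0)" using s by linarith
      show ?thesis unfolding \<open>sum ?g {..<N} = _\<close> sum_constant A1 by (simp add: algebra_simps)
    qed
    moreover have "\<bar>card A0 - N * d\<bar> \<le> 1" using a0 a1 s by (simp add: algebra_simps abs_le_iff)
    moreover have "\<bar>g0 - g1\<bar> \<le> 2" using b(2,3) by linarith
    ultimately show ?thesis
      using mult_mono[of "\<bar>card A0 - N * d\<bar>" 1 "\<bar>g0 - g1\<bar>" 2] by (simp add: abs_mult)
  qed
  moreover have "\<bar>u - w\<bar> \<le> p + r" if "\<bar>u - u'\<bar> \<le> p" "\<bar>u' - w\<bar> \<le> r" for u u' w p r :: real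
    using that by linarith
  ultimately have "\<bar>(\<Sum>l<N. v l) - N * (d * g0 + (1 - d) * g1)\<bar> \<le> (N * \<omega> + 2 * (4 * (N * e) + 3)) + 2"
    by blast
  also have "\<dots> = N * (\<omega> + 8 * e + 8 / N)" using N by (simp add: algebra_simps)
  finally show ?thesis .
qed

lemma three_piece_count:
  fixes N :: nat and x0 d e :: real
  assumes N: "0 < N" and x0: "0 \<le> x0" "x0 < 1 / N" and d: "0 \<le> d" "d \<le> 1" and e: "0 < e"
    and A: "A \<subseteq> {..<N}"
    and close: "\<And>l m. l \<in> A \<Longrightarrow> m \<in> A \<Longrightarrow> \<bar>twist_at d (x0 + l / N) - twist_at d (x0 + m / N)\<bar> < (sin (pi * e))\<^sup>2"
  shows "real (card A) \<le> 3 * (N * e + 1)"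
proof -
  let ?x = "\<lambda>l::nat. x0 + l / N"
  have x: "0 \<le> ?x l" "?x l \<le> 1" if "l < N" for l
  proof -
    show "0 \<le> ?x l" using x0 by simp
    have "real l + 1 \<le> N" using that by linarith
    then have "(real l + 1) / N \<le> 1" using N by simp
    then show "?x l \<le> 1" using x0(2) by (simp add: add_divide_distrib)
  qed
  have fin: "finite A" using A finite_subset by blast
  have piece: "real (card (A \<inter> {l. a \<le> ?x l \<and> ?x l \<le> b})) \<le> N * e + 1"
    if "(a \<ge> d/2 - 1/2 \<and> b \<le> d/2) \<or> (a \<ge> d/2 \<and> b \<le> d/2 + 1/2) \<or> (a \<ge> d/2 + 1/2 \<and> b \<le> d/2 + 1)" for a b
  proof (rule card_le_diameter)
    show "finite (A \<inter> {l. a \<le> ?x l \<and> ?x l \<le> b})" using fin by simp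
    show "0 \<le> N * e" using e by simp
    fix l m assume lm: "l \<in> A \<inter> {l. a \<le> ?x l \<and> ?x l \<le> b}" "m \<in> A \<inter> {l. a \<le> ?x l \<and> ?x l \<le> b}" "l < m"
    have "\<not> ?x l + e \<le> ?x m"
    proof
      assume "?x l + e \<le> ?x m"
      moreover have "a \<le> ?x l" "?x m \<le> b" using lm by auto
      then have "(?x l \<ge> d/2 - 1/2 \<and> ?x m \<le> d/2) \<or> (?x l \<ge> d/2 \<and> ?x m \<le> d/2 + 1/2)
          \<or> (?x l \<ge> d/2 + 1/2 \<and> ?x m \<le> d/2 + 1)"
        using that by linarith
      ultimately have "(sin (pi * e))\<^sup>2 \<le> \<bar>twist_at d (?x l) - twist_at d (?x m)\<bar>"
        by (intro twist_at_separates[OF e])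
      then show False using close[of l m] lm by auto
    qed
    then have "(real m - real l) / N < e" by (simp add: diff_divide_distrib)
    then show "real m - real l \<le> N * e" using N by (simp add: field_simps)
  qed
  let ?P = "\<lambda>a b. A \<inter> {l. a \<le> ?x l \<and> ?x l \<le> b}"
  have "A \<subseteq> ?P (d/2 - 1/2) (d/2) \<union> ?P (d/2) (d/2 + 1/2) \<union> ?P (d/2 + 1/2) (d/2 + 1)"
  proof
    fix l assume l: "l \<in> A"
    then have "0 \<le> ?x l" "?x l \<le> 1" using x A by auto
    then show "l \<in> ?P (d/2 - 1/2) (d/2) \<union> ?P (d/2) (d/2 + 1/2) \<union> ?P (d/2 + 1/2) (d/2 + 1)"
      using l d by auto
  qed
  then have "card A \<le> card (?P (d/2 - 1/2) (d/2) \<union> ?P (d/2) (d/2 + 1/2) \<union> ?P (d/2 + 1/2) (d/2 + 1))"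
    using fin by (intro card_mono) auto
  also have "\<dots> \<le> card (?P (d/2 - 1/2) (d/2)) + card (?P (d/2) (d/2 + 1/2)) + card (?P (d/2 + 1/2) (d/2 + 1))"
    using card_Un_le by (meson add_le_mono1 order_trans)
  finally show ?thesis
    using piece[of "d/2 - 1/2" "d/2"] piece[of "d/2" "d/2 + 1/2"] piece[of "d/2 + 1/2" "d/2 + 1"] by auto
qed

section \<open>Birkhoff averages of the perturbed maps\<close>

lemma norm_cis_diff: "norm (cis x - cis y) \<le> \<bar>x - y\<bar>"
proof -
  have "cis x - cis y = cis y * (cis (x - y) - 1)" by (simp add: right_diff_distrib cis_mult)
  then have "norm (cis x - cis y) = norm (exp (\<i> * of_real (x - y)) - 1)"
    by (simp add: norm_mult cis_conv_exp)
  also have "\<dots> = 2 * \<bar>sin ((x - y) / 2)\<bar>" by (rule dist_exp_i_1)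
  also have "\<dots> \<le> 2 * \<bar>(x - y) / 2\<bar>" by (intro mult_left_mono abs_sin_x_le_abs_x) auto
  finally show ?thesis by simp
qed

lemma dist_pt_le: "dist ((a::real), cis u) (b, cis v) \<le> \<bar>a - b\<bar> + \<bar>u - v\<bar>"
proof -
  have "dist (a, cis u) (b, cis v) \<le> dist a b + dist (cis u) (cis v)"
    unfolding dist_Pair_Pair by (rule order_trans[OF sqrt_sum_squares_le_sum_abs]) simp
  also have "\<dots> \<le> \<bar>a - b\<bar> + \<bar>u - v\<bar>"
    using norm_cis_diff[of u v] by (simp add: dist_norm)
  finally show ?thesis .
qed

text \<open>
  A test function that vanishes exactly on the boundary.
\<close>
definition chi :: "pt \<Rightarrow> real" where
  "chi x = fst x * (1 - fst x)"

lemma chi_bounds: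
  assumes "x \<in> annulus" shows "0 \<le> chi x" "chi x \<le> 1"
proof -
  have s: "0 \<le> fst x" "fst x \<le> 1" using assms by (cases x; auto simp: annulus_iff)+
  show "0 \<le> chi x" using s by (simp add: chi_def)
  have "fst x * (1 - fst x) \<le> 1 * 1" using s by (intro mult_mono) auto
  then show "chi x \<le> 1" by (simp add: chi_def)
qed

definition modulus :: "(pt \<Rightarrow> pt) \<Rightarrow> real \<Rightarrow> real \<Rightarrow> (pt \<Rightarrow> real) \<Rightarrow> bool" where
  "modulus h \<delta> \<omega> \<phi> \<longleftrightarrow>
     (\<forall>x\<in>annulus. \<forall>y\<in>annulus. dist x y < \<delta> \<longrightarrow> \<bar>\<phi> (h x) - \<phi> (h y)\<bar> \<le> \<omega>)"

text \<open>
  A Riemann sum for the mean of \<open>\<phi> \<circ> h\<close> over the circle of height \<open>s\<close>, with one node for each cell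
  of length \<open>1/q\<close>.
\<close>
definition circle_average :: "(pt \<Rightarrow> pt) \<Rightarrow> nat \<Rightarrow> (pt \<Rightarrow> real) \<Rightarrow> real \<Rightarrow> real" where
  "circle_average h q \<phi> s = (\<Sum>j<q. \<phi> (h (s, cis (2 * pi * (real j / q))))) / q"

text \<open>
  The quantities are chosen in the order \<open>e\<close>, \<open>\<delta>\<^sub>0\<close>, \<open>\<delta>\<close>, \<open>V\<close>, \<open>K\<close>, \<open>a\<close>, \<open>q\<close>, \<open>\<beta>\<close>, \<open>N\<close>. Within \<open>\<delta>\<^sub>0\<close> the test functions
  composed with \<open>h\<close> are almost constant; \<open>\<delta>\<close> is the width of the two boundary collars; \<open>lshift\<close> by at
  least \<open>V\<close> in either direction carries every height outside the collars into one of them; and \<open>K\<close>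
  times the twist is at least \<open>V + 1\<close> in absolute value away from the zeros of the twist.
\<close>
locale perturbed = twisting q d K a \<beta> for q :: nat and d K a \<beta> :: real +
  fixes r :: enat and h k :: "pt \<Rightarrow> pt" and N P :: nat and \<delta>\<^sub>0 \<delta> V e :: real
  assumes hk: "Cr_homeo r h k" and N: "0 < N" and cop: "coprime P (q * N)"
    and \<beta>: "0 \<le> \<beta>" "\<beta> \<le> 1 / q" and d: "0 \<le> d" "d \<le> 1"
    and \<delta>: "0 < \<delta>" "\<delta> + 8 * pi / q < \<delta>\<^sub>0"
    and V: "1 / \<delta>\<^sup>2 < exp V"
    and e: "0 < e" and K: "0 < K" "V + 1 \<le> K * (sin (pi * e))\<^sup>2"
begin

abbreviation "\<psi> \<equiv> psi q d K a \<beta>"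
abbreviation "\<psi>' \<equiv> psi_inv q d K a \<beta>"

definition g :: "pt \<Rightarrow> pt" where
  "g = rot_conj (h \<circ> \<psi>) (\<psi>' \<circ> k) (real P / real (q * N))"

lemma Cr_homeo_H: "Cr_homeo r (h \<circ> \<psi>) (\<psi>' \<circ> k)"
  by (rule Cr_homeo_compose[OF hk Cr_homeo_psi])

text \<open>
  The image of a grid point of the cell \<open>j\<close> has an angle within \<open>4/q\<close> of \<open>j/q\<close>. If its height is also
  within \<open>\<delta>\<close> of \<open>u\<close>, then the test functions cannot distinguish it from the point of height \<open>u\<close> and
  angle \<open>j/q\<close>.
\<close>
lemma grid_point:
  fixes t s u :: real and j l :: nat
  assumes "0 \<le> t" "t < 1 / real (q * N)" "j < q" "l < N" "0 \<le> s" "s \<le> 1"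
  defines "y \<equiv> ann_proj (s, t + j / q + l / real (q * N))"
  shows "\<psi> y \<in> annulus"
    and "fst (\<psi> y) = lshift s (K * twist_at d (q * t + l / N))"
    and "\<bar>fst (\<psi> y) - u\<bar> \<le> \<delta> \<Longrightarrow> dist (\<psi> y) (u, cis (2 * pi * (j / q))) < \<delta>\<^sub>0"
proof -
  let ?\<tau> = "t + j / q + l / real (q * N)"
  have y: "y = (s, cis (2 * pi * ?\<tau>))" by (simp add: y_def ann_proj_def)
  show "\<psi> y \<in> annulus" using psi_inv_psi(2)[of y] assms(5,6) by (simp add: y annulus_iff)
  have qt: "q * ?\<tau> = q * t + l / N + j" using q N by (simp add: field_simps)
  have "cis (2 * pi * ?\<tau>) ^ q = cis (2 * pi * (q * ?\<tau>))"
    by (simp add: Complex.DeMoivre mult.left_commute mult.assoc)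
  also have "\<dots> = cis (2 * pi * (q * t + l / N)) * cis (2 * pi * j)"
    unfolding qt cis_mult by (simp only: distrib_left)
  also have "cis (2 * pi * j) = 1" by (rule cis_multiple_2pi) simp
  finally have w: "cis (2 * pi * ?\<tau>) ^ q = cis (2 * pi * (q * t + l / N))" by simp
  define \<mu> where "\<mu> = moebius_shift (- a) (cis (2 * pi * ?\<tau>) ^ q)"
  have \<mu>: "\<bar>\<mu>\<bar> \<le> 1 / 2" unfolding \<mu>_def by (rule moebius_shift_bound)
  have \<psi>y: "\<psi> y = (lshift s (K * twist_at d (q * t + l / N)), cis (2 * pi * (?\<tau> + \<beta> - \<mu> / q)))"
    unfolding y psi_def prod.case \<mu>_def[symmetric]
    unfolding w twist_cis twist_at_def[symmetric] by (simp add: cis_mult algebra_simps)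
  then show "fst (\<psi> y) = lshift s (K * twist_at d (q * t + l / N))" by simp
  have b1: "l / real (q * N) \<le> 1 / q" "0 \<le> l / real (q * N)" using assms(4) q N by (auto simp: field_simps)
  have "1 / real (q * N) \<le> 1 / q" using q N by (intro frac_le) auto
  then have b2: "t \<le> 1 / q" using assms(2) by linarith
  have b3: "\<bar>\<mu> / q\<bar> \<le> 1 / q" using \<mu> q by (simp add: abs_divide divide_right_mono)
  have "\<bar>(?\<tau> + \<beta> - \<mu> / q) - j / q\<bar> \<le> 1 / q + 1 / q + 1 / q + 1 / q"
    using b1 b2 b3 assms(1) \<beta> unfolding abs_le_iff by linarith
  then have b4: "2 * pi * \<bar>(?\<tau> + \<beta> - \<mu> / q) - j / q\<bar> \<le> 2 * pi * (4 / q)"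
    by (intro mult_left_mono) auto
  have c: "2 * pi * (4 / real q) = 8 * pi / q" by simp
  have ab: "\<bar>2 * pi * u - 2 * pi * v\<bar> = 2 * pi * \<bar>u - v\<bar>" for u v :: real
    by (simp only: right_diff_distrib[symmetric] abs_mult) simp
  have "\<bar>2 * pi * (?\<tau> + \<beta> - \<mu> / q) - 2 * pi * (j / q)\<bar> \<le> 8 * pi / q"
    unfolding ab using b4 unfolding c .
  moreover assume "\<bar>fst (\<psi> y) - u\<bar> \<le> \<delta>"
  ultimately show "dist (\<psi> y) (u, cis (2 * pi * (j / q))) < \<delta>\<^sub>0"
    using dist_pt_le[of "fst (\<psi> y)" "2 * pi * (?\<tau> + \<beta> - \<mu> / q)" u "2 * pi * (j / q)"] \<delta>(2)
    by (simp add: \<psi>y)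
qed

lemma grid:
  assumes x: "x \<in> annulus"
  obtains t where "0 \<le> t" "t < 1 / real (q * N)"
    and "\<And>\<phi>. birkhoff g \<phi> (q * N) x = (\<Sum>j<q. \<Sum>l<N.
      \<phi> (h (\<psi> (ann_proj (fst (\<psi>' (k x)), t + j / q + l / real (q * N)))))) / real (q * N)"
  using birkhoff_rot_conj_grid[OF Cr_homeo_H x cop q N] unfolding g_def by auto

lemma x0_bound:
  fixes t :: real
  assumes "0 \<le> t" "t < 1 / real (q * N)"
  shows "0 \<le> q * t \<and> q * t < 1 / N"
  using assms q N by (simp add: field_simps)

lemma k_in: "x \<in> annulus \<Longrightarrow> k x \<in> annulus" "x \<in> annulus \<Longrightarrow> h x \<in> annulus"
  using Cr_homeoD[OF hk] by blast+

lemma fst_bounds: "x \<in> annulus \<Longrightarrow> 0 \<le> fst x \<and> fst x \<le> 1"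
  by (cases x) (auto simp: annulus_iff)

lemma circle_in: "0 \<le> u \<Longrightarrow> u \<le> 1 \<Longrightarrow> (u, cis v) \<in> annulus"
  by (simp add: annulus_iff)

lemma birkhoff_boundary:
  assumes \<phi>: "modulus h \<delta>\<^sub>0 \<omega> \<phi>" and x: "x \<in> annulus" "fst x = 0 \<or> fst x = 1"
  shows "\<bar>birkhoff g \<phi> (q * N) x - circle_average h q \<phi> (fst (k x))\<bar> \<le> \<omega>"
proof -
  obtain t where t: "0 \<le> t" "t < 1 / real (q * N)"
    and B: "birkhoff g \<phi> (q * N) x = (\<Sum>j<q. \<Sum>l<N.
      \<phi> (h (\<psi> (ann_proj (fst (\<psi>' (k x)), t + j / q + l / real (q * N)))))) / real (q * N)"
    using grid[OF x(1)] by metis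
  have s: "fst (k x) = 0 \<or> fst (k x) = 1" by (rule Cr_homeo_boundary[OF Cr_homeo_sym[OF hk] x])
  then have s': "fst (\<psi>' (k x)) = fst (k x)" by (rule fst_psi_inv_boundary)
  have s01: "0 \<le> fst (k x)" "fst (k x) \<le> 1" using s by auto
  show ?thesis unfolding B s' circle_average_def
  proof (rule grid_average[OF q N])
    fix j assume j: "j < q"
    have "\<bar>(\<Sum>l<N. \<phi> (h (\<psi> (ann_proj (fst (k x), t + j / q + l / real (q * N)))))) -
        (\<Sum>l<N. \<phi> (h (fst (k x), cis (2 * pi * (j / q)))))\<bar> \<le> (\<Sum>l<N. \<omega>)"
      unfolding sum_subtractf[symmetric]
    proof (rule order_trans[OF sum_abs sum_mono])
      fix l assume "l \<in> {..<N}"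
      then have l: "l < N" by simp
      note G = grid_point[OF t j l s01]
      have "fst (\<psi> (ann_proj (fst (k x), t + j / q + l / real (q * N)))) = fst (k x)"
        unfolding G(2) using s by auto
      then have "dist (\<psi> (ann_proj (fst (k x), t + j / q + l / real (q * N)))) (fst (k x), cis (2 * pi * (j / q))) < \<delta>\<^sub>0"
        using \<delta>(1) by (intro G(3)) simp
      then show "\<bar>\<phi> (h (\<psi> (ann_proj (fst (k x), t + j / q + l / real (q * N))))) -
          \<phi> (h (fst (k x), cis (2 * pi * (j / q))))\<bar> \<le> \<omega>"
        using \<phi> G(1) circle_in[OF s01] unfolding modulus_def by blast
    qed
    then show "\<bar>(\<Sum>l<N. \<phi> (h (\<psi> (ann_proj (fst (k x), t + j / q + l / real (q * N)))))) -
        N * \<phi> (h (fst (k x), cis (2 * pi * (j / q))))\<bar> \<le> N * \<omega>" by simp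
  qed
qed

text \<open>
  Two grid points of the same circle that are both mapped outside the collars have twists differing
  by less than \<open>V / K\<close>, because otherwise the relative translation would carry one of them into a
  collar. Such points are rare by \<open>three_piece_count\<close>.
\<close>
lemma birkhoff_interior:
  assumes \<phi>: "modulus h \<delta>\<^sub>0 \<omega> chi" and x: "x \<in> annulus" and \<omega>: "0 \<le> \<omega>"
  shows "birkhoff g chi (q * N) x \<le> \<omega> + 6 * e + 6 / N"
proof -
  obtain t where t: "0 \<le> t" "t < 1 / real (q * N)"
    and B: "birkhoff g chi (q * N) x = (\<Sum>j<q. \<Sum>l<N.
      chi (h (\<psi> (ann_proj (fst (\<psi>' (k x)), t + j / q + l / real (q * N)))))) / real (q * N)"
    using grid[OF x(1)] by metis
  define s where "s = fst (\<psi>' (k x))"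
  have s01: "0 \<le> s" "s \<le> 1"
    using fst_bounds[OF psi_psi_inv(2)[OF k_in(1)[OF x]]] by (auto simp: s_def)
  let ?S = "\<lambda>l. lshift s (K * twist_at d (q * t + l / N))"
  define A where "A = {l\<in>{..<N}. \<delta> < ?S l \<and> ?S l < 1 - \<delta>}"
  have cA: "real (card A) \<le> 3 * (N * e + 1)"
  proof (rule three_piece_count[OF N _ _ d e])
    show "0 \<le> q * t" "q * t < 1 / N" using x0_bound[OF t] by auto
    show "A \<subseteq> {..<N}" by (auto simp: A_def)
    fix l m assume lm: "l \<in> A" "m \<in> A"
    let ?v = "K * (twist_at d (q * t + l / N) - twist_at d (q * t + m / N))"
    have "?S l = lshift (?S m) ?v" using s01 by (simp add: lshift_add algebra_simps)
    then have "\<not> V \<le> ?v" "\<not> ?v \<le> - V"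
      using lshift_extreme[OF \<delta>(1) _ _ V, of "?S m" ?v] lm by (auto simp: A_def)
    then have "\<bar>?v\<bar> < V" by linarith
    then have "K * \<bar>twist_at d (q * t + l / N) - twist_at d (q * t + m / N)\<bar> < K * (sin (pi * e))\<^sup>2"
    proof -
      have "\<bar>?v\<bar> = K * \<bar>twist_at d (q * t + l / N) - twist_at d (q * t + m / N)\<bar>"
        using K(1) by (simp only: abs_mult abs_of_pos)
      then show ?thesis using \<open>\<bar>?v\<bar> < V\<close> K(2) by linarith
    qed
    then show "\<bar>twist_at d (q * t + l / N) - twist_at d (q * t + m / N)\<bar> < (sin (pi * e))\<^sup>2"
      by (simp only: mult_less_cancel_left_pos[OF K(1)])
  qed
  have "\<bar>(\<Sum>j<q. \<Sum>l<N. chi (h (\<psi> (ann_proj (s, t + j / q + l / real (q * N)))))) / real (q * N)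
      - (\<Sum>j<q. 0) / q\<bar> \<le> \<omega> + 6 * e + 6 / N"
  proof (rule grid_average[OF q N])
    fix j assume j: "j < q"
    define v where "v = (\<lambda>l::nat. chi (h (\<psi> (ann_proj (s, t + j / q + l / real (q * N))))))"
    have sub: "A \<subseteq> {..<N}" by (auto simp: A_def)
    have two: "\<bar>v l - 0\<bar> \<le> 2" if l: "l < N" for l
    proof -
      note G = grid_point[OF t j l s01]
      show ?thesis using chi_bounds[OF k_in(2)[OF G(1)]] by (simp add: v_def)
    qed
    have off: "\<bar>v l - 0\<bar> \<le> \<omega>" if l: "l < N" and "l \<notin> A" for l
    proof -
      note G = grid_point[OF t j l s01]
      from \<open>l \<notin> A\<close> have "?S l \<le> \<delta> \<or> 1 - \<delta> \<le> ?S l" using l by (auto simp: A_def)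
      \<comment> \<open>The image is in a collar, hence close to a boundary circle, on which \<open>chi \<circ> h\<close> vanishes.\<close>
      then obtain u where u: "u = 0 \<or> u = 1" "\<bar>?S l - u\<bar> \<le> \<delta>"
        using lshift_bounds[OF s01, of "K * twist_at d (q * t + l / N)"] by (metis abs_of_nonneg abs_minus_commute
            diff_0_right diff_ge_0_iff_ge diff_le_eq add.commute)
      then have dd: "dist (\<psi> (ann_proj (s, t + j / q + l / real (q * N)))) (u, cis (2 * pi * (j / q))) < \<delta>\<^sub>0"
        by (intro G(3)) (simp only: G(2))
      have ua: "(u, cis (2 * pi * (j / q))) \<in> annulus" using u(1) by (intro circle_in) auto
      have "fst (h (u, cis (2 * pi * (j / q)))) = 0 \<or> fst (h (u, cis (2 * pi * (j / q)))) = 1"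
        using u(1) by (intro Cr_homeo_boundary[OF hk ua]) simp
      then have "chi (h (u, cis (2 * pi * (j / q)))) = 0" by (auto simp: chi_def)
      moreover have "\<bar>v l - chi (h (u, cis (2 * pi * (j / q))))\<bar> \<le> \<omega>"
        using \<phi> G(1) ua dd unfolding modulus_def v_def by blast
      ultimately show ?thesis by simp
    qed
    have "\<bar>(\<Sum>l<N. v l) - (\<Sum>l<N. 0)\<bar> \<le> N * \<omega> + 2 * (3 * (N * e + 1))"
      by (rule sum_off_bad[OF sub off two \<omega> cA])
    also have "\<dots> = N * (\<omega> + 6 * e + 6 / N)" using N by (simp add: algebra_simps)
    finally show "\<bar>(\<Sum>l<N. chi (h (\<psi> (ann_proj (s, t + j / q + l / real (q * N)))))) - N * (0::real)\<bar>
        \<le> N * (\<omega> + 6 * e + 6 / N)" by (simp add: v_def)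
  qed
  from abs_le_D1[OF this] show ?thesis unfolding B s_def[symmetric] by simp
qed

text \<open>
  The point lies outside the collars, and by the assumption on the twist at its preimage it was
  translated by at most \<open>1\<close>. Therefore the sign of the twist at the other points of its circle
  decides into which collar they go.
\<close>
lemma birkhoff_typical:
  assumes \<phi>: "modulus h \<delta>\<^sub>0 \<omega> \<phi>" "\<And>x. x \<in> annulus \<Longrightarrow> \<bar>\<phi> x\<bar> \<le> 1" and x: "x \<in> annulus" and \<omega>: "0 \<le> \<omega>"
    and y: "\<delta> \<le> fst (k x)" "fst (k x) \<le> 1 - \<delta>"
    and \<kappa>: "\<bar>K * twist d (snd (\<psi>' (k x)) ^ q)\<bar> \<le> 1"
  shows "\<bar>birkhoff g \<phi> (q * N) x - (d * circle_average h q \<phi> 0 + (1 - d) * circle_average h q \<phi> 1)\<bar>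
    \<le> \<omega> + 8 * e + 8 / N"
proof -
  obtain t where t: "0 \<le> t" "t < 1 / real (q * N)"
    and B: "birkhoff g \<phi> (q * N) x = (\<Sum>j<q. \<Sum>l<N.
      \<phi> (h (\<psi> (ann_proj (fst (\<psi>' (k x)), t + j / q + l / real (q * N)))))) / real (q * N)"
    using grid[OF x(1)] by metis
  define s where "s = fst (\<psi>' (k x))"
  define \<kappa>' where "\<kappa>' = K * twist d (snd (\<psi>' (k x)) ^ q)"
  have s01: "0 \<le> s" "s \<le> 1"
    using fst_bounds[OF psi_psi_inv(2)[OF k_in(1)[OF x]]] by (auto simp: s_def)
  have s: "s = lshift (fst (k x)) (- \<kappa>')"
    by (simp add: s_def \<kappa>'_def psi_inv_def Let_def case_prod_unfold)
  have sh: "lshift s v = lshift (fst (k x)) (v - \<kappa>')" for v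
    unfolding s using y \<delta>(1) by (subst lshift_add) auto
  let ?g = "\<lambda>u j. \<phi> (h (u, cis (2 * pi * (real j / q))))"
  have "\<bar>(\<Sum>j<q. \<Sum>l<N. \<phi> (h (\<psi> (ann_proj (s, t + j / q + l / real (q * N)))))) / real (q * N)
      - (\<Sum>j<q. d * ?g 0 j + (1 - d) * ?g 1 j) / q\<bar> \<le> \<omega> + 8 * e + 8 / N"
  proof (rule grid_average[OF q N])
    fix j assume j: "j < q"
    show "\<bar>(\<Sum>l<N. \<phi> (h (\<psi> (ann_proj (s, t + j / q + l / real (q * N)))))) -
        N * (d * ?g 0 j + (1 - d) * ?g 1 j)\<bar> \<le> N * (\<omega> + 8 * e + 8 / N)"
    proof (rule two_level_sum[OF N _ _ d e \<omega>])
      show "0 \<le> q * t" "q * t < 1 / N" using x0_bound[OF t] by auto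
      show "\<bar>?g 0 j\<bar> \<le> 1" "\<bar>?g 1 j\<bar> \<le> 1" by (intro \<phi>(2) k_in(2) circle_in; simp)+
      fix l assume l: "l < N"
      note G = grid_point[OF t j l s01]
      show "\<bar>\<phi> (h (\<psi> (ann_proj (s, t + j / q + l / real (q * N)))))\<bar> \<le> 1"
        by (intro \<phi>(2) k_in(2) G(1))
      have near: "\<bar>\<phi> (h (\<psi> (ann_proj (s, t + j / q + l / real (q * N))))) - ?g u j\<bar> \<le> \<omega>"
        if "u = 0 \<or> u = 1" "\<bar>lshift s (K * twist_at d (q * t + l / N)) - u\<bar> \<le> \<delta>" for u
      proof -
        have dd: "dist (\<psi> (ann_proj (s, t + j / q + l / real (q * N)))) (u, cis (2 * pi * (j / q))) < \<delta>\<^sub>0"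
          using that(2) by (intro G(3)) (simp only: G(2))
        have ua: "(u, cis (2 * pi * (j / q))) \<in> annulus" using that(1) by (intro circle_in) auto
        show ?thesis using \<phi>(1) G(1) ua dd unfolding modulus_def by blast
      qed
      have L: "0 \<le> lshift s (K * twist_at d (q * t + l / N))" "lshift s (K * twist_at d (q * t + l / N)) \<le> 1"
        using lshift_bounds[OF s01] by auto
      have \<kappa>1: "\<kappa>' \<le> 1" "- 1 \<le> \<kappa>'" using \<kappa> unfolding \<kappa>'_def[symmetric] by auto
      show "\<bar>\<phi> (h (\<psi> (ann_proj (s, t + j / q + l / real (q * N))))) - ?g 0 j\<bar> \<le> \<omega>"
        if "e \<le> q * t + l / N" "q * t + l / N \<le> d - e"
      proof -
        have "K * twist_at d (q * t + l / N) \<le> K * (- (sin (pi * e))\<^sup>2)"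
          using twist_at_good(1)[OF e that(1) d that(2)] K(1) by (intro mult_left_mono) auto
        then have "K * twist_at d (q * t + l / N) - \<kappa>' \<le> - V" using K(2) \<kappa>1 by simp
        then have "lshift s (K * twist_at d (q * t + l / N)) < \<delta>"
          unfolding sh by (rule lshift_extreme(2)[OF \<delta>(1) y V])
        then show ?thesis using L by (intro near) auto
      qed
      show "\<bar>\<phi> (h (\<psi> (ann_proj (s, t + j / q + l / real (q * N))))) - ?g 1 j\<bar> \<le> \<omega>"
        if "d + e \<le> q * t + l / N" "q * t + l / N \<le> 1 - e"
      proof -
        have "e \<le> q * t + l / N" using that(1) d by linarith
        then have "K * (sin (pi * e))\<^sup>2 \<le> K * twist_at d (q * t + l / N)"
          using twist_at_good(2)[OF e _ d that] K(1) by (intro mult_left_mono) auto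
        then have "V \<le> K * twist_at d (q * t + l / N) - \<kappa>'" using K(2) \<kappa>1 by simp
        then have "1 - \<delta> < lshift s (K * twist_at d (q * t + l / N))"
          unfolding sh by (rule lshift_extreme(1)[OF \<delta>(1) y V])
        then show ?thesis using L by (intro near) auto
      qed
    qed
  qed
  then show ?thesis
    unfolding B s_def[symmetric] circle_average_def
    by (simp add: sum.distrib sum_distrib_left[symmetric] add_divide_distrib)
qed

end

section \<open>Lebesgue measure on the annulus\<close>

lemma space_annulus_borel [simp]: "space annulus_borel = annulus"
  by (simp add: annulus_borel_def space_restrict_space)

lemma annulus_lebesgue_simps [simp]:
  "space annulus_lebesgue = annulus" "sets annulus_lebesgue = sets annulus_borel"
  by (simp_all add: annulus_lebesgue_def)

lemma borel_measurable_annulus: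
  fixes f :: "pt \<Rightarrow> 'b::topological_space"
  assumes "continuous_on annulus f" shows "f \<in> borel_measurable annulus_borel"
  unfolding annulus_borel_def by (rule borel_measurable_continuous_on_restrict[OF assms])


lemma measurable_ann_proj:
  "ann_proj \<in> measurable (restrict_space lborel ({0..1} \<times> {0..<1})) annulus_borel"
proof -
  have "ann_proj \<in> borel_measurable borel"
    by (rule borel_measurable_continuous_onI[OF continuous_on_ann_proj])
  then have "ann_proj \<in> measurable (restrict_space lborel ({0..1} \<times> {0..<1})) borel"
    by (intro measurable_restrict_space1) simp
  then show ?thesis
    unfolding annulus_borel_def
    by (intro measurable_restrict_space2) (auto simp: space_restrict_space strip_def)
qed

lemma emeasure_rectangle: "emeasure lborel (A \<times> B) = emeasure lborel A * emeasure lborel B"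
  if "A \<in> sets borel" "B \<in> sets borel" for A B :: "real set"
proof -
  have "emeasure (lborel \<Otimes>\<^sub>M lborel) (A \<times> B) = emeasure lborel A * emeasure lborel B"
    using that by (intro lborel.emeasure_pair_measure_Times) auto
  then show ?thesis by (simp add: lborel_prod)
qed

lemma rectangle_sets: "{0..1::real} \<times> {0..<1::real} \<in> sets borel"
  by (simp add: borel_Times)

lemma prob_space_annulus_lebesgue: "prob_space annulus_lebesgue"
proof -
  let ?R = "{0..1::real} \<times> {0..<1::real}"
  have "emeasure (restrict_space lborel ?R) (space (restrict_space lborel ?R)) = emeasure lborel ?R"
    using rectangle_sets by (simp add: emeasure_restrict_space space_restrict_space)
  also have "\<dots> = 1" by (simp add: emeasure_rectangle)
  finally have "prob_space (restrict_space lborel ?R)" by (rule prob_spaceI)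
  then show ?thesis
    unfolding annulus_lebesgue_def by (rule prob_space.prob_space_distr[OF _ measurable_ann_proj])
qed

interpretation leb: prob_space annulus_lebesgue
  by (rule prob_space_annulus_lebesgue)

lemma annulus_lebesgue_boundary: "measure annulus_lebesgue {x\<in>annulus. fst x = 0 \<or> fst x = 1} = 0"
proof -
  let ?R = "{0..1::real} \<times> {0..<1::real}" and ?B = "{x\<in>annulus. fst x = 0 \<or> fst x = 1}"
  have [measurable]: "fst \<in> borel_measurable annulus_borel"
    by (intro borel_measurable_annulus continuous_intros)
  have "{x\<in>space annulus_borel. fst x = 0 \<or> fst x = 1} \<in> sets annulus_borel" by measurable
  then have B: "?B \<in> sets annulus_borel" by simp
  have "emeasure annulus_lebesgue ?B = emeasure (restrict_space lborel ?R) (ann_proj -` ?B \<inter> space (restrict_space lborel ?R))"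
    unfolding annulus_lebesgue_def by (rule emeasure_distr[OF measurable_ann_proj B])
  also have "ann_proj -` ?B \<inter> space (restrict_space lborel ?R) = {0, 1} \<times> {0..<1}"
    by (auto simp: space_restrict_space strip_iff ann_proj_def annulus_iff)
  also have "emeasure (restrict_space lborel ?R) ({0, 1} \<times> {0..<1}) = emeasure lborel ({0, 1::real} \<times> {0..<1::real})"
    using rectangle_sets by (intro emeasure_restrict_space) auto
  also have "\<dots> = 0"
    using emeasure_lborel_countable[of "{0, 1::real}"] by (simp add: emeasure_rectangle)
  finally show ?thesis by (simp add: measure_def)
qed

text \<open>
  The conditions are on Birkhoff averages at one time \<open>n\<close>: near constancy on each boundary circle,
  little time in the interior, and the prescribed mixture at most points. The points \<open>(0, 1)\<close> and
  \<open>(1, 1)\<close> represent the two boundary circles, which is harmless by the first condition.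
\<close>
definition oscillates_at :: "(pt \<Rightarrow> pt) \<Rightarrow> (pt \<Rightarrow> real) set \<Rightarrow> real \<Rightarrow> real \<Rightarrow> nat \<Rightarrow> bool" where
  "oscillates_at f \<Phi> c \<epsilon> n \<longleftrightarrow>
     (\<forall>\<phi>\<in>\<Phi>. \<forall>x\<in>annulus. \<forall>y\<in>annulus. (fst x = 0 \<or> fst x = 1) \<and> fst y = fst x \<longrightarrow>
        \<bar>birkhoff f \<phi> n x - birkhoff f \<phi> n y\<bar> \<le> \<epsilon>) \<and>
     (\<forall>x\<in>annulus. birkhoff f chi n x \<le> \<epsilon>) \<and>
     1 - \<epsilon> \<le> measure annulus_lebesgue {x\<in>annulus. \<forall>\<phi>\<in>\<Phi>.
        \<bar>birkhoff f \<phi> n x - ((1 - c) * birkhoff f \<phi> n (0, 1) + c * birkhoff f \<phi> n (1, 1))\<bar> \<le> \<epsilon>}"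

lemma continuous_on_birkhoff:
  assumes "continuous_on annulus f" "\<And>x. x \<in> annulus \<Longrightarrow> f x \<in> annulus" "continuous_on annulus \<phi>"
  shows "continuous_on annulus (birkhoff f \<phi> n)"
proof -
  have "continuous_on annulus (f ^^ i) \<and> (f ^^ i) ` annulus \<subseteq> annulus" for i
  proof (induction i)
    case (Suc i)
    have "continuous_on annulus (\<lambda>x. f ((f ^^ i) x))"
      by (rule continuous_on_compose2[OF assms(1)]) (use Suc in auto)
    then show ?case using Suc assms(2) by (auto simp: image_subset_iff o_def)
  qed simp
  then have "continuous_on annulus (\<lambda>x. \<phi> ((f ^^ i) x))" for i
    using assms(3) by (intro continuous_on_compose2[OF assms(3)]) auto
  then show ?thesis unfolding birkhoff_def[abs_def] by (cases "n = 0") (auto intro!: continuous_intros)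
qed

lemma typical_set_measurable:
  assumes f: "continuous_on annulus f" "\<And>x. x \<in> annulus \<Longrightarrow> f x \<in> annulus"
    and \<Phi>: "finite \<Phi>" "\<And>\<phi>. \<phi> \<in> \<Phi> \<Longrightarrow> continuous_on annulus \<phi>"
  shows "{x\<in>annulus. \<forall>\<phi>\<in>\<Phi>. \<bar>birkhoff f \<phi> n x - t \<phi>\<bar> \<le> \<epsilon>} \<in> sets annulus_borel"
proof -
  have "{x\<in>space annulus_borel. \<forall>\<phi>\<in>\<Phi>. \<bar>birkhoff f \<phi> n x - t \<phi>\<bar> \<le> \<epsilon>} \<in> sets annulus_borel"
  proof (rule sets.sets_Collect_finite_All[OF _ \<Phi>(1)])
    fix \<phi> assume "\<phi> \<in> \<Phi>"
    then have [measurable]: "birkhoff f \<phi> n \<in> borel_measurable annulus_borel"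
      using \<Phi>(2) f by (intro borel_measurable_annulus continuous_on_birkhoff)
    show "{x\<in>space annulus_borel. \<bar>birkhoff f \<phi> n x - t \<phi>\<bar> \<le> \<epsilon>} \<in> sets annulus_borel" by measurable
  qed
  then show ?thesis by simp
qed

lemma modulus_exists:
  assumes "finite \<Phi>" "\<And>\<phi>. \<phi> \<in> \<Phi> \<Longrightarrow> continuous_on annulus \<phi>" "Cr_homeo r h k" "0 < \<omega>"
  shows "\<exists>\<delta>>0. \<forall>\<phi>\<in>\<Phi>. modulus h \<delta> \<omega> \<phi>"
  using assms(1,2)
proof (induction \<Phi>)
  case empty
  show ?case by (intro exI[of _ 1]) simp
next
  case (insert \<phi> \<Phi>)
  obtain \<delta> where \<delta>: "\<delta> > 0" "\<forall>\<phi>\<in>\<Phi>. modulus h \<delta> \<omega> \<phi>" using insert by auto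
  note D = Cr_homeoD[OF assms(3)]
  have "continuous_on annulus (\<lambda>x. \<phi> (h x))"
    by (rule continuous_on_compose2[OF _ D(1)]) (use insert.prems D(3) in auto)
  then have "uniformly_continuous_on annulus (\<lambda>x. \<phi> (h x))"
    by (rule compact_uniformly_continuous[OF _ compact_annulus])
  then obtain \<delta>' where \<delta>': "\<delta>' > 0"
    "\<And>x y. x \<in> annulus \<Longrightarrow> y \<in> annulus \<Longrightarrow> dist y x < \<delta>' \<Longrightarrow> dist (\<phi> (h y)) (\<phi> (h x)) < \<omega>"
    unfolding uniformly_continuous_on_def using assms(4) by metis
  have "modulus h (min \<delta> \<delta>') \<omega> \<phi>"
    unfolding modulus_def using \<delta>'(2) by (fastforce simp: dist_real_def dist_commute)
  moreover have "modulus h (min \<delta> \<delta>') \<omega> \<phi>'" if "\<phi>' \<in> \<Phi>" for \<phi>'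
    using \<delta>(2) that unfolding modulus_def by auto
  ultimately show ?case using \<delta>(1) \<delta>'(1) by (intro exI[of _ "min \<delta> \<delta>'"]) auto
qed

lemma measurable_fst_k:
  assumes "Cr_homeo r h k"
  shows "(\<lambda>x. fst (k x)) \<in> borel_measurable annulus_borel" "(\<lambda>x. snd (k x)) \<in> borel_measurable annulus_borel"
  using Cr_homeoD(2)[OF assms] by (auto intro!: borel_measurable_annulus continuous_intros)

text \<open>
  The collars shrink to the boundary of the annulus, which \<open>h\<close> preserves and which is a null set.
\<close>
lemma small_collar:
  assumes hk: "Cr_homeo r h k" and \<epsilon>: "0 < \<epsilon>" and \<delta>\<^sub>0: "0 < \<delta>\<^sub>0"
  obtains \<delta> where "0 < \<delta>" "\<delta> < \<delta>\<^sub>0"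
    "measure annulus_lebesgue {x\<in>annulus. \<not> (\<delta> \<le> fst (k x) \<and> fst (k x) \<le> 1 - \<delta>)} < \<epsilon>"
proof -
  note [measurable] = measurable_fst_k[OF hk]
  let ?d = "\<lambda>n::nat. 1 / (real n + 1)"
  define A where "A = (\<lambda>n. {x\<in>annulus. \<not> (?d n \<le> fst (k x) \<and> fst (k x) \<le> 1 - ?d n)})"
  have meas: "A n \<in> sets annulus_lebesgue" for n
  proof -
    have "{x\<in>space annulus_borel. \<not> (?d n \<le> fst (k x) \<and> fst (k x) \<le> 1 - ?d n)} \<in> sets annulus_borel"
      by measurable
    then show ?thesis by (simp add: A_def)
  qed
  have d: "?d (Suc n) \<le> ?d n" for n by (simp add: field_simps)
  have dec: "decseq A"
    unfolding decseq_Suc_iff A_def using d by (auto intro: order_trans)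
  have "(\<Inter>n. A n) \<subseteq> {x\<in>annulus. fst x = 0 \<or> fst x = 1}"
  proof
    fix x assume x: "x \<in> (\<Inter>n. A n)"
    then have xa: "x \<in> annulus" by (auto simp: A_def)
    have kx: "k x \<in> annulus" using Cr_homeoD(4)[OF hk xa] .
    have "\<not> (0 < fst (k x) \<and> fst (k x) < 1)"
    proof
      assume *: "0 < fst (k x) \<and> fst (k x) < 1"
      then obtain n where n: "?d n < min (fst (k x)) (1 - fst (k x))"
        using reals_Archimedean[of "min (fst (k x)) (1 - fst (k x))"]
        by (auto simp: inverse_eq_divide add.commute)
      have "x \<in> A n" using x by blast
      then show False using n by (auto simp: A_def)
    qed
    then have "fst (k x) = 0 \<or> fst (k x) = 1" using kx by (cases "k x") (auto simp: annulus_iff)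
    then have "fst (h (k x)) = 0 \<or> fst (h (k x)) = 1" by (rule Cr_homeo_boundary[OF hk kx])
    then show "x \<in> {x\<in>annulus. fst x = 0 \<or> fst x = 1}" using Cr_homeoD(5)[OF hk xa] xa by simp
  qed
  moreover have "{x\<in>annulus. fst x = 0 \<or> fst x = 1} \<in> sets annulus_lebesgue"
  proof -
    have [measurable]: "fst \<in> borel_measurable annulus_borel"
      by (intro borel_measurable_annulus continuous_intros)
    have "{x\<in>space annulus_borel. fst x = 0 \<or> fst x = 1} \<in> sets annulus_borel" by measurable
    then show ?thesis by simp
  qed
  ultimately have "measure annulus_lebesgue (\<Inter>n. A n) \<le> measure annulus_lebesgue {x\<in>annulus. fst x = 0 \<or> fst x = 1}"
    by (rule leb.finite_measure_mono)
  then have "measure annulus_lebesgue (\<Inter>n. A n) \<le> 0" by (simp only: annulus_lebesgue_boundary)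
  then have z: "measure annulus_lebesgue (\<Inter>n. A n) = 0" by (simp add: measure_le_0_iff)
  have "range A \<subseteq> sets annulus_lebesgue" using meas by blast
  from leb.finite_Lim_measure_decseq[OF this dec]
  have "(\<lambda>n. measure annulus_lebesgue (A n)) \<longlonglongrightarrow> 0" unfolding z .
  then have 1: "\<forall>\<^sub>F n in sequentially. measure annulus_lebesgue (A n) < \<epsilon>"
    using \<epsilon> by (rule order_tendstoD)
  have "?d \<longlonglongrightarrow> 0" using LIMSEQ_inverse_real_of_nat by (simp add: inverse_eq_divide add.commute)
  then have 2: "\<forall>\<^sub>F n in sequentially. ?d n < \<delta>\<^sub>0"
    using \<delta>\<^sub>0 by (rule order_tendstoD)
  from eventually_conj[OF 1 2] have "\<exists>n. measure annulus_lebesgue (A n) < \<epsilon> \<and> ?d n < \<delta>\<^sub>0"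
    by (rule eventually_happens'[OF sequentially_bot])
  then obtain n where "measure annulus_lebesgue (A n) < \<epsilon>" "?d n < \<delta>\<^sub>0" by blast
  then show ?thesis using that[of "?d n"] by (simp add: A_def)
qed

text \<open>
  A point of the unit circle cannot be close to \<open>- 1\<close> after two different rotations by \<open>J\<close>-th roots
  of unity.
\<close>
lemma roots_separated:
  assumes "0 < (J::nat)"
  obtains e where "0 < e" "e \<le> 1"
    "\<And>(b::nat) (b'::nat) w. b < J \<Longrightarrow> b' < J \<Longrightarrow> norm (w * cis (- 2 * pi * (b / J)) + 1) < e \<Longrightarrow>
      norm (w * cis (- 2 * pi * (b' / J)) + 1) < e \<Longrightarrow> norm w = 1 \<Longrightarrow> b = b'"
proof -
  define D where "D = insert 2 ((\<lambda>(b, b'). norm (cis (- 2 * pi * (real b / J)) - cis (- 2 * pi * (real b' / J))))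
      ` {(b, b'). b < J \<and> b' < J \<and> b \<noteq> b'})"
  have "finite {(b, b'). b < J \<and> b' < J \<and> b \<noteq> b'}"
    by (rule finite_subset[of _ "{..<J} \<times> {..<J}"]) auto
  then have fin: "finite D" by (simp add: D_def)
  have pos: "0 < x" if "x \<in> D" for x
  proof -
    have "cis (- 2 * pi * (real b / J)) \<noteq> cis (- 2 * pi * (real b' / J))" if "b < J" "b' < J" "b \<noteq> b'" for b b'
    proof
      assume eq: "cis (- 2 * pi * (real b / J)) = cis (- 2 * pi * (real b' / J))"
      have "cnj (cis (- 2 * pi * (real c / J))) = cis (2 * pi * (real c / J))" for c
        by (simp add: cis_cnj)
      then have "cis (2 * pi * (real b / J)) = cis (2 * pi * (real b' / J))" using eq by metis
      then have "exp (2 * pi * \<i> * of_nat b / of_nat J) = exp (2 * pi * \<i> * of_nat b' / of_nat J)"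
        by (simp add: cis_conv_exp algebra_simps)
      then have "b mod J = b' mod J" using complex_root_unity_eq[of J b b'] assms by (simp add: cong_def)
      then show False using that by simp
    qed
    then show ?thesis using that by (auto simp: D_def)
  qed
  define e where "e = Min D / 2"
  have "Min D \<in> D" using fin by (intro Min_in) (auto simp: D_def)
  then have e0: "0 < e" using pos by (simp add: e_def)
  have "Min D \<le> 2" using fin by (intro Min_le) (auto simp: D_def)
  then have e1: "e \<le> 1" by (simp add: e_def)
  show ?thesis
  proof (rule that[OF e0 e1])
    fix b b' w
    assume b: "b < J" "b' < J" and n: "norm (w * cis (- 2 * pi * (b / J)) + 1) < e"
      "norm (w * cis (- 2 * pi * (b' / J)) + 1) < e" "norm w = 1"
    show "b = b'"
    proof (rule ccontr)
      assume "b \<noteq> b'"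
      then have "norm (cis (- 2 * pi * (real b / J)) - cis (- 2 * pi * (real b' / J))) \<in> D"
        using b by (auto simp: D_def)
      then have "Min D \<le> norm (cis (- 2 * pi * (real b / J)) - cis (- 2 * pi * (real b' / J)))"
        using fin by simp
      also have "\<dots> = norm (w * (cis (- 2 * pi * (real b / J)) - cis (- 2 * pi * (real b' / J))))"
        by (simp only: norm_mult n(3) mult_1)
      also have "\<dots> = norm ((w * cis (- 2 * pi * (b / J)) + 1) - (w * cis (- 2 * pi * (b' / J)) + 1))"
        by (simp add: right_diff_distrib)
      also have "\<dots> \<le> norm (w * cis (- 2 * pi * (b / J)) + 1) + norm (w * cis (- 2 * pi * (b' / J)) + 1)"
        by (rule norm_triangle_ineq4)
      also have "\<dots> < e + e" using n by linarith
      finally show False by (simp add: e_def)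
    qed
  qed
qed

text \<open>
  The exceptional sets for the phases \<open>b/J\<close>, \<open>b < J\<close>, are disjoint, so one of them has measure at
  most \<open>1/J\<close>. This holds whatever \<open>k\<close> does to the measure.
\<close>
lemma choose_phase:
  assumes hk: "Cr_homeo r h k" and J: "0 < (J::nat)"
    and sep: "\<And>(b::nat) (b'::nat) w. b < J \<Longrightarrow> b' < J \<Longrightarrow> norm (w * cis (- 2 * pi * (b / J)) + 1) < e \<Longrightarrow>
      norm (w * cis (- 2 * pi * (b' / J)) + 1) < e \<Longrightarrow> norm w = 1 \<Longrightarrow> b = b'"
  obtains b :: nat where "b < J"
    "measure annulus_lebesgue {x\<in>annulus. norm (snd (k x) ^ q * cis (- 2 * pi * (b / J)) + 1) < e} \<le> 1 / J"
proof -
  note [measurable] = measurable_fst_k[OF hk]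
  define B where "B = (\<lambda>b::nat. {x\<in>annulus. norm (snd (k x) ^ q * cis (- 2 * pi * (b / J)) + 1) < e})"
  have meas: "B b \<in> sets annulus_lebesgue" for b
  proof -
    have "{x\<in>space annulus_borel. norm (snd (k x) ^ q * cis (- 2 * pi * (b / J)) + 1) < e} \<in> sets annulus_borel"
      by measurable
    then show ?thesis by (simp add: B_def)
  qed
  have disj: "disjoint_family_on B {..<J}"
    unfolding disjoint_family_on_def
  proof (intro ballI impI)
    fix b b' assume b: "b \<in> {..<J}" "b' \<in> {..<J}" "b \<noteq> b'"
    show "B b \<inter> B b' = {}"
    proof (rule ccontr)
      assume "B b \<inter> B b' \<noteq> {}"
      then obtain x where x: "x \<in> B b" "x \<in> B b'" by blast
      then have "k x \<in> annulus" using Cr_homeoD(4)[OF hk] by (simp add: B_def)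
      then have "norm (snd (k x) ^ q) = 1" by (cases "k x") (simp add: annulus_iff norm_power)
      then show False using sep[of b b' "snd (k x) ^ q"] x b by (auto simp: B_def)
    qed
  qed
  have "\<exists>b<J. measure annulus_lebesgue (B b) \<le> 1 / J"
  proof (rule ccontr)
    assume "\<not> ?thesis"
    then have "(\<Sum>b<J. 1 / real J) < (\<Sum>b<J. measure annulus_lebesgue (B b))"
      using J by (intro sum_strict_mono) (auto simp: not_le)
    also have "\<dots> = measure annulus_lebesgue (\<Union>b<J. B b)"
    proof (rule leb.finite_measure_finite_Union[symmetric, OF _ _ disj])
      show "B ` {..<J} \<subseteq> sets annulus_lebesgue" using meas by blast
    qed simp
    also have "\<dots> \<le> 1" by (rule leb.prob_le_1)
    finally show False using J by simp
  qed
  then show ?thesis using that by (auto simp: B_def)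
qed

lemma (in twisting) psi_inv_pow:
  "snd (psi_inv q d K a \<beta> x) ^ q = moebius a (snd x ^ q * cis (- 2 * pi * (q * \<beta>)))"
proof -
  have "(snd x * cis (- 2 * pi * \<beta>)) ^ q = snd x ^ q * cis (q * (- 2 * pi * \<beta>))"
    by (simp only: power_mult_distrib Complex.DeMoivre)
  also have "q * (- 2 * pi * \<beta>) = - 2 * pi * (q * \<beta>)" by simp
  finally show ?thesis
    unfolding psi_inv_def Let_def case_prod_unfold snd_conv pow_q by simp
qed

lemma rotation_add_nat: "rotation (\<alpha> + real m) x = rotation \<alpha> x"
proof (induction m)
  case (Suc m)
  have "rotation (\<alpha> + real (Suc m)) x = rotation ((\<alpha> + real m) + 1) x" by (simp add: algebra_simps)
  then show ?case using Suc by (simp only: rotation_add_1)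
qed simp

section \<open>Density of the oscillation conditions\<close>

lemma rational_near:
  assumes hk: "Cr_homeo r h k" and W: "openin (Diff_top r) W" "rot_conj h k \<alpha> \<in> W"
  obtains p q :: nat where "q0 \<le> q" "0 < q" "rot_conj h k (real p / real q) \<in> W"
proof -
  define m where "m = nat \<lceil>\<bar>\<alpha>\<bar>\<rceil>"
  define \<alpha>' where "\<alpha>' = \<alpha> + real m"
  have m: "\<bar>\<alpha>\<bar> \<le> real m" unfolding m_def by linarith
  have \<alpha>': "0 \<le> \<alpha>'" using m by (simp add: \<alpha>'_def)
  have "rot_conj h k \<alpha>' = rot_conj h k \<alpha>" by (simp add: rot_conj_def \<alpha>'_def rotation_add_nat)
  then have "\<alpha>' \<in> {\<alpha>. rot_conj h k \<alpha> \<in> W}" using W(2) by simp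
  then obtain \<rho> where \<rho>: "\<rho> > 0" "ball \<alpha>' \<rho> \<subseteq> {\<alpha>. rot_conj h k \<alpha> \<in> W}"
    using open_rot_conj_vimage[OF hk W(1)] open_contains_ball by blast
  define q where "q = max q0 (nat \<lceil>1 / \<rho>\<rceil> + 1)"
  have q: "q0 \<le> q" "0 < q" by (auto simp: q_def)
  have "1 / \<rho> < real (nat \<lceil>1 / \<rho>\<rceil> + 1)" by linarith
  also have "\<dots> \<le> real q" unfolding q_def by (intro of_nat_mono) simp
  finally have q\<rho>: "1 / q < \<rho>" using \<rho>(1) q(2) by (simp add: field_simps)
  define p where "p = nat \<lfloor>\<alpha>' * q\<rfloor>"
  have p: "real p \<le> \<alpha>' * q" "\<alpha>' * q < real p + 1"
    unfolding p_def using \<alpha>' by (simp_all add: of_nat_nat)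
  have "real p / q \<le> \<alpha>'" "\<alpha>' < (real p + 1) / q"
    using p q(2) by (simp_all add: pos_divide_le_eq pos_less_divide_eq)
  then have "\<bar>\<alpha>' - real p / q\<bar> < \<rho>" using q\<rho> by (simp add: add_divide_distrib)
  then have "real p / real q \<in> ball \<alpha>' \<rho>" by (simp add: dist_real_def)
  then show ?thesis using that[OF q] \<rho>(2) by blast
qed

lemma coprime_Suc_multiple: "m dvd y \<Longrightarrow> coprime (y + 1) (m::nat)"
  by (meson coprime_def dvd_add_right_iff dvd_trans)

theorem oscillating_perturbation:
  fixes \<Phi> :: "(pt \<Rightarrow> real) set"
  assumes hk: "Cr_homeo r h k"
    and \<Phi>: "finite \<Phi>" "\<And>\<phi>. \<phi> \<in> \<Phi> \<Longrightarrow> continuous_on annulus \<phi>"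
      "\<And>\<phi> x. \<phi> \<in> \<Phi> \<Longrightarrow> x \<in> annulus \<Longrightarrow> \<bar>\<phi> x\<bar> \<le> 1"
    and c: "0 \<le> c" "c \<le> 1" and \<epsilon>: "0 < \<epsilon>"
    and W: "openin (Diff_top r) W" "rot_conj h k \<alpha> \<in> W"
  shows "\<exists>g\<in>rotation_conjugates r. g \<in> W \<and> (\<exists>n\<ge>N\<^sub>0. 0 < n \<and> oscillates_at g \<Phi> c \<epsilon> n)"
proof -
  define \<omega> where "\<omega> = \<epsilon> / 8"
  define e where "e = min (\<epsilon> / 64) (1 / 4)"
  have \<omega>: "0 < \<omega>" and e: "0 < e" "e \<le> \<epsilon> / 64" "e \<le> 1 / 4" using \<epsilon> by (auto simp: \<omega>_def e_def)
  have "continuous_on annulus chi" unfolding chi_def by (intro continuous_intros)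
  then obtain \<delta>\<^sub>0 where \<delta>\<^sub>0: "\<delta>\<^sub>0 > 0" "\<forall>\<phi>\<in>insert chi \<Phi>. modulus h \<delta>\<^sub>0 \<omega> \<phi>"
    using modulus_exists[of "insert chi \<Phi>" r h k \<omega>] \<Phi>(1,2) hk \<omega> by blast
  obtain \<delta> where \<delta>: "0 < \<delta>" "\<delta> < \<delta>\<^sub>0 / 2"
    "measure annulus_lebesgue {x\<in>annulus. \<not> (\<delta> \<le> fst (k x) \<and> fst (k x) \<le> 1 - \<delta>)} < \<epsilon> / 2"
    using small_collar[OF hk, of "\<epsilon> / 2" "\<delta>\<^sub>0 / 2"] \<epsilon> \<delta>\<^sub>0(1) by auto
  define V where "V = max 0 (ln (1 / \<delta>\<^sup>2) + 1)"
  have V: "1 / \<delta>\<^sup>2 < exp V"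
  proof -
    have "1 / \<delta>\<^sup>2 = exp (ln (1 / \<delta>\<^sup>2))" using \<delta>(1) by simp
    also have "\<dots> < exp V" unfolding V_def by (subst exp_less_cancel_iff) linarith
    finally show ?thesis .
  qed
  have V0: "0 \<le> V" by (simp add: V_def)
  define S where "S = (sin (pi * e))\<^sup>2"
  have S: "0 < S" unfolding S_def using e by (intro zero_less_power sin_gt_zero) (auto simp: field_simps)
  define K where "K = (V + 1) / S"
  have K: "0 < K" "V + 1 \<le> K * S" using S V0 by (auto simp: K_def)
  obtain J :: nat where J: "2 / \<epsilon> < J" using reals_Archimedean2 by blast
  then have J0: "0 < J" using \<epsilon> by (metis divide_pos_pos of_nat_0_less_iff order_less_trans zero_less_numeral)
  have J1: "1 / J < \<epsilon> / 2" using J J0 \<epsilon> by (simp add: field_simps)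
  obtain e\<^sub>0 where e\<^sub>0: "0 < e\<^sub>0" "e\<^sub>0 \<le> 1"
    "\<And>(b::nat) (b'::nat) w. b < J \<Longrightarrow> b' < J \<Longrightarrow> norm (w * cis (- 2 * pi * (b / J)) + 1) < e\<^sub>0 \<Longrightarrow>
      norm (w * cis (- 2 * pi * (b' / J)) + 1) < e\<^sub>0 \<Longrightarrow> norm w = 1 \<Longrightarrow> b = b'"
    using roots_separated[OF J0] by metis
  \<comment> \<open>By \<open>moebius_contracts\<close> this \<open>a\<close> brings all points at distance at least \<open>e\<^sub>0\<close> from \<open>- 1\<close> so close to \<open>1\<close>
    that \<open>K\<close> times the twist is at most \<open>1\<close> there.\<close>
  define a where "a = 1 - min (e\<^sub>0 / 2) (e\<^sub>0 / (2 * K))"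
  have a: "0 < a" "a < 1" "1 - a \<le> e\<^sub>0 / 2" "1 - a \<le> e\<^sub>0 / (2 * K)"
  proof -
    have "0 < min (e\<^sub>0 / 2) (e\<^sub>0 / (2 * K))" using e\<^sub>0(1) K(1) by simp
    moreover have "min (e\<^sub>0 / 2) (e\<^sub>0 / (2 * K)) \<le> e\<^sub>0 / 2" "min (e\<^sub>0 / 2) (e\<^sub>0 / (2 * K)) \<le> e\<^sub>0 / (2 * K)"
      by simp_all
    ultimately show "0 < a" "a < 1" "1 - a \<le> e\<^sub>0 / 2" "1 - a \<le> e\<^sub>0 / (2 * K)"
      using e\<^sub>0(2) unfolding a_def by linarith+
  qed
  obtain p q :: nat where q: "max N\<^sub>0 (nat \<lceil>16 * pi / \<delta>\<^sub>0\<rceil> + 1) \<le> q" "0 < q"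
    and pq: "rot_conj h k (real p / real q) \<in> W"
    using rational_near[OF hk W] by metis
  have q\<delta>: "8 * pi / q < \<delta>\<^sub>0 / 2"
  proof -
    have "16 * pi / \<delta>\<^sub>0 < real (nat \<lceil>16 * pi / \<delta>\<^sub>0\<rceil> + 1)" by linarith
    also have "\<dots> \<le> real q" using q(1) by (intro of_nat_mono) simp
    finally show ?thesis using \<delta>\<^sub>0(1) q(2) by (simp add: field_simps)
  qed
  obtain b :: nat where b: "b < J"
    "measure annulus_lebesgue {x\<in>annulus. norm (snd (k x) ^ q * cis (- 2 * pi * (b / J)) + 1) < e\<^sub>0} \<le> 1 / J"
    by (rule choose_phase[OF hk J0 e\<^sub>0(3), where q = q])
  define \<beta> where "\<beta> = b / J / q"
  have \<beta>: "0 \<le> \<beta>" "\<beta> \<le> 1 / q" "q * \<beta> = b / J"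
  proof -
    have "real b / J \<le> 1" using b(1) J0 by simp
    then show "\<beta> \<le> 1 / q" unfolding \<beta>_def by (intro divide_right_mono) auto
  qed (use q(2) in \<open>simp_all add: \<beta>_def\<close>)
  \<comment> \<open>The proportion \<open>d\<close> of each circle is pushed to height \<open>0\<close>, which \<open>h\<close> maps to the boundary circle
    \<open>s = 1\<close> if it exchanges the boundary circles.\<close>
  define d where "d = (if flips k then c else 1 - c)"
  have d: "0 \<le> d" "d \<le> 1" using c by (auto simp: d_def)
  interpret T: twisting q d K a \<beta> by unfold_locales (use q a in auto)
  let ?H = "h \<circ> psi q d K a \<beta>" and ?K = "psi_inv q d K a \<beta> \<circ> k"
  have HK: "Cr_homeo r ?H ?K" by (rule Cr_homeo_compose[OF hk T.Cr_homeo_psi])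
  have "rot_conj ?H ?K (real p / real q) = rot_conj h k (real p / real q)"
  proof (rule extensionalityI[of _ annulus])
    fix x assume x: "x \<in> annulus"
    then have "k x \<in> annulus" using Cr_homeoD(4)[OF hk] by blast
    then show "rot_conj ?H ?K (real p / real q) x = rot_conj h k (real p / real q) x"
      using x T.psi_rotation[of p] T.psi_psi_inv by (simp add: rot_conj_def)
  qed (auto simp: rot_conj_def)
  then have "real p / real q \<in> {\<alpha>. rot_conj ?H ?K \<alpha> \<in> W}" using pq by simp
  then obtain \<rho> where \<rho>: "\<rho> > 0" "ball (real p / real q) \<rho> \<subseteq> {\<alpha>. rot_conj ?H ?K \<alpha> \<in> W}"
    using open_rot_conj_vimage[OF HK W(1)] open_contains_ball by blast
  obtain M :: nat where M: "max (1 / \<rho>) (64 / \<epsilon>) < M" using reals_Archimedean2 by blast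
  have M0: "0 < M" using M \<epsilon> by (metis divide_pos_pos less_max_iff_disj max_less_iff_conj of_nat_0_less_iff order_less_trans zero_less_numeral)
  \<comment> \<open>With this \<open>N\<close> and \<open>P\<close>, the fraction \<open>P/(q N)\<close> is \<open>p/q + 1/(q N)\<close>, and it is in lowest terms whatever
    the greatest common divisor of \<open>p\<close> and \<open>q\<close> is, since \<open>P\<close> is \<open>1\<close> modulo \<open>q M\<close>.\<close>
  define N where "N = q * M"
  define P where "P = p * q * M + 1"
  have N0: "0 < N" using q M0 by (simp add: N_def)
  have NM: "real M \<le> real N" unfolding N_def using q(2) by (intro of_nat_mono) simp
  have N8: "8 / N \<le> \<epsilon> / 8"
  proof -
    have "64 / \<epsilon> \<le> N" using M NM by linarith
    then show ?thesis using N0 \<epsilon> by (simp add: field_simps)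
  qed
  have cop: "coprime P (q * N)"
  proof -
    have "coprime P q" "coprime P M" unfolding P_def by (intro coprime_Suc_multiple; simp)+
    then show ?thesis by (simp add: N_def)
  qed
  have "real P / real (q * N) - real p / real q = 1 / (q * N)"
    using q(2) M0 by (simp add: P_def N_def field_simps)
  moreover have "1 / real (q * N) \<le> 1 / M"
  proof -
    have "N \<le> q * N" "M \<le> N" using q(2) by (simp_all add: N_def)
    then have "real M \<le> real (q * N)" by linarith
    then show ?thesis using M0 by (intro divide_left_mono) auto
  qed
  moreover have "1 / M < \<rho>" using M M0 \<rho>(1) by (simp add: field_simps)
  moreover have "0 \<le> 1 / real (q * N)" by simp
  moreover have "\<bar>y - x\<bar> < \<rho>" if "x - y = z" "z \<le> w" "w < \<rho>" "0 \<le> z" for x y z w :: real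
    using that by linarith
  ultimately have "\<bar>real p / real q - real P / real (q * N)\<bar> < \<rho>" by blast
  then have near: "real P / real (q * N) \<in> ball (real p / real q) \<rho>"
    by (simp add: dist_real_def)
  interpret PP: perturbed q d K a \<beta> r h k N P \<delta>\<^sub>0 \<delta> V e
    by unfold_locales (use hk N0 cop \<beta> d \<delta> q\<delta> V e K S_def in auto)
  have gW: "PP.g \<in> W" using near \<rho>(2) unfolding PP.g_def by blast
  have gRC: "PP.g \<in> rotation_conjugates r"
    unfolding PP.g_def by (rule rot_conj_in_rotation_conjugates[OF HK])
  have mod: "modulus h \<delta>\<^sub>0 \<omega> \<phi>" if "\<phi> \<in> \<Phi>" for \<phi> using \<delta>\<^sub>0(2) that by blast
  let ?F = "circle_average h q"
  have kb: "fst (k x) = (if flips k then 1 - fst x else fst x)" if "x \<in> annulus" "fst x = 0 \<or> fst x = 1" for x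
    using Cr_homeo_boundary_value[OF Cr_homeo_sym[OF hk] that] .
  have 1: "\<bar>birkhoff PP.g \<phi> (q * N) x - birkhoff PP.g \<phi> (q * N) y\<bar> \<le> \<epsilon>"
    if "\<phi> \<in> \<Phi>" "x \<in> annulus" "y \<in> annulus" "fst x = 0 \<or> fst x = 1" "fst y = fst x" for \<phi> x y
  proof -
    have "fst (k x) = fst (k y)" using kb that by simp
    moreover have "\<bar>birkhoff PP.g \<phi> (q * N) x - ?F \<phi> (fst (k x))\<bar> \<le> \<omega>" "\<bar>birkhoff PP.g \<phi> (q * N) y - ?F \<phi> (fst (k y))\<bar> \<le> \<omega>"
      using that by (intro PP.birkhoff_boundary mod; simp)+
    moreover have "\<bar>u - v\<bar> \<le> 2 * \<omega>" if "\<bar>u - w\<bar> \<le> \<omega>" "\<bar>v - w\<bar> \<le> \<omega>" for u v w :: real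
      using that by linarith
    ultimately have "\<bar>birkhoff PP.g \<phi> (q * N) x - birkhoff PP.g \<phi> (q * N) y\<bar> \<le> 2 * \<omega>" by metis
    then show ?thesis using \<epsilon> by (simp add: \<omega>_def)
  qed
  have 2: "birkhoff PP.g chi (q * N) x \<le> \<epsilon>" if "x \<in> annulus" for x
  proof -
    have "birkhoff PP.g chi (q * N) x \<le> \<omega> + 6 * e + 6 / N"
      using \<delta>\<^sub>0(2) that \<omega> by (intro PP.birkhoff_interior) auto
    moreover have "6 / N \<le> 8 / N" by (intro divide_right_mono) auto
    ultimately show ?thesis using N8 e \<epsilon> by (simp add: \<omega>_def)
  qed
  let ?good = "{x\<in>annulus. \<forall>\<phi>\<in>\<Phi>. \<bar>birkhoff PP.g \<phi> (q * N) x -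
      ((1 - c) * birkhoff PP.g \<phi> (q * N) (0, 1) + c * birkhoff PP.g \<phi> (q * N) (1, 1))\<bar> \<le> \<epsilon>}"
  let ?B1 = "{x\<in>annulus. \<not> (\<delta> \<le> fst (k x) \<and> fst (k x) \<le> 1 - \<delta>)}"
  let ?B2 = "{x\<in>annulus. norm (snd (k x) ^ q * cis (- 2 * pi * (b / J)) + 1) < e\<^sub>0}"
  have good: "x \<in> ?good" if x: "x \<in> annulus" "x \<notin> ?B1" "x \<notin> ?B2" for x
  proof -
    have kx: "k x \<in> annulus" using PP.k_in x(1) by blast
    let ?w = "snd (k x) ^ q * cis (- 2 * pi * (b / J))"
    have w: "norm ?w = 1" using kx by (cases "k x") (simp add: annulus_iff norm_mult norm_power)
    have "norm (moebius a ?w - 1) \<le> 4 * (1 - a) / e\<^sub>0"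
      using x w a e\<^sub>0(1) by (intro moebius_contracts) auto
    then have "norm (moebius a ?w - 1) / 2 \<le> 4 * (1 - a) / e\<^sub>0 / 2" by (rule divide_right_mono) simp
    also have "4 * (1 - a) / e\<^sub>0 / 2 = 2 * (1 - a) / e\<^sub>0" using e\<^sub>0(1) by (simp add: field_simps)
    finally have "\<bar>twist d (moebius a ?w)\<bar> \<le> 2 * (1 - a) / e\<^sub>0"
      using order_trans[OF twist_le] by blast
    moreover have "snd (PP.\<psi>' (k x)) ^ q = moebius a ?w" unfolding T.psi_inv_pow \<beta>(3) ..
    ultimately have "\<bar>twist d (snd (PP.\<psi>' (k x)) ^ q)\<bar> \<le> 2 * (1 - a) / e\<^sub>0"
      by (simp only:)
    then have "K * \<bar>twist d (snd (PP.\<psi>' (k x)) ^ q)\<bar> \<le> K * (2 * (1 - a) / e\<^sub>0)"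
      using K(1) by (intro mult_left_mono) auto
    also have "K * (2 * (1 - a) / e\<^sub>0) \<le> K * (2 * (e\<^sub>0 / (2 * K)) / e\<^sub>0)"
      using a(4) K(1) e\<^sub>0(1) by (intro mult_left_mono divide_right_mono) auto
    also have "\<dots> = 1" using K(1) e\<^sub>0(1) by simp
    finally have \<kappa>: "\<bar>K * twist d (snd (PP.\<psi>' (k x)) ^ q)\<bar> \<le> 1" using K(1) by (simp add: abs_mult)
    have "\<bar>birkhoff PP.g \<phi> (q * N) x - ((1 - c) * birkhoff PP.g \<phi> (q * N) (0, 1) + c * birkhoff PP.g \<phi> (q * N) (1, 1))\<bar> \<le> \<epsilon>"
      if \<phi>: "\<phi> \<in> \<Phi>" for \<phi>
    proof -
      have t: "\<bar>birkhoff PP.g \<phi> (q * N) x - (d * ?F \<phi> 0 + (1 - d) * ?F \<phi> 1)\<bar> \<le> \<omega> + 8 * e + 8 / N"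
        using \<phi> x \<omega> \<kappa> \<Phi>(3) by (intro PP.birkhoff_typical mod) auto
      have b0: "\<bar>birkhoff PP.g \<phi> (q * N) (0, 1) - ?F \<phi> (fst (k (0, 1)))\<bar> \<le> \<omega>"
        and b1: "\<bar>birkhoff PP.g \<phi> (q * N) (1, 1) - ?F \<phi> (fst (k (1, 1)))\<bar> \<le> \<omega>"
        using \<phi> by (intro PP.birkhoff_boundary mod; simp add: annulus_iff)+
      have k0: "fst (k (0, 1)) = (if flips k then 1 else 0)" "fst (k (1, 1)) = (if flips k then 0 else 1)"
        using kb[of "(0, 1)"] kb[of "(1, 1)"] by (auto simp: annulus_iff)
      have F: "d * ?F \<phi> 0 + (1 - d) * ?F \<phi> 1 = (1 - c) * ?F \<phi> (fst (k (0, 1))) + c * ?F \<phi> (fst (k (1, 1)))"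
        unfolding k0 d_def by simp
      have "\<bar>(1 - c) * (birkhoff PP.g \<phi> (q * N) (0, 1) - ?F \<phi> (fst (k (0, 1))))\<bar> \<le> (1 - c) * \<omega>"
        unfolding abs_mult using b0 c by (intro mult_mono) auto
      moreover have "\<bar>c * (birkhoff PP.g \<phi> (q * N) (1, 1) - ?F \<phi> (fst (k (1, 1))))\<bar> \<le> c * \<omega>"
        unfolding abs_mult using b1 c by (intro mult_mono) auto
      moreover have "(1 - c) * \<omega> + c * \<omega> = \<omega>" by (simp add: algebra_simps)
      moreover have "\<bar>((1 - c) * u + c * v) - ((1 - c) * u' + c * v')\<bar> \<le> \<omega>"
        if "\<bar>(1 - c) * (u' - u)\<bar> \<le> s" "\<bar>c * (v' - v)\<bar> \<le> s'" "s + s' = \<omega>" for u v u' v' s s'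
        using that unfolding right_diff_distrib by linarith
      ultimately have "\<bar>(d * ?F \<phi> 0 + (1 - d) * ?F \<phi> 1)
          - ((1 - c) * birkhoff PP.g \<phi> (q * N) (0, 1) + c * birkhoff PP.g \<phi> (q * N) (1, 1))\<bar> \<le> \<omega>"
        unfolding F by blast
      moreover have "\<bar>u - w\<bar> \<le> \<omega> + s" if "\<bar>v - w\<bar> \<le> \<omega>" "\<bar>u - v\<bar> \<le> s" for u v w s :: real
        using that by linarith
      ultimately have "\<bar>birkhoff PP.g \<phi> (q * N) x - ((1 - c) * birkhoff PP.g \<phi> (q * N) (0, 1) + c * birkhoff PP.g \<phi> (q * N) (1, 1))\<bar>
          \<le> \<omega> + (\<omega> + 8 * e + 8 / N)" using t by blast
      then show ?thesis using N8 e \<epsilon> by (simp add: \<omega>_def)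
    qed
    then show ?thesis using x(1) by blast
  qed
  have "1 - \<epsilon> \<le> measure annulus_lebesgue ?good"
  proof -
    note [measurable] = measurable_fst_k[OF hk]
    have "{x\<in>space annulus_borel. \<not> (\<delta> \<le> fst (k x) \<and> fst (k x) \<le> 1 - \<delta>)} \<in> sets annulus_borel"
      "{x\<in>space annulus_borel. norm (snd (k x) ^ q * cis (- 2 * pi * (b / J)) + 1) < e\<^sub>0} \<in> sets annulus_borel"
      by measurable
    then have B: "?B1 \<in> sets annulus_lebesgue" "?B2 \<in> sets annulus_lebesgue" by simp_all
    have hg: "homeomorphism annulus annulus PP.g (rot_conj ?H ?K (- (real P / real (q * N))))"
      unfolding PP.g_def by (rule homeomorphism_rot_conj[OF HK])
    then have "continuous_on annulus PP.g" "\<And>x. x \<in> annulus \<Longrightarrow> PP.g x \<in> annulus"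
      unfolding homeomorphism_def by blast+
    then have G: "?good \<in> sets annulus_lebesgue"
      unfolding annulus_lebesgue_simps using \<Phi>(1,2) by (rule typical_set_measurable)
    have "measure annulus_lebesgue (?B1 \<union> ?B2) \<le> measure annulus_lebesgue ?B1 + measure annulus_lebesgue ?B2"
      using B by (rule measure_Un_le)
    then have "measure annulus_lebesgue (?B1 \<union> ?B2) \<le> \<epsilon>" using \<delta>(3) b(2) J1 by linarith
    moreover have "measure annulus_lebesgue (space annulus_lebesgue - (?B1 \<union> ?B2)) = 1 - measure annulus_lebesgue (?B1 \<union> ?B2)"
      using B by (intro leb.prob_compl) auto
    moreover have "measure annulus_lebesgue (space annulus_lebesgue - (?B1 \<union> ?B2)) \<le> measure annulus_lebesgue ?good"
      using good by (intro leb.finite_measure_mono G) auto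
    ultimately show ?thesis by linarith
  qed
  then have "oscillates_at PP.g \<Phi> c \<epsilon> (q * N)"
    unfolding oscillates_at_def using 1 2 by blast
  moreover have "N\<^sub>0 \<le> q * N" using q(1) N0 by (metis le_trans max.boundedE mult.commute mult_le_mono1 nat_mult_1 Suc_leI One_nat_def)
  moreover have "0 < q * N" using q(2) N0 by simp
  ultimately show ?thesis using gW gRC by blast
qed

section \<open>The generic set\<close>

text \<open>
  Countably many test functions, bounded by \<open>1\<close> on the annulus, with dense linear span.
\<close>
definition monom3 :: "nat \<times> nat \<times> nat \<Rightarrow> pt \<Rightarrow> real" where
  "monom3 = (\<lambda>(i, j, l) x. fst x ^ i * Re (snd x) ^ j * Im (snd x) ^ l)"

definition monoms_upto :: "nat \<Rightarrow> (pt \<Rightarrow> real) set" where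
  "monoms_upto N = monom3 ` ({..N} \<times> {..N} \<times> {..N})"

lemma finite_monoms_upto: "finite (monoms_upto N)"
  by (simp add: monoms_upto_def)

lemma monom3_in_monoms_upto: "i \<le> N \<Longrightarrow> j \<le> N \<Longrightarrow> l \<le> N \<Longrightarrow> monom3 (i, j, l) \<in> monoms_upto N"
  by (auto simp: monoms_upto_def)

lemma continuous_on_monom3: "continuous_on S (monom3 m)"
  unfolding monom3_def case_prod_unfold by (intro continuous_intros)

lemma monom3_bound:
  assumes "x \<in> annulus" shows "\<bar>monom3 m x\<bar> \<le> 1"
proof -
  obtain i j l where m: "m = (i, j, l)" by (cases m)
  have x: "\<bar>fst x\<bar> \<le> 1" "\<bar>Re (snd x)\<bar> \<le> 1" "\<bar>Im (snd x)\<bar> \<le> 1"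
    using assms abs_Re_le_cmod[of "snd x"] abs_Im_le_cmod[of "snd x"] by (cases x; simp add: annulus_iff)+
  have "\<bar>fst x\<bar> ^ i * \<bar>Re (snd x)\<bar> ^ j * \<bar>Im (snd x)\<bar> ^ l \<le> 1 * 1 * 1"
    using x by (intro mult_mono power_le_one) auto
  then show ?thesis by (simp add: m monom3_def abs_mult power_abs)
qed

lemma monoms_upto_props:
  assumes "\<phi> \<in> monoms_upto N"
  shows "continuous_on annulus \<phi>" "x \<in> annulus \<Longrightarrow> \<bar>\<phi> x\<bar> \<le> 1"
  using assms continuous_on_monom3 monom3_bound unfolding monoms_upto_def by blast+

text \<open>
  The maps \<open>g\<close> are required to preserve the annulus because uniform continuity of \<open>f\<close> is available
  only there.
\<close>
definition C0_close :: "real \<Rightarrow> (pt \<Rightarrow> pt) \<Rightarrow> (pt \<Rightarrow> pt) \<Rightarrow> bool" where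
  "C0_close \<epsilon> f g \<longleftrightarrow> (\<forall>x\<in>annulus. g x \<in> annulus \<and> dist (g x) (f x) < \<epsilon>)"

lemma C0_close_mono: "C0_close \<epsilon> f g \<Longrightarrow> \<epsilon> \<le> \<epsilon>' \<Longrightarrow> C0_close \<epsilon>' f g"
  by (auto simp: C0_close_def intro: less_le_trans)

lemma C0_close_finite:
  assumes "finite A" "\<And>a. a \<in> A \<Longrightarrow> \<exists>\<epsilon>>0. \<forall>g. C0_close \<epsilon> f g \<longrightarrow> Q a g"
  shows "\<exists>\<epsilon>>0. \<forall>a\<in>A. \<forall>g. C0_close \<epsilon> f g \<longrightarrow> Q a g"
  using assms
proof (induction A)
  case empty
  show ?case by (intro exI[of _ 1]) simp
next
  case (insert a A)
  obtain \<epsilon> where 1: "\<epsilon> > 0" "\<forall>a\<in>A. \<forall>g. C0_close \<epsilon> f g \<longrightarrow> Q a g" using insert by auto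
  obtain \<epsilon>' where 2: "\<epsilon>' > 0" "\<forall>g. C0_close \<epsilon>' f g \<longrightarrow> Q a g" using insert.prems by blast
  show ?case
    using 1 2 C0_close_mono[of "min \<epsilon> \<epsilon>'" f _ \<epsilon>] C0_close_mono[of "min \<epsilon> \<epsilon>'" f _ \<epsilon>']
    by (intro exI[of _ "min \<epsilon> \<epsilon>'"]) auto
qed

lemma funpow_in_annulus:
  assumes "\<And>x. x \<in> annulus \<Longrightarrow> f x \<in> annulus" "x \<in> annulus"
  shows "(f ^^ i) x \<in> annulus"
  by (induction i) (use assms in auto)

lemma C0_close_funpow:
  assumes f: "continuous_on annulus f" "\<And>x. x \<in> annulus \<Longrightarrow> f x \<in> annulus" and "0 < \<eta>"
  shows "\<exists>\<epsilon>>0. \<forall>g. C0_close \<epsilon> f g \<longrightarrow> (\<forall>x\<in>annulus. dist ((g ^^ i) x) ((f ^^ i) x) < \<eta>)"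
  using assms(3)
proof (induction i arbitrary: \<eta>)
  case 0
  then show ?case by (intro exI[of _ 1]) simp
next
  case (Suc i)
  have "uniformly_continuous_on annulus f"
    by (rule compact_uniformly_continuous[OF f(1) compact_annulus])
  then obtain \<delta> where \<delta>: "\<delta> > 0"
    "\<And>x y. x \<in> annulus \<Longrightarrow> y \<in> annulus \<Longrightarrow> dist y x < \<delta> \<Longrightarrow> dist (f y) (f x) < \<eta> / 2"
    using Suc.prems unfolding uniformly_continuous_on_def by (metis half_gt_zero)
  obtain \<epsilon> where \<epsilon>: "\<epsilon> > 0"
    "\<And>g x. C0_close \<epsilon> f g \<Longrightarrow> x \<in> annulus \<Longrightarrow> dist ((g ^^ i) x) ((f ^^ i) x) < \<delta>"
    using Suc.IH[OF \<delta>(1)] by blast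
  have "dist ((g ^^ Suc i) x) ((f ^^ Suc i) x) < \<eta>"
    if g: "C0_close (min \<epsilon> (\<eta> / 2)) f g" and x: "x \<in> annulus" for g x
  proof -
    have gi: "(g ^^ i) x \<in> annulus" using g x by (intro funpow_in_annulus) (auto simp: C0_close_def)
    have fi: "(f ^^ i) x \<in> annulus" using f(2) x by (rule funpow_in_annulus)
    have "dist (g ((g ^^ i) x)) (f ((g ^^ i) x)) < \<eta> / 2" using g gi by (auto simp: C0_close_def)
    moreover have "dist (f ((g ^^ i) x)) (f ((f ^^ i) x)) < \<eta> / 2"
      using \<epsilon>(2)[OF C0_close_mono[OF g] x] by (intro \<delta>(2) gi fi) simp
    ultimately have "dist (g ((g ^^ i) x)) (f ((f ^^ i) x)) < \<eta> / 2 + \<eta> / 2"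
      using dist_triangle[of "g ((g ^^ i) x)" "f ((f ^^ i) x)" "f ((g ^^ i) x)"] by linarith
    then show ?thesis by simp
  qed
  then show ?case using \<epsilon>(1) Suc.prems by (intro exI[of _ "min \<epsilon> (\<eta> / 2)"]) auto
qed

lemma birkhoff_stable:
  assumes f: "continuous_on annulus f" "\<And>x. x \<in> annulus \<Longrightarrow> f x \<in> annulus"
    and \<phi>: "continuous_on annulus \<phi>" and \<eta>: "0 < \<eta>"
  shows "\<exists>\<epsilon>>0. \<forall>g. C0_close \<epsilon> f g \<longrightarrow> (\<forall>x\<in>annulus. \<bar>birkhoff g \<phi> n x - birkhoff f \<phi> n x\<bar> \<le> \<eta>)"
proof -
  have "uniformly_continuous_on annulus \<phi>"
    by (rule compact_uniformly_continuous[OF \<phi> compact_annulus])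
  then obtain \<delta> where \<delta>: "\<delta> > 0"
    "\<And>x y. x \<in> annulus \<Longrightarrow> y \<in> annulus \<Longrightarrow> dist y x < \<delta> \<Longrightarrow> dist (\<phi> y) (\<phi> x) < \<eta>"
    using \<eta> unfolding uniformly_continuous_on_def by metis
  have "\<exists>\<epsilon>>0. \<forall>i\<in>{..<n}. \<forall>g. C0_close \<epsilon> f g \<longrightarrow> (\<forall>x\<in>annulus. dist ((g ^^ i) x) ((f ^^ i) x) < \<delta>)"
    using C0_close_funpow[OF f \<delta>(1)] by (intro C0_close_finite) auto
  then obtain \<epsilon> where \<epsilon>: "\<epsilon> > 0"
    "\<And>i g x. i < n \<Longrightarrow> C0_close \<epsilon> f g \<Longrightarrow> x \<in> annulus \<Longrightarrow> dist ((g ^^ i) x) ((f ^^ i) x) < \<delta>"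
    by blast
  have "\<bar>birkhoff g \<phi> n x - birkhoff f \<phi> n x\<bar> \<le> \<eta>" if g: "C0_close \<epsilon> f g" and x: "x \<in> annulus" for g x
  proof -
    have "\<bar>\<phi> ((g ^^ i) x) - \<phi> ((f ^^ i) x)\<bar> \<le> \<eta>" if "i < n" for i
    proof -
      have "dist (\<phi> ((g ^^ i) x)) (\<phi> ((f ^^ i) x)) < \<eta>"
        using g x f(2) \<epsilon>(2)[OF that g x]
        by (intro \<delta>(2) funpow_in_annulus) (auto simp: C0_close_def)
      then show ?thesis by (simp add: dist_real_def)
    qed
    then have "(\<Sum>i<n. \<bar>\<phi> ((g ^^ i) x) - \<phi> ((f ^^ i) x)\<bar>) \<le> (\<Sum>i<n. \<eta>)" by (intro sum_mono) auto
    then have "\<bar>(\<Sum>i<n. \<phi> ((g ^^ i) x)) - (\<Sum>i<n. \<phi> ((f ^^ i) x))\<bar> \<le> n * \<eta>"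
      unfolding sum_subtractf[symmetric] by (intro order_trans[OF sum_abs]) simp
    then have "\<bar>(\<Sum>i<n. \<phi> ((g ^^ i) x)) - (\<Sum>i<n. \<phi> ((f ^^ i) x))\<bar> / n \<le> \<eta>"
      using \<eta> by (cases "n = 0") (simp_all add: pos_divide_le_eq mult.commute)
    then show ?thesis by (simp add: birkhoff_def diff_divide_distrib[symmetric] abs_divide)
  qed
  then show ?thesis using \<epsilon>(1) by blast
qed

text \<open>
  Averages of length \<open>n\<close> of nearby maps are uniformly close, so each inequality survives with a
  slightly larger error. For the last condition the set of good points can only grow.
\<close>
lemma oscillates_at_stable:
  assumes f: "continuous_on annulus f" "\<And>x. x \<in> annulus \<Longrightarrow> f x \<in> annulus"
    and \<Phi>: "finite \<Phi>" "\<And>\<phi>. \<phi> \<in> \<Phi> \<Longrightarrow> continuous_on annulus \<phi>"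
    and c: "0 \<le> c" "c \<le> 1" and e: "e < e'" and osc: "oscillates_at f \<Phi> c e n"
  shows "\<exists>\<epsilon>>0. \<forall>g. C0_close \<epsilon> f g \<and> continuous_on annulus g \<longrightarrow> oscillates_at g \<Phi> c e' n"
proof -
  define \<eta> where "\<eta> = (e' - e) / 2"
  have \<eta>: "0 < \<eta>" "e + 2 * \<eta> = e'" using e by (auto simp: \<eta>_def field_simps)
  have chi: "continuous_on annulus chi" unfolding chi_def by (intro continuous_intros)
  have "\<exists>\<epsilon>>0. \<forall>\<phi>\<in>insert chi \<Phi>. \<forall>g. C0_close \<epsilon> f g \<longrightarrow> (\<forall>x\<in>annulus. \<bar>birkhoff g \<phi> n x - birkhoff f \<phi> n x\<bar> \<le> \<eta>)"
    using \<Phi> chi \<eta>(1) by (intro C0_close_finite birkhoff_stable f) auto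
  then obtain \<epsilon> where \<epsilon>: "\<epsilon> > 0"
    "\<And>\<phi> g x. \<phi> \<in> insert chi \<Phi> \<Longrightarrow> C0_close \<epsilon> f g \<Longrightarrow> x \<in> annulus \<Longrightarrow> \<bar>birkhoff g \<phi> n x - birkhoff f \<phi> n x\<bar> \<le> \<eta>"
    by blast
  have "oscillates_at g \<Phi> c e' n" if g: "C0_close \<epsilon> f g" "continuous_on annulus g" for g
    unfolding oscillates_at_def
  proof (intro conjI ballI impI)
    fix \<phi> x y assume a: "\<phi> \<in> \<Phi>" "x \<in> annulus" "y \<in> annulus" "(fst x = 0 \<or> fst x = 1) \<and> fst y = fst x"
    have "\<bar>birkhoff f \<phi> n x - birkhoff f \<phi> n y\<bar> \<le> e"
      using osc a unfolding oscillates_at_def by blast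
    moreover have "\<bar>birkhoff g \<phi> n x - birkhoff f \<phi> n x\<bar> \<le> \<eta>" "\<bar>birkhoff g \<phi> n y - birkhoff f \<phi> n y\<bar> \<le> \<eta>"
      using a g by (auto intro!: \<epsilon>(2))
    ultimately show "\<bar>birkhoff g \<phi> n x - birkhoff g \<phi> n y\<bar> \<le> e'" using \<eta>(2) by linarith
  next
    fix x assume a: "x \<in> annulus"
    have "birkhoff f chi n x \<le> e" using osc a unfolding oscillates_at_def by blast
    moreover have "\<bar>birkhoff g chi n x - birkhoff f chi n x\<bar> \<le> \<eta>" using a g by (auto intro!: \<epsilon>(2))
    ultimately show "birkhoff g chi n x \<le> e'" using \<eta> by linarith
  next
    let ?S = "\<lambda>f e. {x\<in>annulus. \<forall>\<phi>\<in>\<Phi>.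
        \<bar>birkhoff f \<phi> n x - ((1 - c) * birkhoff f \<phi> n (0, 1) + c * birkhoff f \<phi> n (1, 1))\<bar> \<le> e}"
    have "?S f e \<subseteq> ?S g e'"
    proof (intro subsetI CollectI conjI ballI)
      fix x \<phi> assume x: "x \<in> ?S f e"
      then show "x \<in> annulus" by simp
      assume \<phi>: "\<phi> \<in> \<Phi>"
      have 1: "\<bar>birkhoff f \<phi> n x - ((1 - c) * birkhoff f \<phi> n (0, 1) + c * birkhoff f \<phi> n (1, 1))\<bar> \<le> e"
        using x \<phi> by blast
      have 2: "\<bar>birkhoff g \<phi> n x - birkhoff f \<phi> n x\<bar> \<le> \<eta>" using x \<phi> g by (auto intro!: \<epsilon>(2))
      have "\<bar>birkhoff g \<phi> n (0, 1) - birkhoff f \<phi> n (0, 1)\<bar> \<le> \<eta>" "\<bar>birkhoff g \<phi> n (1, 1) - birkhoff f \<phi> n (1, 1)\<bar> \<le> \<eta>"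
        using \<phi> g by (auto intro!: \<epsilon>(2) simp: annulus_iff)
      then have 3: "\<bar>(1 - c) * (birkhoff g \<phi> n (0, 1) - birkhoff f \<phi> n (0, 1))\<bar> \<le> (1 - c) * \<eta>"
        and 4: "\<bar>c * (birkhoff g \<phi> n (1, 1) - birkhoff f \<phi> n (1, 1))\<bar> \<le> c * \<eta>"
        unfolding abs_mult using c by (auto intro!: mult_left_mono)
      have 5: "(1 - c) * \<eta> + c * \<eta> = \<eta>" by (simp add: algebra_simps)
      have "\<bar>u - ((1 - c) * v + c * w)\<bar> \<le> e'"
        if "\<bar>u' - ((1 - c) * v' + c * w')\<bar> \<le> e" "\<bar>u - u'\<bar> \<le> \<eta>" "\<bar>(1 - c) * (v - v')\<bar> \<le> s"
          "\<bar>c * (w - w')\<bar> \<le> s'" "s + s' = \<eta>" for u u' v v' w w' s s'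
        using that \<eta>(2) unfolding right_diff_distrib by linarith
      from this[OF 1 2 3 4 5]
      show "\<bar>birkhoff g \<phi> n x - ((1 - c) * birkhoff g \<phi> n (0, 1) + c * birkhoff g \<phi> n (1, 1))\<bar> \<le> e'" .
    qed
    moreover have "?S g e' \<in> sets annulus_lebesgue"
      unfolding annulus_lebesgue_simps using g \<Phi> by (intro typical_set_measurable) (auto simp: C0_close_def)
    ultimately have "measure annulus_lebesgue (?S f e) \<le> measure annulus_lebesgue (?S g e')"
      by (rule leb.finite_measure_mono)
    moreover have "1 - e \<le> measure annulus_lebesgue (?S f e)"
      using osc unfolding oscillates_at_def by blast
    ultimately show "1 - e' \<le> measure annulus_lebesgue (?S g e')" using e by linarith
  qed
  then show ?thesis using \<epsilon>(1) by blast
qed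

text \<open>
  The strict bound on \<open>e\<close> leaves the room that openness requires.
\<close>
definition oscillating_set :: "enat \<Rightarrow> nat \<Rightarrow> real \<Rightarrow> (pt \<Rightarrow> pt) set" where
  "oscillating_set r N c = {f \<in> Diff_plus r. \<exists>n\<ge>N. 0 < n \<and>
     (\<exists>e < 1 / (real N + 1). oscillates_at f (monoms_upto N) c e n)}"

lemma Diff_plusD:
  assumes "f \<in> Diff_plus r"
  shows "continuous_on annulus f" "x \<in> annulus \<Longrightarrow> f x \<in> annulus"
  using assms by (auto simp: Diff_plus_def Diff_ann_def homeomorphism_def)

lemma openin_oscillating_set:
  assumes c: "0 \<le> c" "c \<le> 1"
  shows "openin (Diff_top r) (oscillating_set r N c)"
proof (rule openin_Diff_topI)
  show "oscillating_set r N c \<subseteq> Diff_plus r" by (auto simp: oscillating_set_def)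
  fix f assume "f \<in> oscillating_set r N c"
  then obtain n e where f: "f \<in> Diff_plus r" and n: "n \<ge> N" "0 < n" and e: "e < 1 / (real N + 1)"
    "oscillates_at f (monoms_upto N) c e n" by (auto simp: oscillating_set_def)
  obtain e' where e': "e < e'" "e' < 1 / (real N + 1)" using e(1) dense by blast
  obtain \<epsilon> where \<epsilon>: "\<epsilon> > 0"
    "\<And>g. C0_close \<epsilon> f g \<Longrightarrow> continuous_on annulus g \<Longrightarrow> oscillates_at g (monoms_upto N) c e' n"
    using oscillates_at_stable[OF Diff_plusD(1)[OF f] Diff_plusD(2)[OF f] finite_monoms_upto[of N]
        monoms_upto_props(1)[of _ N] c e'(1) e(2)] by blast
  have "g \<in> oscillating_set r N c" if "g \<in> Diff_plus r" "\<forall>x\<in>annulus. dist (g x) (f x) < \<epsilon>" for g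
  proof -
    have "C0_close \<epsilon> f g" using that Diff_plusD(2) by (auto simp: C0_close_def)
    then have "oscillates_at g (monoms_upto N) c e' n" using \<epsilon>(2) Diff_plusD(1)[OF that(1)] by blast
    then show ?thesis using that(1) n e'(2) unfolding oscillating_set_def by blast
  qed
  then show "\<exists>\<epsilon>>0. \<forall>g\<in>Diff_plus r. (\<forall>x\<in>annulus. dist (g x) (f x) < \<epsilon>) \<longrightarrow> g \<in> oscillating_set r N c"
    using \<epsilon>(1) by blast
qed

definition generic_maps :: "enat \<Rightarrow> (pt \<Rightarrow> pt) set" where
  "generic_maps r = topspace (AK_space r) \<inter>
     (\<Inter>(N, c)\<in>UNIV \<times> (\<rat> \<inter> {0..1}). oscillating_set r N c)"

lemma baire_generic_generic_maps: "baire_generic (AK_space r) (generic_maps r)"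
  unfolding generic_maps_def
proof (rule baire_generic_Inter)
  show "countable ((UNIV :: nat set) \<times> (\<rat> \<inter> {0..1::real}))"
    by (intro countable_SIGMA countable_Int1 countable_rat) auto
  fix i assume i: "i \<in> (UNIV :: nat set) \<times> (\<rat> \<inter> {0..1::real})"
  then obtain N c where ic: "i = (N, c)" and c: "0 \<le> c" "c \<le> 1" by auto
  show "openin (Diff_top r) (case i of (N, c) \<Rightarrow> oscillating_set r N c)"
    using openin_oscillating_set[OF c] by (simp add: ic)
  fix f W assume f: "f \<in> rotation_conjugates r" and W: "openin (Diff_top r) W" "f \<in> W"
  obtain h k \<alpha> where hk: "Cr_homeo r h k" "f = rot_conj h k \<alpha>" using rotation_conjugatesE[OF f] by blast
  define \<epsilon> where "\<epsilon> = 1 / (real N + 2)"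
  have \<epsilon>: "0 < \<epsilon>" "\<epsilon> < 1 / (real N + 1)" by (auto simp: \<epsilon>_def field_simps)
  have "\<exists>g\<in>rotation_conjugates r. g \<in> W \<and>
      (\<exists>n\<ge>N. 0 < n \<and> oscillates_at g (monoms_upto N) c \<epsilon> n)"
    using monoms_upto_props
    by (intro oscillating_perturbation[OF hk(1) finite_monoms_upto _ _ c \<epsilon>(1) W(1) W(2)[unfolded hk(2)]])
  then obtain g n where g: "g \<in> rotation_conjugates r" "g \<in> W" "n \<ge> N" "0 < n"
    "oscillates_at g (monoms_upto N) c \<epsilon> n"
    by blast
  then have "g \<in> oscillating_set r N c"
    using \<epsilon>(2) rotation_conjugates_subset unfolding oscillating_set_def by blast
  then show "\<exists>g\<in>rotation_conjugates r. g \<in> W \<and> g \<in> (case i of (N, c) \<Rightarrow> oscillating_set r N c)"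
    using g by (auto simp: ic)
qed

section \<open>Measures determined by monomials\<close>

inductive_set polyspan :: "(pt \<Rightarrow> real) set" where
  monom: "monom3 m \<in> polyspan"
| scale: "p \<in> polyspan \<Longrightarrow> (\<lambda>x. r * p x) \<in> polyspan"
| add: "p \<in> polyspan \<Longrightarrow> p' \<in> polyspan \<Longrightarrow> (\<lambda>x. p x + p' x) \<in> polyspan"

lemma polyspan_mult:
  assumes "p \<in> polyspan" "p' \<in> polyspan" shows "(\<lambda>x. p x * p' x) \<in> polyspan"
  using assms
proof (induction p)
  case (monom m)
  from monom show ?case
  proof (induction p')
    case (monom m')
    obtain i j l i' j' l' where m: "m = (i, j, l)" "m' = (i', j', l')" by (cases m, cases m')
    have "(\<lambda>x. monom3 m x * monom3 m' x) = monom3 (i + i', j + j', l + l')"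
      by (rule ext) (simp add: m monom3_def power_add algebra_simps)
    then show ?case using polyspan.monom by metis
  next
    case (scale p r)
    have "(\<lambda>x. monom3 m x * (r * p x)) = (\<lambda>x. r * (monom3 m x * p x))" by (simp add: algebra_simps)
    then show ?case using polyspan.scale[OF scale.IH, of r] by simp
  next
    case (add p p')
    have "(\<lambda>x. monom3 m x * (p x + p' x)) = (\<lambda>x. monom3 m x * p x + monom3 m x * p' x)"
      by (simp add: algebra_simps)
    then show ?case using polyspan.add[OF add.IH] by simp
  qed
next
  case (scale p r)
  have "(\<lambda>x. r * p x * p' x) = (\<lambda>x. r * (p x * p' x))" by (simp add: algebra_simps)
  then show ?case using polyspan.scale[OF scale.IH[OF scale.prems], of r] by simp
next
  case (add p p2)
  have "(\<lambda>x. (p x + p2 x) * p' x) = (\<lambda>x. p x * p' x + p2 x * p' x)" by (simp add: algebra_simps)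
  then show ?case using polyspan.add[OF add.IH(1)[OF add.prems] add.IH(2)[OF add.prems]] by simp
qed

text \<open>
  Since monomials are closed under multiplication, their linear span contains all polynomial
  functions, and the Stone-Weierstrass theorem applies to it.
\<close>
lemma real_polynomial_function_polyspan:
  "real_polynomial_function p \<Longrightarrow> p \<in> polyspan"
proof (induction rule: real_polynomial_function.induct)
  case (linear f)
  have "f x = f (1, 0) * monom3 (1, 0, 0) x + (f (0, 1) * monom3 (0, 1, 0) x + f (0, \<i>) * monom3 (0, 0, 1) x)" for x
  proof -
    interpret bounded_linear f by fact
    have "x = fst x *\<^sub>R (1, 0) + (Re (snd x) *\<^sub>R (0, 1) + Im (snd x) *\<^sub>R (0, \<i>))"
      by (simp add: prod_eq_iff complex_eq_iff)
    then have "f x = f (fst x *\<^sub>R (1, 0) + (Re (snd x) *\<^sub>R (0, 1) + Im (snd x) *\<^sub>R (0, \<i>)))" by (rule arg_cong)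
    then show ?thesis unfolding add scaleR by (simp add: monom3_def)
  qed
  then have "f = (\<lambda>x. f (1, 0) * monom3 (1, 0, 0) x + (f (0, 1) * monom3 (0, 1, 0) x + f (0, \<i>) * monom3 (0, 0, 1) x))"
    by (rule ext)
  moreover have "(\<lambda>x. f (1, 0) * monom3 (1, 0, 0) x + (f (0, 1) * monom3 (0, 1, 0) x + f (0, \<i>) * monom3 (0, 0, 1) x))
      \<in> polyspan"
    by (intro polyspan.add polyspan.scale polyspan.monom)
  ultimately show ?case by (rule ssubst[where P = "\<lambda>g. g \<in> polyspan"])
next
  case (const c)
  have "(\<lambda>x. c) = (\<lambda>x. c * monom3 (0, 0, 0) x)" by (simp add: monom3_def)
  then show ?case
    by (rule ssubst[where P = "\<lambda>g. g \<in> polyspan"]) (intro polyspan.scale polyspan.monom)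
qed (auto intro: polyspan.add polyspan_mult)

lemma polyspan_approx:
  assumes "continuous_on annulus \<phi>" "0 < \<epsilon>"
  obtains p where "p \<in> polyspan" "\<And>x. x \<in> annulus \<Longrightarrow> \<bar>\<phi> x - p x\<bar> < \<epsilon>"
  using Stone_Weierstrass_real_polynomial_function[OF compact_annulus assms] real_polynomial_function_polyspan
  by metis

lemma continuous_on_polyspan: "p \<in> polyspan \<Longrightarrow> continuous_on S p"
  by (induction rule: polyspan.induct) (auto intro: continuous_on_monom3 continuous_intros)

locale annulus_prob = prob_space \<mu> for \<mu> :: "pt measure" +
  assumes sets_\<mu>: "sets \<mu> = sets annulus_borel"
begin

lemma space_\<mu>: "space \<mu> = annulus"
  using sets_eq_imp_space_eq[OF sets_\<mu>] by simp

lemma meas: "continuous_on annulus f \<Longrightarrow> f \<in> borel_measurable \<mu>" for f :: "pt \<Rightarrow> 'b::topological_space"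
  using borel_measurable_annulus[of f] by (simp add: measurable_cong_sets[OF sets_\<mu> refl])

lemma int: "continuous_on annulus f \<Longrightarrow> integrable \<mu> f" for f :: "pt \<Rightarrow> real"
proof -
  assume f: "continuous_on annulus f"
  have "bounded (f ` annulus)" by (intro compact_imp_bounded compact_continuous_image f compact_annulus)
  then obtain B where "\<And>x. x \<in> annulus \<Longrightarrow> norm (f x) \<le> B" by (auto simp: bounded_iff)
  then show ?thesis by (intro integrable_const_bound[of _ B] AE_I2 meas f) (auto simp: space_\<mu>)
qed

lemma int_close:
  assumes "continuous_on annulus f" "continuous_on annulus g" "\<And>x. x \<in> annulus \<Longrightarrow> \<bar>f x - g x\<bar> \<le> e"
  shows "\<bar>integral\<^sup>L \<mu> f - integral\<^sup>L \<mu> (g :: pt \<Rightarrow> real)\<bar> \<le> e"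
proof -
  have "\<bar>integral\<^sup>L \<mu> f - integral\<^sup>L \<mu> g\<bar> = \<bar>integral\<^sup>L \<mu> (\<lambda>x. f x - g x)\<bar>"
    using assms by (simp add: int)
  also have "\<dots> \<le> integral\<^sup>L \<mu> (\<lambda>x. \<bar>f x - g x\<bar>)" by (rule integral_abs_bound)
  also have "\<dots> \<le> integral\<^sup>L \<mu> (\<lambda>x. e)"
    using assms by (intro integral_mono int continuous_intros) (auto simp: space_\<mu> intro!: int continuous_intros)
  also have "\<dots> = e" by (simp add: prob_space)
  finally show ?thesis .
qed

end

text \<open>
  Convergence on monomials passes to their linear span and from there to uniform limits.
\<close>
lemma weak_limit_from_monomials:
  fixes A :: "nat \<Rightarrow> (pt \<Rightarrow> real) \<Rightarrow> real"
  assumes "annulus_prob \<mu>"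
    and lin: "\<And>j p p'. A j (\<lambda>x. p x + p' x) = A j p + A j p'" "\<And>j r p. A j (\<lambda>x. r * p x) = r * A j p"
    and close: "\<And>j \<phi> p e. (\<And>x. x \<in> annulus \<Longrightarrow> \<bar>\<phi> x - p x\<bar> < e) \<Longrightarrow> continuous_on annulus \<phi> \<Longrightarrow>
      continuous_on annulus p \<Longrightarrow> \<bar>A j \<phi> - A j p\<bar> \<le> e"
    and mono: "\<And>m. (\<lambda>j. A j (monom3 m)) \<longlonglongrightarrow> integral\<^sup>L \<mu> (monom3 m)"
    and \<phi>: "continuous_on annulus \<phi>"
  shows "(\<lambda>j. A j \<phi>) \<longlonglongrightarrow> integral\<^sup>L \<mu> \<phi>"
proof -
  interpret annulus_prob \<mu> by fact
  have poly: "(\<lambda>j. A j p) \<longlonglongrightarrow> integral\<^sup>L \<mu> p" if "p \<in> polyspan" for p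
    using that
  proof induction
    case (monom m)
    show ?case by (rule mono)
  next
    case (scale p r)
    then show ?case unfolding lin by (simp add: tendsto_mult_left)
  next
    case (add p p')
    then show ?case unfolding lin
      by (subst Bochner_Integration.integral_add) (auto intro!: tendsto_add int continuous_on_polyspan)
  qed
  show ?thesis
  proof (rule LIMSEQ_I)
    fix e :: real assume e: "0 < e"
    then have e4: "0 < e / 4" by simp
    obtain p where p: "p \<in> polyspan" "\<And>x. x \<in> annulus \<Longrightarrow> \<bar>\<phi> x - p x\<bar> < e / 4"
      using polyspan_approx[OF \<phi> e4] by blast
    note pc = continuous_on_polyspan[OF p(1), of annulus]
    have 1: "\<bar>integral\<^sup>L \<mu> \<phi> - integral\<^sup>L \<mu> p\<bar> \<le> e / 4"
      using p(2) by (intro int_close \<phi> pc) (auto simp: less_imp_le)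
    obtain N where N: "\<And>j. j \<ge> N \<Longrightarrow> \<bar>A j p - integral\<^sup>L \<mu> p\<bar> < e / 4"
      using LIMSEQ_D[OF poly[OF p(1)] e4] by auto
    have "norm (A j \<phi> - integral\<^sup>L \<mu> \<phi>) < e" if "j \<ge> N" for j
    proof -
      have "\<bar>A j \<phi> - A j p\<bar> \<le> e / 4" using p(2) \<phi> pc by (rule close)
      then show ?thesis using 1 N[OF that] e unfolding real_norm_def by linarith
    qed
    then show "\<exists>N. \<forall>j\<ge>N. norm (A j \<phi> - integral\<^sup>L \<mu> \<phi>) < e" by blast
  qed
qed

text \<open>
  The functions \<open>max 0 (1 - n d(x, C))\<close> decrease to the indicator of a closed set \<open>C\<close>, and closed sets
  generate the Borel sets.
\<close>
lemma annulus_measure_eqI: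
  assumes "annulus_prob \<mu>" "annulus_prob \<nu>"
    and eq: "\<And>\<phi>. continuous_on annulus \<phi> \<Longrightarrow> integral\<^sup>L \<mu> \<phi> = integral\<^sup>L \<nu> (\<phi> :: pt \<Rightarrow> real)"
  shows "\<mu> = \<nu>"
proof -
  interpret M: annulus_prob \<mu> by fact
  interpret N: annulus_prob \<nu> by fact
  have closed_eq: "measure \<mu> (C \<inter> annulus) = measure \<nu> (C \<inter> annulus)" if C: "closed C" for C
  proof (cases "C = {}")
    case False
    define \<phi> where "\<phi> = (\<lambda>(n::nat) x. max 0 (1 - real n * infdist x C))"
    have \<phi>c: "continuous_on annulus (\<phi> n)" for n
      unfolding \<phi>_def by (intro continuous_intros)
    have lim: "(\<lambda>n. integral\<^sup>L \<rho> (\<phi> n)) \<longlonglongrightarrow> measure \<rho> (C \<inter> annulus)" if "annulus_prob \<rho>" for \<rho>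
    proof -
      interpret annulus_prob \<rho> by fact
      have Cs: "C \<inter> annulus \<in> sets \<rho>"
        unfolding sets_\<mu> annulus_borel_def sets_restrict_space using C by auto
      have "(\<lambda>n. integral\<^sup>L \<rho> (\<phi> n)) \<longlonglongrightarrow> integral\<^sup>L \<rho> (indicator (C \<inter> annulus))"
      proof (rule integral_dominated_convergence[where w = "\<lambda>_. 1"])
        show "AE x in \<rho>. (\<lambda>n. \<phi> n x) \<longlonglongrightarrow> indicator (C \<inter> annulus) x"
        proof (rule AE_I2)
          fix x assume x: "x \<in> space \<rho>"
          show "(\<lambda>n. \<phi> n x) \<longlonglongrightarrow> indicator (C \<inter> annulus) x"
          proof (cases "x \<in> C")
            case True
            then show ?thesis using x by (simp add: \<phi>_def space_\<mu>)
          next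
            case xC: False
            then have pos: "0 < infdist x C"
              using C False infdist_nonneg[of x C] in_closed_iff_infdist_zero[OF C False, of x] by linarith
            obtain n0 :: nat where n0: "1 / infdist x C < n0" using reals_Archimedean2 by blast
            have "\<phi> n x = 0" if "n \<ge> n0" for n
            proof -
              have "1 / infdist x C \<le> n" using n0 that by linarith
              then have "1 \<le> real n * infdist x C" using pos by (simp add: divide_le_eq)
              then show ?thesis by (simp add: \<phi>_def)
            qed
            then have "\<forall>\<^sub>F n in sequentially. \<phi> n x = indicator (C \<inter> annulus) x"
              unfolding eventually_sequentially using xC by auto
            then show ?thesis by (rule tendsto_eventually)
          qed
        qed
        show "AE x in \<rho>. norm (\<phi> n x) \<le> 1" for n
          by (rule AE_I2) (auto simp: \<phi>_def infdist_nonneg)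
      qed (use Cs \<phi>c in \<open>auto intro: meas\<close>)
      then show ?thesis using Cs by simp
    qed
    have "(\<lambda>n. integral\<^sup>L \<mu> (\<phi> n)) = (\<lambda>n. integral\<^sup>L \<nu> (\<phi> n))" using eq \<phi>c by auto
    then show ?thesis using lim[OF assms(1)] lim[OF assms(2)] LIMSEQ_unique by metis
  qed simp
  have id: "(\<lambda>x. x) \<in> measurable \<rho> borel" if "annulus_prob \<rho>" for \<rho>
    using annulus_prob.meas[OF that continuous_on_id] .
  have dist: "distr \<mu> borel (\<lambda>x. x) = distr \<nu> borel (\<lambda>x. x)"
  proof (rule measure_eqI_generator_eq[where E = "Collect closed" and \<Omega> = UNIV and A = "\<lambda>_. UNIV"])
    show "Int_stable (Collect closed :: pt set set)" by (auto simp: Int_stable_def)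
    fix C :: "pt set" assume "C \<in> Collect closed"
    then have C: "closed C" "C \<in> sets borel" by auto
    have "emeasure (distr \<rho> borel (\<lambda>x. x)) C = ennreal (measure \<rho> (C \<inter> annulus))" if "annulus_prob \<rho>" for \<rho>
    proof -
      interpret annulus_prob \<rho> by fact
      show ?thesis using C(2) id[OF that]
        by (simp add: emeasure_distr space_\<mu> emeasure_eq_measure)
    qed
    then show "emeasure (distr \<mu> borel (\<lambda>x. x)) C = emeasure (distr \<nu> borel (\<lambda>x. x)) C"
      using assms closed_eq[OF C(1)] by simp
  next
    show "emeasure (distr \<mu> borel (\<lambda>x. x)) UNIV \<noteq> \<infinity>"
      using id[OF assms(1)] by (simp add: emeasure_distr M.emeasure_eq_measure)
  qed (auto simp: borel_eq_closed)
  show ?thesis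
  proof (rule measure_eqI)
    show "sets \<mu> = sets \<nu>" by (simp add: M.sets_\<mu> N.sets_\<mu>)
    fix A assume "A \<in> sets \<mu>"
    then obtain B where B: "A = B \<inter> annulus" "B \<in> sets borel"
      unfolding M.sets_\<mu> annulus_borel_def sets_restrict_space by auto
    have "emeasure (distr \<mu> borel (\<lambda>x. x)) B = emeasure (distr \<nu> borel (\<lambda>x. x)) B" by (simp only: dist)
    then show "emeasure \<mu> A = emeasure \<nu> A"
      using B id[OF assms(1)] id[OF assms(2)] by (simp add: emeasure_distr M.space_\<mu> N.space_\<mu>)
  qed
qed

lemma birkhoff_add: "birkhoff f (\<lambda>x. p x + p' x) n x = birkhoff f p n x + birkhoff f p' n x"
  by (simp add: birkhoff_def sum.distrib add_divide_distrib)

lemma birkhoff_scale: "birkhoff f (\<lambda>x. r * p x) n x = r * birkhoff f p n x"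
  by (simp add: birkhoff_def sum_distrib_left)

lemma birkhoff_close:
  assumes "\<And>x. x \<in> annulus \<Longrightarrow> f x \<in> annulus" "x \<in> annulus"
    and "\<And>x. x \<in> annulus \<Longrightarrow> \<bar>p x - p' x\<bar> \<le> e" "0 \<le> e"
  shows "\<bar>birkhoff f p n x - birkhoff f p' n x\<bar> \<le> e"
proof -
  have "\<bar>(\<Sum>i<n. p ((f ^^ i) x)) - (\<Sum>i<n. p' ((f ^^ i) x))\<bar> \<le> (\<Sum>i<n. e)"
    unfolding sum_subtractf[symmetric]
    by (rule order_trans[OF sum_abs sum_mono]) (intro assms(3) funpow_in_annulus assms)
  then have "\<bar>(\<Sum>i<n. p ((f ^^ i) x)) - (\<Sum>i<n. p' ((f ^^ i) x))\<bar> / n \<le> e"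
    using assms(4) by (cases "n = 0") (simp_all add: pos_divide_le_eq mult.commute)
  then show ?thesis by (simp add: birkhoff_def diff_divide_distrib[symmetric] abs_divide)
qed

lemma integral_empirical:
  assumes f: "\<And>x. x \<in> annulus \<Longrightarrow> f x \<in> annulus" "x \<in> annulus" and \<phi>: "continuous_on annulus \<phi>"
  shows "integral\<^sup>L (empirical_measure f x n) \<phi> = birkhoff f \<phi> n x"
proof -
  have "(\<lambda>i. (f ^^ i) x) \<in> measurable (uniform_count_measure {..<n}) annulus_borel"
    using funpow_in_annulus[OF f] by (simp add: measurable_def space_uniform_count_measure sets_uniform_count_measure)
  then have "integral\<^sup>L (empirical_measure f x n) \<phi> = integral\<^sup>L (uniform_count_measure {..<n}) (\<lambda>i. \<phi> ((f ^^ i) x))"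
    unfolding empirical_measure_def by (rule integral_distr[OF _ borel_measurable_annulus[OF \<phi>]])
  also have "\<dots> = birkhoff f \<phi> n x" by (simp add: integral_uniform_count_measure birkhoff_def)
  finally show ?thesis .
qed

section \<open>Invariant measures of generic maps\<close>

lemma boundary_component_eq: "s = 0 \<or> s = 1 \<Longrightarrow> boundary_component s = {x\<in>annulus. fst x = s}"
  by (auto simp: boundary_component_def annulus_def)

lemma boundary_component_sets: "s = 0 \<or> s = 1 \<Longrightarrow> boundary_component s \<in> sets annulus_borel"
proof -
  assume s: "s = 0 \<or> s = 1"
  have [measurable]: "fst \<in> borel_measurable annulus_borel"
    by (intro borel_measurable_annulus continuous_intros)
  have "{x\<in>space annulus_borel. fst x = s} \<in> sets annulus_borel" by measurable
  then show ?thesis by (simp add: boundary_component_eq[OF s])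
qed

text \<open>
  All that is used about a generic map from here on. The third assumption says that both boundary
  circles and the interior are preserved.
\<close>
locale generic_map =
  fixes f :: "pt \<Rightarrow> pt"
  assumes f_cont: "continuous_on annulus f" and f_in: "\<And>x. x \<in> annulus \<Longrightarrow> f x \<in> annulus"
    and f_bd: "\<And>x s. x \<in> annulus \<Longrightarrow> s = 0 \<or> s = 1 \<Longrightarrow> fst (f x) = s \<longleftrightarrow> fst x = s"
    and osc: "\<And>N c. c \<in> \<rat> \<Longrightarrow> 0 \<le> c \<Longrightarrow> c \<le> 1 \<Longrightarrow> \<exists>n\<ge>N. 0 < n \<and>
      (\<exists>e < 1 / (real N + 1). oscillates_at f (monoms_upto N) c e n)"
begin

lemma f_meas: "f \<in> measurable annulus_borel annulus_borel"
proof -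
  have "f \<in> measurable annulus_borel borel" by (rule borel_measurable_annulus[OF f_cont])
  then show ?thesis
    unfolding annulus_borel_def using f_in
    by (intro measurable_restrict_space2) (auto simp: space_restrict_space)
qed

lemma f_comp: "continuous_on annulus \<phi> \<Longrightarrow> continuous_on annulus (\<lambda>x. \<phi> (f x))"
  by (rule continuous_on_compose2[OF _ f_cont]) (use f_in in auto)

lemma invariantD:
  assumes "\<mu> \<in> invariant_measures f"
  shows "annulus_prob \<mu>" "distr \<mu> \<mu> f = \<mu>"
  using assms by (auto simp: invariant_measures_def annulus_prob_def annulus_prob_axioms_def)

lemma integral_birkhoff:
  assumes \<mu>: "\<mu> \<in> invariant_measures f" and \<phi>: "continuous_on annulus \<phi>" and n: "0 < n"
  shows "integral\<^sup>L \<mu> (birkhoff f \<phi> n) = integral\<^sup>L \<mu> \<phi>"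
proof -
  interpret annulus_prob \<mu> by (rule invariantD[OF \<mu>])
  have fm: "f \<in> measurable \<mu> \<mu>" using f_meas by (simp add: measurable_cong_sets[OF sets_\<mu> sets_\<mu>])
  have ci: "continuous_on annulus (\<lambda>x. \<phi> ((f ^^ i) x))" for i
  proof (induction i)
    case (Suc i)
    have "continuous_on annulus (\<lambda>x. \<phi> ((f ^^ i) (f x)))" by (rule f_comp[OF Suc])
    then show ?case by (simp add: funpow_swap1)
  qed (simp add: \<phi>)
  have "integral\<^sup>L \<mu> (\<lambda>x. \<phi> ((f ^^ i) x)) = integral\<^sup>L \<mu> \<phi>" for i
  proof (induction i)
    case (Suc i)
    have "integral\<^sup>L \<mu> (\<lambda>x. \<phi> ((f ^^ Suc i) x)) = integral\<^sup>L \<mu> (\<lambda>x. \<phi> ((f ^^ i) (f x)))"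
      by (simp add: funpow_swap1)
    also have "\<dots> = integral\<^sup>L (distr \<mu> \<mu> f) (\<lambda>x. \<phi> ((f ^^ i) x))"
      by (rule integral_distr[OF fm meas[OF ci], symmetric])
    also have "\<dots> = integral\<^sup>L \<mu> \<phi>" using Suc by (simp add: invariantD(2)[OF \<mu>])
    finally show ?case .
  qed simp
  then have "(\<Sum>i<n. integral\<^sup>L \<mu> (\<lambda>x. \<phi> ((f ^^ i) x))) = n * integral\<^sup>L \<mu> \<phi>" by simp
  moreover have "integral\<^sup>L \<mu> (birkhoff f \<phi> n) = (\<Sum>i<n. integral\<^sup>L \<mu> (\<lambda>x. \<phi> ((f ^^ i) x))) / n"
    unfolding birkhoff_def[abs_def] using ci int by (simp add: Bochner_Integration.integral_sum)
  ultimately show ?thesis using n by simp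
qed

text \<open>
  The integral of \<open>chi\<close> equals the integral of its Birkhoff averages, which are uniformly small.
\<close>
lemma AE_boundary:
  assumes \<mu>: "\<mu> \<in> invariant_measures f"
  shows "AE x in \<mu>. fst x = 0 \<or> fst x = 1"
proof -
  interpret annulus_prob \<mu> by (rule invariantD[OF \<mu>])
  have chi: "continuous_on annulus chi" unfolding chi_def by (intro continuous_intros)
  have "integral\<^sup>L \<mu> chi \<le> 1 / (real N + 1)" for N
  proof -
    obtain n e where n: "0 < n" "e < 1 / (real N + 1)" "oscillates_at f (monoms_upto N) 0 e n"
      using osc[of 0 N] by auto
    have "integral\<^sup>L \<mu> (birkhoff f chi n) \<le> integral\<^sup>L \<mu> (\<lambda>x. e)"
      using n(3) unfolding oscillates_at_def
      by (intro integral_mono int continuous_on_birkhoff f_cont f_in chi continuous_intros) (auto simp: space_\<mu>)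
    then show ?thesis using n(2) by (simp add: integral_birkhoff[OF \<mu> chi n(1)] prob_space)
  qed
  then have "integral\<^sup>L \<mu> chi \<le> 0"
    using LIMSEQ_le_const[OF LIMSEQ_inverse_real_of_nat, of "integral\<^sup>L \<mu> chi"]
    by (auto simp: inverse_eq_divide add.commute)
  moreover have "0 \<le> integral\<^sup>L \<mu> chi"
    by (rule integral_nonneg_AE) (auto intro!: AE_I2 chi_bounds simp: space_\<mu>)
  ultimately have "integral\<^sup>L \<mu> chi = 0" by simp
  moreover have "AE x in \<mu>. 0 \<le> chi x" by (rule AE_I2) (simp add: space_\<mu> chi_bounds)
  ultimately have "AE x in \<mu>. chi x = 0"
    using integral_nonneg_eq_0_iff_AE[OF int[OF chi]] by blast
  then show ?thesis by eventually_elim (auto simp: chi_def)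
qed

lemma measure_boundary_sum:
  assumes \<mu>: "\<mu> \<in> invariant_measures f"
  shows "measure \<mu> (boundary_component 0) = 1 - measure \<mu> (boundary_component 1)"
proof -
  interpret annulus_prob \<mu> by (rule invariantD[OF \<mu>])
  have B: "boundary_component 0 \<in> sets \<mu>" "boundary_component 1 \<in> sets \<mu>"
    using boundary_component_sets by (simp_all add: sets_\<mu>)
  have "measure \<mu> (boundary_component 0 \<union> boundary_component 1) = 1"
  proof (subst prob_eq_1)
    show "boundary_component 0 \<union> boundary_component 1 \<in> sets \<mu>" using B by blast
    show "AE x in \<mu>. x \<in> boundary_component 0 \<union> boundary_component 1"
      using AE_boundary[OF \<mu>] AE_space by eventually_elim (auto simp: boundary_component_eq space_\<mu>)
  qed
  moreover have "boundary_component 0 \<inter> boundary_component 1 = {}" by (auto simp: boundary_component_def)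
  ultimately show ?thesis using finite_measure_Union[OF B] by simp
qed

text \<open>
  Integrate the Birkhoff average instead of \<open>\<phi>\<close>: on the boundary, where \<open>\<mu>\<close> lives, it is almost
  equal to one of the two constants.
\<close>
lemma integral_approx:
  assumes \<mu>: "\<mu> \<in> invariant_measures f" and \<phi>: "\<phi> \<in> \<Phi>" "continuous_on annulus \<phi>" and n: "0 < n"
    and o: "oscillates_at f \<Phi> c e n"
  shows "\<bar>integral\<^sup>L \<mu> \<phi> - ((1 - measure \<mu> (boundary_component 1)) * birkhoff f \<phi> n (0, 1)
    + measure \<mu> (boundary_component 1) * birkhoff f \<phi> n (1, 1))\<bar> \<le> e"
proof -
  interpret annulus_prob \<mu> by (rule invariantD[OF \<mu>])
  have B: "boundary_component 0 \<in> sets \<mu>" "boundary_component 1 \<in> sets \<mu>"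
    using boundary_component_sets by (simp_all add: sets_\<mu>)
  let ?h = "\<lambda>x. indicator (boundary_component 0) x * birkhoff f \<phi> n (0, 1) + indicator (boundary_component 1) x * birkhoff f \<phi> n (1, 1)"
  have bc: "continuous_on annulus (birkhoff f \<phi> n)" by (intro continuous_on_birkhoff f_cont f_in \<phi>(2))
  have ih: "integrable \<mu> ?h" using B by (intro Bochner_Integration.integrable_add integrable_mult_left)
      (auto intro!: integrable_real_indicator simp: emeasure_eq_measure)
  have "AE x in \<mu>. \<bar>birkhoff f \<phi> n x - ?h x\<bar> \<le> e"
    using AE_boundary[OF \<mu>] AE_space
  proof eventually_elim
    case (elim x)
    then have x: "x \<in> annulus" "fst x = 0 \<or> fst x = 1" by (auto simp: space_\<mu>)
    have "(0, 1) \<in> annulus" "(1, 1) \<in> annulus" by (auto simp: annulus_iff)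
    then have "\<bar>birkhoff f \<phi> n x - birkhoff f \<phi> n (fst x, 1)\<bar> \<le> e"
      using o \<phi>(1) x unfolding oscillates_at_def by fastforce
    then show ?case using x by (auto simp: boundary_component_eq indicator_def)
  qed
  then have "integral\<^sup>L \<mu> (\<lambda>x. \<bar>birkhoff f \<phi> n x - ?h x\<bar>) \<le> integral\<^sup>L \<mu> (\<lambda>x. e)"
    using ih int[OF bc] by (intro integral_mono_AE) auto
  then have "integral\<^sup>L \<mu> (\<lambda>x. \<bar>birkhoff f \<phi> n x - ?h x\<bar>) \<le> e" by (simp add: prob_space)
  moreover have "\<bar>integral\<^sup>L \<mu> (\<lambda>x. birkhoff f \<phi> n x - ?h x)\<bar> \<le> integral\<^sup>L \<mu> (\<lambda>x. \<bar>birkhoff f \<phi> n x - ?h x\<bar>)"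
    by (rule integral_abs_bound)
  moreover have "integral\<^sup>L \<mu> (\<lambda>x. birkhoff f \<phi> n x - ?h x) = integral\<^sup>L \<mu> \<phi> - integral\<^sup>L \<mu> ?h"
    using ih int[OF bc] by (subst Bochner_Integration.integral_diff) (auto simp: integral_birkhoff[OF \<mu> \<phi>(2) n])
  moreover have "integral\<^sup>L \<mu> ?h = measure \<mu> (boundary_component 0) * birkhoff f \<phi> n (0, 1)
      + measure \<mu> (boundary_component 1) * birkhoff f \<phi> n (1, 1)"
    using B by (subst Bochner_Integration.integral_add)
      (auto intro!: integrable_mult_left integrable_real_indicator simp: emeasure_eq_measure)
  ultimately show ?thesis unfolding measure_boundary_sum[OF \<mu>] by linarith
qed

text \<open>
  By \<open>integral_approx\<close> both integrals of a monomial are close to the same number.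
\<close>
lemma invariant_unique:
  assumes \<mu>: "\<mu> \<in> invariant_measures f" and \<nu>: "\<nu> \<in> invariant_measures f"
    and eq: "measure \<mu> (boundary_component 1) = measure \<nu> (boundary_component 1)"
  shows "\<mu> = \<nu>"
proof (rule annulus_measure_eqI)
  show M: "annulus_prob \<mu>" and N: "annulus_prob \<nu>" by (rule invariantD(1)[OF \<mu>] invariantD(1)[OF \<nu>])+
  interpret N: annulus_prob \<nu> by (rule N)
  have mono: "integral\<^sup>L \<mu> (monom3 m) = integral\<^sup>L \<nu> (monom3 m)" for m
  proof -
    obtain i j l where m: "m = (i, j, l)" by (cases m)
    have b: "\<bar>integral\<^sup>L \<mu> (monom3 m) - integral\<^sup>L \<nu> (monom3 m)\<bar> \<le> 2 * (1 / (real k + 1))" for k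
    proof -
      define N where "N = k + i + j + l"
      have mem: "monom3 m \<in> monoms_upto N" unfolding m N_def by (rule monom3_in_monoms_upto) auto
      obtain n e where n: "0 < n" "e < 1 / (real N + 1)" "oscillates_at f (monoms_upto N) 0 e n"
        using osc[of 0 N] by auto
      have "\<bar>u - v\<bar> \<le> e + e" if "\<bar>u - w\<bar> \<le> e" "\<bar>v - w\<bar> \<le> e" for u v w :: real using that by linarith
      from this[OF integral_approx[OF \<mu> mem continuous_on_monom3 n(1,3)]
          integral_approx[OF \<nu> mem continuous_on_monom3 n(1,3), folded eq]]
      have "\<bar>integral\<^sup>L \<mu> (monom3 m) - integral\<^sup>L \<nu> (monom3 m)\<bar> \<le> e + e" .
      moreover have "1 / (real N + 1) \<le> 1 / (real k + 1)" by (intro divide_left_mono) (auto simp: N_def)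
      ultimately show ?thesis using n(2) by linarith
    qed
    have "\<bar>integral\<^sup>L \<mu> (monom3 m) - integral\<^sup>L \<nu> (monom3 m)\<bar> \<le> 2 * 0"
    proof (rule LIMSEQ_le_const)
      show "(\<lambda>k. 2 * (1 / (real k + 1))) \<longlonglongrightarrow> 2 * 0"
        using LIMSEQ_inverse_real_of_nat by (intro tendsto_mult_left) (simp add: inverse_eq_divide add.commute)
    qed (use b in blast)
    then show ?thesis by simp
  qed
  fix \<phi> :: "pt \<Rightarrow> real" assume \<phi>: "continuous_on annulus \<phi>"
  interpret M: annulus_prob \<mu> by (rule M)
  have poly: "integral\<^sup>L \<mu> p = integral\<^sup>L \<nu> p" if "p \<in> polyspan" for p
    using that
  proof induction
    case (add p p')
    then show ?case by (simp add: M.int N.int continuous_on_polyspan)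
  qed (simp_all add: mono)
  have "\<bar>integral\<^sup>L \<mu> \<phi> - integral\<^sup>L \<nu> \<phi>\<bar> \<le> 0 + e" if e: "0 < e" for e
  proof -
    have e2: "0 < e / 2" using e by simp
    obtain p where p: "p \<in> polyspan" "\<And>x. x \<in> annulus \<Longrightarrow> \<bar>\<phi> x - p x\<bar> < e / 2"
      using polyspan_approx[OF \<phi> e2] by blast
    have "\<bar>integral\<^sup>L \<mu> \<phi> - integral\<^sup>L \<mu> p\<bar> \<le> e / 2" "\<bar>integral\<^sup>L \<nu> \<phi> - integral\<^sup>L \<nu> p\<bar> \<le> e / 2"
      by (intro M.int_close N.int_close \<phi> continuous_on_polyspan p(1) less_imp_le[OF p(2)]; assumption)+
    then show ?thesis using poly[OF p(1)] by linarith
  qed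
  then have "\<bar>integral\<^sup>L \<mu> \<phi> - integral\<^sup>L \<nu> \<phi>\<bar> \<le> 0" by (rule field_le_epsilon)
  then show "integral\<^sup>L \<mu> \<phi> = integral\<^sup>L \<nu> \<phi>" by simp
qed

lemma funpow_boundary: "x \<in> annulus \<Longrightarrow> fst x = s \<Longrightarrow> s = 0 \<or> s = 1 \<Longrightarrow> fst ((f ^^ i) x) = s"
  by (induction i) (auto simp: f_bd funpow_in_annulus[OF f_in])

text \<open>
  Krylov-Bogoliubov: the empirical measures of a point of the circle, written in the angle
  coordinate, are supported in \<open>[0,1]\<close>. Helly's selection theorem gives a weak limit on the real
  line, whose image on the circle is invariant, as shifting an orbit of length \<open>n\<close> by one step
  changes its averages by at most a constant over \<open>n\<close>.
\<close>
lemma invariant_on_boundary: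
  assumes s: "s = 0 \<or> s = 1"
  shows "\<exists>\<mu>\<in>invariant_measures f. measure \<mu> (boundary_component s) = 1"
proof -
  define x where "x = (s, 1 :: complex)"
  have x: "x \<in> annulus" "fst x = s" using s by (auto simp: x_def annulus_iff)
  have ex: "\<exists>t. (f ^^ i) x = ann_proj (s, t) \<and> 0 \<le> t \<and> t < 1" for i
  proof -
    obtain s' t where t: "(f ^^ i) x = ann_proj (s', t)" "0 \<le> t" "t < 1"
      by (rule ann_proj_surj[OF funpow_in_annulus[of f x i, OF f_in x(1)]])
    moreover have "s' = s" using funpow_boundary[OF x s, of i] t(1) by (simp add: ann_proj_def)
    ultimately show ?thesis by blast
  qed
  obtain t where "\<forall>i. (f ^^ i) x = ann_proj (s, t i) \<and> 0 \<le> t i \<and> t i < 1"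
    using choice[OF allI[OF ex]] by (rule exE)
  then have t: "\<And>i. (f ^^ i) x = ann_proj (s, t i)" "\<And>i. 0 \<le> t i" "\<And>i. t i < 1" by simp_all
  define M where "M = (\<lambda>n. distr (uniform_count_measure {..<Suc n}) borel t)"
  have tm: "t \<in> measurable (uniform_count_measure {..<Suc n}) borel" for n
    by (simp add: measurable_def space_uniform_count_measure sets_uniform_count_measure)
  have pM: "real_distribution (M n)" for n
  proof -
    have "prob_space (uniform_count_measure {..<Suc n})" by (rule prob_space_uniform_count_measure) auto
    then have "prob_space (M n)" unfolding M_def by (rule prob_space.prob_space_distr[OF _ tm])
    then show ?thesis by (simp add: real_distribution_def real_distribution_axioms_def M_def)
  qed
  have "tight M"
    unfolding tight_def
  proof (intro conjI allI impI pM)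
    fix \<epsilon> :: real assume "0 < \<epsilon>"
    have "measure (M n) {-1<..1} = 1" for n
    proof -
      have "measure (M n) {-1<..1} = measure (uniform_count_measure {..<Suc n}) (t -` {-1<..1} \<inter> {..<Suc n})"
        unfolding M_def by (subst measure_distr[OF tm]) (auto simp: space_uniform_count_measure)
      also have "t -` {-1<..1} \<inter> {..<Suc n} = {..<Suc n}"
      proof -
        have "- 1 < t i \<and> t i \<le> 1" for i using t(2)[of i] t(3)[of i] by linarith
        then show ?thesis by auto
      qed
      finally show ?thesis by (simp add: measure_uniform_count_measure)
    qed
    then show "\<exists>a b::real. a < b \<and> (\<forall>n. 1 - \<epsilon> < measure (M n) {a<..b})"
      using \<open>0 < \<epsilon>\<close> by (intro exI[of _ "-1"] exI[of _ 1]) auto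
  qed
  from tight_imp_convergent_subsubsequence[OF this strict_mono_id]
  obtain \<rho> L where \<rho>: "strict_mono (\<rho> :: nat \<Rightarrow> nat)" and L: "real_distribution L"
    and conv: "weak_conv_m (M \<circ> \<rho>) L" by auto
  interpret L: real_distribution L by (rule L)
  let ?g = "\<lambda>u. ann_proj (s, u)"
  have gin: "?g u \<in> annulus" for u using s by (auto simp: strip_iff)
  have gc: "continuous_on UNIV ?g"
    by (rule continuous_on_compose2[OF continuous_on_ann_proj[of UNIV]]) (auto intro!: continuous_intros)
  have gm: "?g \<in> measurable L annulus_borel"
  proof -
    have "?g \<in> measurable L borel" using borel_measurable_continuous_onI[OF gc] by simp
    then show ?thesis unfolding annulus_borel_def using gin by (intro measurable_restrict_space2) auto
  qed
  define \<mu> where "\<mu> = distr L annulus_borel ?g"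
  have "prob_space \<mu>" unfolding \<mu>_def by (rule L.prob_space_distr[OF gm])
  then have ap: "annulus_prob \<mu>" by (simp add: annulus_prob_def annulus_prob_axioms_def \<mu>_def)
  interpret annulus_prob \<mu> by (rule ap)
  have lim: "(\<lambda>j. birkhoff f \<phi> (Suc (\<rho> j)) x) \<longlonglongrightarrow> integral\<^sup>L \<mu> \<phi>" if \<phi>: "continuous_on annulus \<phi>" for \<phi>
  proof -
    have Fc: "continuous_on UNIV (\<lambda>u. \<phi> (?g u))"
      by (rule continuous_on_compose2[OF \<phi> gc]) (use gin in auto)
    have "bounded (\<phi> ` annulus)" by (intro compact_imp_bounded compact_continuous_image \<phi> compact_annulus)
    then obtain B where B: "\<And>y. y \<in> annulus \<Longrightarrow> norm (\<phi> y) \<le> B" by (auto simp: bounded_iff)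
    have "(\<lambda>j. integral\<^sup>L ((M \<circ> \<rho>) j) (\<lambda>u. \<phi> (?g u))) \<longlonglongrightarrow> integral\<^sup>L L (\<lambda>u. \<phi> (?g u))"
    proof (rule weak_conv_imp_integral_bdd_continuous_conv[OF _ L conv])
      show "real_distribution ((M \<circ> \<rho>) n)" for n using pM by simp
      show "isCont (\<lambda>u. \<phi> (?g u)) u" for u using Fc by (simp add: continuous_on_eq_continuous_at)
      show "norm (\<phi> (?g u)) \<le> B" for u using B gin by blast
    qed
    moreover have "integral\<^sup>L L (\<lambda>u. \<phi> (?g u)) = integral\<^sup>L \<mu> \<phi>"
      unfolding \<mu>_def by (rule integral_distr[OF gm borel_measurable_annulus[OF \<phi>], symmetric])
    moreover have "integral\<^sup>L ((M \<circ> \<rho>) j) (\<lambda>u. \<phi> (?g u)) = birkhoff f \<phi> (Suc (\<rho> j)) x" for j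
    proof -
      have "(\<lambda>u. \<phi> (?g u)) \<in> borel_measurable borel" by (rule borel_measurable_continuous_onI[OF Fc])
      from integral_distr[OF tm this]
      have "integral\<^sup>L (M (\<rho> j)) (\<lambda>u. \<phi> (?g u)) = integral\<^sup>L (uniform_count_measure {..<Suc (\<rho> j)}) (\<lambda>i. \<phi> (?g (t i)))"
        by (simp add: M_def)
      also have "\<dots> = birkhoff f \<phi> (Suc (\<rho> j)) x"
        unfolding birkhoff_def t(1) by (subst integral_uniform_count_measure) simp_all
      finally show ?thesis by simp
    qed
    ultimately show ?thesis by simp
  qed
  have fm: "f \<in> measurable \<mu> \<mu>" using f_meas by (simp add: measurable_cong_sets[OF sets_\<mu> sets_\<mu>])
  have "distr \<mu> \<mu> f = \<mu>"
  proof (rule annulus_measure_eqI[OF _ ap])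
    show "annulus_prob (distr \<mu> \<mu> f)"
      using prob_space_distr[OF fm] by (simp add: annulus_prob_def annulus_prob_axioms_def sets_\<mu>)
    fix \<phi> :: "pt \<Rightarrow> real" assume \<phi>: "continuous_on annulus \<phi>"
    have "bounded (\<phi> ` annulus)" by (intro compact_imp_bounded compact_continuous_image \<phi> compact_annulus)
    then obtain B where B: "\<And>y. y \<in> annulus \<Longrightarrow> \<bar>\<phi> y\<bar> \<le> B" by (auto simp: bounded_iff)
    have diff: "\<bar>birkhoff f (\<lambda>y. \<phi> (f y)) (Suc n) x - birkhoff f \<phi> (Suc n) x\<bar> \<le> 2 * B * inverse (real (Suc n))" for n
    proof -
      have "(\<Sum>i<Suc n. \<phi> (f ((f ^^ i) x))) - (\<Sum>i<Suc n. \<phi> ((f ^^ i) x)) = \<phi> ((f ^^ Suc n) x) - \<phi> x"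
        by (induction n) simp_all
      then have "birkhoff f (\<lambda>y. \<phi> (f y)) (Suc n) x - birkhoff f \<phi> (Suc n) x = (\<phi> ((f ^^ Suc n) x) - \<phi> x) / Suc n"
        by (simp only: birkhoff_def diff_divide_distrib[symmetric])
      moreover have "\<bar>\<phi> ((f ^^ Suc n) x) - \<phi> x\<bar> \<le> 2 * B"
        using B[OF funpow_in_annulus[of f x "Suc n", OF f_in x(1)]] B[OF x(1)] by linarith
      then have "\<bar>\<phi> ((f ^^ Suc n) x) - \<phi> x\<bar> / Suc n \<le> 2 * B / Suc n" by (rule divide_right_mono) simp
      ultimately have "\<bar>birkhoff f (\<lambda>y. \<phi> (f y)) (Suc n) x - birkhoff f \<phi> (Suc n) x\<bar> \<le> 2 * B / Suc n"
        by (simp only: abs_divide abs_of_nat)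
      then show ?thesis by (simp only: divide_inverse)
    qed
    have "(\<lambda>j. 2 * B * inverse (real (Suc (\<rho> j)))) \<longlonglongrightarrow> 2 * B * 0"
      by (intro tendsto_mult_left LIMSEQ_subseq_LIMSEQ[OF LIMSEQ_inverse_real_of_nat \<rho>, unfolded o_def])
    then have z: "(\<lambda>j. 2 * B * inverse (real (Suc (\<rho> j)))) \<longlonglongrightarrow> 0" by (simp only: mult_zero_right)
    have d0: "(\<lambda>j. birkhoff f (\<lambda>y. \<phi> (f y)) (Suc (\<rho> j)) x - birkhoff f \<phi> (Suc (\<rho> j)) x) \<longlonglongrightarrow> 0"
    proof (rule Lim_null_comparison[OF always_eventually z], rule allI)
      fix j
      show "norm (birkhoff f (\<lambda>y. \<phi> (f y)) (Suc (\<rho> j)) x - birkhoff f \<phi> (Suc (\<rho> j)) x) \<le> 2 * B * inverse (real (Suc (\<rho> j)))"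
        using diff[of "\<rho> j"] unfolding real_norm_def .
    qed
    have "(\<lambda>j. birkhoff f (\<lambda>y. \<phi> (f y)) (Suc (\<rho> j)) x - birkhoff f \<phi> (Suc (\<rho> j)) x)
        \<longlonglongrightarrow> integral\<^sup>L \<mu> (\<lambda>y. \<phi> (f y)) - integral\<^sup>L \<mu> \<phi>"
      by (intro tendsto_diff lim f_comp \<phi>)
    from LIMSEQ_unique[OF d0 this]
    have "integral\<^sup>L \<mu> (\<lambda>y. \<phi> (f y)) = integral\<^sup>L \<mu> \<phi>" by linarith
    moreover have "integral\<^sup>L (distr \<mu> \<mu> f) \<phi> = integral\<^sup>L \<mu> (\<lambda>y. \<phi> (f y))"
      by (rule integral_distr[OF fm meas[OF \<phi>]])
    ultimately show "integral\<^sup>L (distr \<mu> \<mu> f) \<phi> = integral\<^sup>L \<mu> \<phi>" by simp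
  qed
  then have "\<mu> \<in> invariant_measures f"
    using prob_space_axioms by (simp add: invariant_measures_def sets_\<mu>)
  moreover have "measure \<mu> (boundary_component s) = 1"
  proof -
    have "measure \<mu> (boundary_component s) = measure L (?g -` boundary_component s \<inter> space L)"
      unfolding \<mu>_def by (rule measure_distr[OF gm boundary_component_sets[OF s]])
    also have "?g -` boundary_component s \<inter> space L = space L"
      by (auto simp: boundary_component_def ann_proj_def)
    finally show ?thesis using L.prob_space by simp
  qed
  ultimately show ?thesis by blast
qed

end

context generic_map
begin

lemma boundary_invariant: "f -` boundary_component 1 \<inter> annulus = boundary_component 1"
  using f_bd[of _ 1] f_in by (auto simp: boundary_component_eq)

text \<open>
  Conditioning on an invariant set of positive measure gives an invariant measure with the same
  mass on the boundary circles, hence the same measure.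
\<close>
lemma ergodicI:
  assumes \<mu>: "\<mu> \<in> invariant_measures f"
    and b: "measure \<mu> (boundary_component 1) = 0 \<or> measure \<mu> (boundary_component 1) = 1"
  shows "\<mu> \<in> ergodic_measures f"
  unfolding ergodic_measures_def
proof (intro CollectI conjI \<mu> ballI impI)
  interpret annulus_prob \<mu> by (rule invariantD[OF \<mu>])
  have fm: "f \<in> measurable \<mu> \<mu>" using f_meas by (simp add: measurable_cong_sets[OF sets_\<mu> sets_\<mu>])
  have B1: "boundary_component 1 \<in> sets \<mu>" using boundary_component_sets by (simp add: sets_\<mu>)
  fix B assume B: "B \<in> sets \<mu>" "f -` B \<inter> space \<mu> = B"
  show "measure \<mu> B = 0 \<or> measure \<mu> B = 1"
  proof (rule disjCI)
    assume nz: "measure \<mu> B \<noteq> 1"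
    show "measure \<mu> B = 0"
    proof (rule ccontr)
      assume "measure \<mu> B \<noteq> 0"
      then have e: "emeasure \<mu> B \<noteq> 0" "emeasure \<mu> B \<noteq> \<infinity>" by (auto simp: emeasure_eq_measure)
      define \<nu> where "\<nu> = uniform_measure \<mu> B"
      have sets_\<nu>: "sets \<nu> = sets \<mu>" and sp: "space \<nu> = space \<mu>" by (simp_all add: \<nu>_def)
      have p: "prob_space \<nu>" unfolding \<nu>_def by (rule prob_space_uniform_measure[OF e])
      interpret N: prob_space \<nu> by (rule p)
      have fn: "f \<in> measurable \<nu> \<nu>" using fm by (simp add: measurable_cong_sets[OF sets_\<nu> sets_\<nu>])
      have "distr \<nu> \<nu> f = \<nu>"
      proof (rule measure_eqI)
        fix A assume "A \<in> sets (distr \<nu> \<nu> f)"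
        then have A: "A \<in> sets \<mu>" by (simp add: sets_\<nu>)
        then have A': "f -` A \<inter> space \<mu> \<in> sets \<mu>" by (rule measurable_sets[OF fm])
        have "emeasure (distr \<nu> \<nu> f) A = emeasure \<nu> (f -` A \<inter> space \<mu>)"
          using A fn by (simp add: emeasure_distr sets_\<nu> sp)
        also have "\<dots> = emeasure \<mu> (B \<inter> (f -` A \<inter> space \<mu>)) / emeasure \<mu> B"
          unfolding \<nu>_def by (rule emeasure_uniform_measure[OF B(1) A'])
        also have "B \<inter> (f -` A \<inter> space \<mu>) = f -` (B \<inter> A) \<inter> space \<mu>" using B(2) by blast
        also have "emeasure \<mu> (f -` (B \<inter> A) \<inter> space \<mu>) = emeasure (distr \<mu> \<mu> f) (B \<inter> A)"
          using A B(1) fm by (subst emeasure_distr) auto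
        also have "\<dots> = emeasure \<mu> (B \<inter> A)" by (simp add: invariantD(2)[OF \<mu>])
        also have "emeasure \<mu> (B \<inter> A) / emeasure \<mu> B = emeasure \<nu> A"
          unfolding \<nu>_def by (rule emeasure_uniform_measure[OF B(1) A, symmetric])
        finally show "emeasure (distr \<nu> \<nu> f) A = emeasure \<nu> A" .
      qed simp
      then have \<nu>: "\<nu> \<in> invariant_measures f"
        using p by (simp add: invariant_measures_def sets_\<nu> sets_\<mu>)
      have "measure \<nu> (boundary_component 1) = measure \<mu> (boundary_component 1)"
        using b
      proof
        assume 0: "measure \<mu> (boundary_component 1) = 0"
        then have "AE x in \<mu>. x \<notin> boundary_component 1" using prob_eq_0[OF B1] by simp
        then have "AE x in \<nu>. x \<notin> boundary_component 1"
          unfolding \<nu>_def by (intro AE_uniform_measureI B(1)) auto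
        then show ?thesis using N.prob_eq_0[of "boundary_component 1"] B1 0 by (simp add: sets_\<nu>)
      next
        assume 1: "measure \<mu> (boundary_component 1) = 1"
        then have "AE x in \<mu>. x \<in> boundary_component 1" using prob_eq_1[OF B1] by simp
        then have "AE x in \<nu>. x \<in> boundary_component 1"
          unfolding \<nu>_def by (intro AE_uniform_measureI B(1)) auto
        then show ?thesis using N.prob_eq_1[of "boundary_component 1"] B1 1 by (simp add: sets_\<nu>)
      qed
      then have "\<nu> = \<mu>" by (rule invariant_unique[OF \<nu> \<mu>])
      moreover have "emeasure \<nu> B = 1" unfolding \<nu>_def by (rule emeasure_uniform_measure_1[OF e])
      ultimately show False using nz by (simp add: emeasure_eq_measure)
    qed
  qed
qed

lemma two_ergodic_measures:
  "\<exists>\<mu>\<^sub>0 \<mu>\<^sub>1. \<mu>\<^sub>0 \<noteq> \<mu>\<^sub>1 \<and> ergodic_measures f = {\<mu>\<^sub>0, \<mu>\<^sub>1} \<and>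
     measure \<mu>\<^sub>0 (boundary_component 0) = 1 \<and> measure \<mu>\<^sub>1 (boundary_component 1) = 1"
proof -
  obtain \<mu>\<^sub>0 where \<mu>0: "\<mu>\<^sub>0 \<in> invariant_measures f" "measure \<mu>\<^sub>0 (boundary_component 0) = 1"
    using invariant_on_boundary[of 0] by auto
  obtain \<mu>\<^sub>1 where \<mu>1: "\<mu>\<^sub>1 \<in> invariant_measures f" "measure \<mu>\<^sub>1 (boundary_component 1) = 1"
    using invariant_on_boundary[of 1] by auto
  have \<mu>01: "measure \<mu>\<^sub>0 (boundary_component 1) = 0"
    using measure_boundary_sum[OF \<mu>0(1)] \<mu>0(2) by simp
  have "ergodic_measures f = {\<mu>\<^sub>0, \<mu>\<^sub>1}"
  proof (intro equalityI subsetI)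
    fix \<nu> assume e: "\<nu> \<in> ergodic_measures f"
    then have \<nu>: "\<nu> \<in> invariant_measures f" by (simp add: ergodic_measures_def)
    interpret annulus_prob \<nu> by (rule invariantD[OF \<nu>])
    have "boundary_component 1 \<in> sets \<nu>" using boundary_component_sets by (simp add: sets_\<mu>)
    moreover have "f -` boundary_component 1 \<inter> space \<nu> = boundary_component 1"
      using boundary_invariant by (simp add: space_\<mu>)
    ultimately have "measure \<nu> (boundary_component 1) = 0 \<or> measure \<nu> (boundary_component 1) = 1"
      using e unfolding ergodic_measures_def by blast
    then have "\<nu> = \<mu>\<^sub>0 \<or> \<nu> = \<mu>\<^sub>1"
      using invariant_unique[OF \<nu> \<mu>0(1)] invariant_unique[OF \<nu> \<mu>1(1)] \<mu>01 \<mu>1(2) by auto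
    then show "\<nu> \<in> {\<mu>\<^sub>0, \<mu>\<^sub>1}" by blast
  next
    fix \<nu> assume "\<nu> \<in> {\<mu>\<^sub>0, \<mu>\<^sub>1}"
    then show "\<nu> \<in> ergodic_measures f"
      using ergodicI[OF \<mu>0(1)] ergodicI[OF \<mu>1(1)] \<mu>01 \<mu>1(2) by blast
  qed
  moreover have "\<mu>\<^sub>0 \<noteq> \<mu>\<^sub>1" using \<mu>01 \<mu>1(2) by auto
  ultimately show ?thesis using \<mu>0(2) \<mu>1(2) by blast
qed

section \<open>Maximal oscillation\<close>

definition typical :: "nat \<Rightarrow> nat \<Rightarrow> real \<Rightarrow> real \<Rightarrow> pt set" where
  "typical n N c e = {x\<in>annulus. \<forall>\<phi>\<in>monoms_upto N.
     \<bar>birkhoff f \<phi> n x - ((1 - c) * birkhoff f \<phi> n (0, 1) + c * birkhoff f \<phi> n (1, 1))\<bar> \<le> e}"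

text \<open>
  For each weight the good points at stage \<open>N\<close> have measure at least \<open>1 - 1/(N + 1)\<close>, so almost every
  point is good for infinitely many stages.
\<close>
lemma AE_typical:
  "AE x in annulus_lebesgue. \<forall>c\<in>\<rat> \<inter> {0..1}. \<forall>N0. \<exists>N\<ge>N0. \<exists>n\<ge>N. 0 < n \<and>
     (\<exists>e < 1 / (real N + 1). oscillates_at f (monoms_upto N) c e n \<and> x \<in> typical n N c e)"
proof (rule AE_ball_countable')
  show "countable (\<rat> \<inter> {0..1::real})" by (intro countable_Int1 countable_rat)
  fix c :: real assume c: "c \<in> \<rat> \<inter> {0..1}"
  let ?P = "\<lambda>N n e. n \<ge> N \<and> 0 < n \<and> e < 1 / (real N + 1) \<and> oscillates_at f (monoms_upto N) c e n"
  have "\<exists>n e. ?P N n e" for N using osc[of c N] c by auto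
  then obtain n e where ne: "\<And>N. ?P N (n N) (e N)" by metis
  define T where "T = (\<lambda>N. typical (n N) N c (e N))"
  have meas: "T N \<in> sets annulus_lebesgue" for N
    unfolding T_def typical_def annulus_lebesgue_simps
    by (rule typical_set_measurable[OF f_cont f_in finite_monoms_upto monoms_upto_props(1)])
  have big: "1 - 1 / (real N + 1) \<le> measure annulus_lebesgue (T N)" for N
  proof -
    have "1 - e N \<le> measure annulus_lebesgue (T N)"
      using ne[of N] unfolding oscillates_at_def T_def typical_def by blast
    then show ?thesis using ne[of N] by linarith
  qed
  have "AE x in annulus_lebesgue. \<exists>N\<ge>N0. x \<in> T N" for N0
  proof -
    let ?U = "\<Union>N\<in>{N0..}. T N"
    have U: "?U \<in> sets annulus_lebesgue" using meas by (intro sets.countable_UN') auto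
    have le: "1 - 1 / (real k + 1) \<le> measure annulus_lebesgue ?U" for k
    proof -
      have "measure annulus_lebesgue (T (N0 + k)) \<le> measure annulus_lebesgue ?U"
        by (intro leb.finite_measure_mono U UN_upper) simp
      moreover have "1 / (real (N0 + k) + 1) \<le> 1 / (real k + 1)" by (intro divide_left_mono) auto
      ultimately show ?thesis using big[of "N0 + k"] by linarith
    qed
    have "(\<lambda>k. 1 - 1 / (real k + 1)) \<longlonglongrightarrow> 1 - 0"
      using LIMSEQ_inverse_real_of_nat by (intro tendsto_diff) (auto simp: inverse_eq_divide add.commute)
    then have "1 - 0 \<le> measure annulus_lebesgue ?U"
      by (rule LIMSEQ_le_const2) (use le in blast)
    then have "measure annulus_lebesgue ?U = 1" by (intro antisym leb.prob_le_1) simp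
    then have "AE x in annulus_lebesgue. x \<in> ?U" using leb.prob_eq_1[OF U] by simp
    then show ?thesis by eventually_elim auto
  qed
  then have "AE x in annulus_lebesgue. \<forall>N0. \<exists>N\<ge>N0. x \<in> T N" by (simp add: AE_all_countable)
  then show "AE x in annulus_lebesgue. \<forall>N0. \<exists>N\<ge>N0. \<exists>n\<ge>N. 0 < n \<and>
     (\<exists>e < 1 / (real N + 1). oscillates_at f (monoms_upto N) c e n \<and> x \<in> typical n N c e)"
  proof eventually_elim
    case (elim x)
    show ?case
    proof
      fix N0
      obtain N where "N \<ge> N0" "x \<in> T N" using elim by blast
      then show "\<exists>N\<ge>N0. \<exists>n\<ge>N. 0 < n \<and>
          (\<exists>e < 1 / (real N + 1). oscillates_at f (monoms_upto N) c e n \<and> x \<in> typical n N c e)"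
        using ne[of N] unfolding T_def by blast
    qed
  qed
qed

lemma birkhoff_bound:
  assumes "x \<in> annulus" "\<And>x. x \<in> annulus \<Longrightarrow> \<bar>\<phi> x\<bar> \<le> 1" shows "\<bar>birkhoff f \<phi> n x\<bar> \<le> 1"
proof -
  have "\<bar>birkhoff f \<phi> n x - birkhoff f (\<lambda>_. 0) n x\<bar> \<le> 1"
    by (rule birkhoff_close) (use f_in assms in auto)
  then show ?thesis by (simp add: birkhoff_def)
qed

lemma rational_close:
  assumes "0 \<le> (c::real)" "c \<le> 1" "0 < \<epsilon>"
  obtains c' where "c' \<in> \<rat> \<inter> {0..1}" "\<bar>c - c'\<bar> \<le> \<epsilon>"
proof (cases "c = 1")
  case True
  then show ?thesis using that[of 1] assms by auto
next
  case False
  then have "c < min 1 (c + \<epsilon>)" using assms by auto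
  then obtain q where "q \<in> \<rat>" "c < q" "q < min 1 (c + \<epsilon>)" using Rats_dense_in_real by blast
  then show ?thesis using that[of q] assms by auto
qed

text \<open>
  The weight of \<open>\<mu>\<close> is approximated by a rational one; replacing \<open>c\<close> by \<open>c'\<close> moves the mixture of two
  numbers in \<open>[-1,1]\<close> by at most \<open>2 \<bar>c - c'\<bar>\<close>.
\<close>
lemma empirical_near_invariant:
  assumes x: "x \<in> annulus"
    and typical: "\<forall>c\<in>\<rat> \<inter> {0..1}. \<forall>N0. \<exists>N\<ge>N0. \<exists>n\<ge>N. 0 < n \<and>
     (\<exists>e < 1 / (real N + 1). oscillates_at f (monoms_upto N) c e n \<and> x \<in> typical n N c e)"
    and \<mu>: "\<mu> \<in> invariant_measures f"
  shows "\<exists>n>m. \<forall>\<phi>\<in>monoms_upto j. \<bar>birkhoff f \<phi> n x - integral\<^sup>L \<mu> \<phi>\<bar> \<le> 4 * (1 / (real j + 1))"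
proof -
  interpret annulus_prob \<mu> by (rule invariantD[OF \<mu>])
  define c where "c = measure \<mu> (boundary_component 1)"
  obtain c' where c': "c' \<in> \<rat> \<inter> {0..1}" "\<bar>c - c'\<bar> \<le> 1 / (real j + 1)"
    using rational_close[of c "1 / (real j + 1)"] by (auto simp: c_def)
  obtain N n e where N: "N \<ge> max j (Suc m)" "n \<ge> N" "0 < n" "e < 1 / (real N + 1)"
    "oscillates_at f (monoms_upto N) c' e n" "x \<in> typical n N c' e"
    using typical c'(1) by metis
  have "1 / (real N + 1) \<le> 1 / (real j + 1)" using N(1) by (intro divide_left_mono) auto
  then have e: "e \<le> 1 / (real j + 1)" using N(4) by linarith
  have "\<bar>birkhoff f \<phi> n x - integral\<^sup>L \<mu> \<phi>\<bar> \<le> 4 * (1 / (real j + 1))" if \<phi>: "\<phi> \<in> monoms_upto j" for \<phi>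
  proof -
    have \<phi>N: "\<phi> \<in> monoms_upto N" using \<phi> N(1) by (auto simp: monoms_upto_def)
    define u v where "u = birkhoff f \<phi> n (0, 1)" and "v = birkhoff f \<phi> n (1, 1)"
    have 1: "\<bar>birkhoff f \<phi> n x - ((1 - c') * u + c' * v)\<bar> \<le> e"
      using N(6) \<phi>N unfolding typical_def u_def v_def by blast
    have 2: "\<bar>integral\<^sup>L \<mu> \<phi> - ((1 - c) * u + c * v)\<bar> \<le> e"
      unfolding u_def v_def c_def
      by (rule integral_approx[OF \<mu> \<phi>N monoms_upto_props(1)[OF \<phi>] N(3,5)])
    have "\<bar>u\<bar> \<le> 1" "\<bar>v\<bar> \<le> 1"
      unfolding u_def v_def by (intro birkhoff_bound monoms_upto_props(2)[OF \<phi>]; simp add: annulus_iff)+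
    then have "\<bar>v - u\<bar> \<le> 2" by linarith
    then have "\<bar>c - c'\<bar> * \<bar>v - u\<bar> \<le> (1 / (real j + 1)) * 2" using c'(2) by (intro mult_mono) auto
    moreover have "((1 - c) * u + c * v) - ((1 - c') * u + c' * v) = (c - c') * (v - u)"
      by (simp add: algebra_simps)
    ultimately have 3: "\<bar>((1 - c) * u + c * v) - ((1 - c') * u + c' * v)\<bar> \<le> (1 / (real j + 1)) * 2"
      by (simp only: abs_mult)
    have "\<bar>a - b\<bar> \<le> 4 * s" if "\<bar>a - w\<bar> \<le> e" "\<bar>b - w'\<bar> \<le> e" "\<bar>w' - w\<bar> \<le> s * 2" "e \<le> s" for a b w w' s :: real
      using that by linarith
    from this[OF 1 2 3 e] show ?thesis .
  qed
  moreover have "n > m" using N(1,2) by auto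
  ultimately show ?thesis by blast
qed

lemma maximally_oscillating: "maximally_oscillating f"
  unfolding maximally_oscillating_def
  using AE_typical AE_space
proof eventually_elim
  case (elim x)
  then have x: "x \<in> annulus" by simp
  show ?case
  proof
    fix \<mu> assume \<mu>: "\<mu> \<in> invariant_measures f"
    let ?P = "\<lambda>j n. 1 \<le> n \<and> (\<forall>\<phi>\<in>monoms_upto j. \<bar>birkhoff f \<phi> n x - integral\<^sup>L \<mu> \<phi>\<bar> \<le> 4 * (1 / (real j + 1)))"
    have ex: "\<exists>n. ?P j n \<and> m < n" for j m
    proof -
      obtain n where "n > m" "\<forall>\<phi>\<in>monoms_upto j. \<bar>birkhoff f \<phi> n x - integral\<^sup>L \<mu> \<phi>\<bar> \<le> 4 * (1 / (real j + 1))"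
        using empirical_near_invariant[OF x elim(1) \<mu>, of m j] by blast
      then show ?thesis by (intro exI[of _ n]) simp
    qed
    have "\<exists>\<sigma>. \<forall>j. ?P j (\<sigma> j) \<and> \<sigma> j < \<sigma> (Suc j)"
      by (rule dependent_nat_choice) (use ex in blast)+
    then obtain \<sigma> where \<sigma>: "\<And>j. ?P j (\<sigma> j)" "\<And>j. \<sigma> j < \<sigma> (Suc j)" by blast
    have mono: "(\<lambda>j. birkhoff f (monom3 m) (\<sigma> j) x) \<longlonglongrightarrow> integral\<^sup>L \<mu> (monom3 m)" for m
    proof -
      obtain i k l where m: "m = (i, k, l)" by (cases m)
      have "\<forall>\<^sub>F j in sequentially. norm (birkhoff f (monom3 m) (\<sigma> j) x - integral\<^sup>L \<mu> (monom3 m)) \<le> 4 * (1 / (real j + 1))"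
        unfolding eventually_sequentially
      proof (intro exI allI impI)
        fix j assume "i + k + l \<le> j"
        then have "monom3 m \<in> monoms_upto j" unfolding m by (intro monom3_in_monoms_upto) auto
        then show "norm (birkhoff f (monom3 m) (\<sigma> j) x - integral\<^sup>L \<mu> (monom3 m)) \<le> 4 * (1 / (real j + 1))"
          using \<sigma>(1)[of j] by simp
      qed
      moreover have "(\<lambda>j. 4 * (1 / (real j + 1))) \<longlonglongrightarrow> 4 * 0"
        using LIMSEQ_inverse_real_of_nat by (intro tendsto_mult_left) (simp add: inverse_eq_divide add.commute)
      then have "(\<lambda>j. 4 * (1 / (real j + 1))) \<longlonglongrightarrow> 0" by (simp only: mult_zero_right)
      ultimately have "(\<lambda>j. birkhoff f (monom3 m) (\<sigma> j) x - integral\<^sup>L \<mu> (monom3 m)) \<longlonglongrightarrow> 0"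
        by (rule Lim_null_comparison)
      then show ?thesis by (rule LIM_zero_cancel)
    qed
    have "weak_star_limit (\<lambda>j. empirical_measure f x (\<sigma> j)) \<mu>"
      unfolding weak_star_limit_def
    proof (intro allI impI)
      fix \<phi> :: "pt \<Rightarrow> real" assume \<phi>: "continuous_on annulus \<phi>"
      have "(\<lambda>j. birkhoff f \<phi> (\<sigma> j) x) \<longlonglongrightarrow> integral\<^sup>L \<mu> \<phi>"
      proof (rule weak_limit_from_monomials[where A = "\<lambda>j \<phi>. birkhoff f \<phi> (\<sigma> j) x", OF invariantD(1)[OF \<mu>] birkhoff_add birkhoff_scale _ mono \<phi>])
        fix j :: nat and \<phi> p :: "pt \<Rightarrow> real" and e
        assume c: "\<And>x. x \<in> annulus \<Longrightarrow> \<bar>\<phi> x - p x\<bar> < e"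
        have "0 \<le> e" using c[OF x] by linarith
        then show "\<bar>birkhoff f \<phi> (\<sigma> j) x - birkhoff f p (\<sigma> j) x\<bar> \<le> e"
          using c by (intro birkhoff_close f_in x) (auto intro: less_imp_le)
      qed
      then show "(\<lambda>j. integral\<^sup>L (empirical_measure f x (\<sigma> j)) \<phi>) \<longlonglongrightarrow> integral\<^sup>L \<mu> \<phi>"
        by (simp add: integral_empirical[OF f_in x \<phi>])
    qed
    moreover have "strict_mono \<sigma>" using \<sigma>(2) by (simp add: strict_mono_Suc_iff)
    moreover have "1 \<le> \<sigma> 0" using \<sigma>(1) by blast
    ultimately show "\<exists>\<sigma>. strict_mono \<sigma> \<and> 1 \<le> \<sigma> 0 \<and>
        weak_star_limit (\<lambda>j. empirical_measure f x (\<sigma> j)) \<mu>" by blast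
  qed
qed

end

text \<open>
  The boundary circles are preserved because this holds for conjugates of rotations, the interior
  because the map is a homeomorphism.
\<close>
lemma generic_map_generic_maps:
  assumes "f \<in> generic_maps r" shows "generic_map f"
proof
  have f: "f \<in> topspace (AK_space r)" and o: "\<And>N c. c \<in> \<rat> \<Longrightarrow> 0 \<le> c \<Longrightarrow> c \<le> 1 \<Longrightarrow> f \<in> oscillating_set r N c"
    using assms by (auto simp: generic_maps_def)
  show "continuous_on annulus f" "\<And>x. x \<in> annulus \<Longrightarrow> f x \<in> annulus"
    using AK_space_homeomorphism[OF f] by blast+
  show "\<exists>n\<ge>N. 0 < n \<and> (\<exists>e < 1 / (real N + 1). oscillates_at f (monoms_upto N) c e n)"
    if "c \<in> \<rat>" "0 \<le> c" "c \<le> 1" for N c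
    using o[OF that, of N] by (auto simp: oscillating_set_def)
  fix x :: pt and s :: real assume x: "x \<in> annulus" and s: "s = 0 \<or> s = 1"
  obtain g where hom: "Cr_homeo r f g"
    using AK_space_in_Diff_plus[OF f] by (auto simp: Diff_plus_def Diff_ann_def Cr_homeo_def)
  show "fst (f x) = s \<longleftrightarrow> fst x = s"
  proof (cases "fst x = 0 \<or> fst x = 1")
    case True
    then show ?thesis using AK_space_boundary[OF f x] by simp
  next
    case False
    then have "0 < fst x" "fst x < 1" using x by (cases x; auto simp: annulus_iff)+
    from Cr_homeo_interior[OF hom x this] False show ?thesis using s by auto
  qed
qed

theorem theoremA:
  fixes r :: enat
  shows "\<exists>G. baire_generic (AK_space r) G \<and>
    (\<forall>f\<in>G.
       (\<exists>\<mu>\<^sub>0 \<mu>\<^sub>1. \<mu>\<^sub>0 \<noteq> \<mu>\<^sub>1 \<and> ergodic_measures f = {\<mu>\<^sub>0, \<mu>\<^sub>1} \<and>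
          measure \<mu>\<^sub>0 (boundary_component 0) = 1 \<and>
          measure \<mu>\<^sub>1 (boundary_component 1) = 1) \<and>
       maximally_oscillating f)"
proof (rule exI[of _ "generic_maps r"], rule conjI)
  show "baire_generic (AK_space r) (generic_maps r)"
    by (rule baire_generic_generic_maps)
  show "\<forall>f\<in>generic_maps r.
       (\<exists>\<mu>\<^sub>0 \<mu>\<^sub>1. \<mu>\<^sub>0 \<noteq> \<mu>\<^sub>1 \<and> ergodic_measures f = {\<mu>\<^sub>0, \<mu>\<^sub>1} \<and>
          measure \<mu>\<^sub>0 (boundary_component 0) = 1 \<and>
          measure \<mu>\<^sub>1 (boundary_component 1) = 1) \<and>
       maximally_oscillating f"
  proof
    fix f assume "f \<in> generic_maps r"
    then interpret generic_map f by (rule generic_map_generic_maps)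
    show "(\<exists>\<mu>\<^sub>0 \<mu>\<^sub>1. \<mu>\<^sub>0 \<noteq> \<mu>\<^sub>1 \<and> ergodic_measures f = {\<mu>\<^sub>0, \<mu>\<^sub>1} \<and>
          measure \<mu>\<^sub>0 (boundary_component 0) = 1 \<and>
          measure \<mu>\<^sub>1 (boundary_component 1) = 1) \<and> maximally_oscillating f"
      using two_ergodic_measures maximally_oscillating by (rule conjI)
  qed
qed

end
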